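(* Let $T>0$ and let $G\colon\mathbb{R}^{2n}\to[0,\infty)$ be a G-function such that $G\in\Gamma(\mathbb{R}^{2n})$, $G^\star$ is semi-symplectic and $G^\star\in\Delta_2$. Let $\mathcal{H}\colon[0,T]\times\mathbb{R}^{2n}\to\mathbb{R}$ be of class $C^1$ with $\mathcal{H}(t,\cdot)\in\Gamma(\mathbb{R}^{2n})$ for every $t$. Suppose that: (1) there exists $\xi\in \mathbf{L}^{G^\star}([0,T],\mathbb{R}^{2n})$ such that for every $u\in\mathbb{R}^{2n}$ and a.e. $t\in[0,T]$, $\mathcal{H}(t,u)\ge\langle \xi(t),u\rangle$; (2) there exist $\Lambda>0$ with $\Lambda^{-1}>T\max\{1,C_{G^\star}(T)/2\}$ and $\alpha\in \mathbf{L}^1([0,T],\mathbb{R})$ such that for every $u\in\mathbb{R}^{2n}$ and a.e. $t\in[0,T]$, $\mathcal{H}(t,u)\le G(\Lambda u)+\alpha(t)$; (3) $\int_0^T\mathcal{H}(t,u)\,dt\to+\infty$ as $|u|\to+\infty$, $u\in\mathbb{R}^{2n}$. Then there exists $u\in \mathbf{W}^1_T\mathbf{L}^{G}([0,T],\mathbb{R}^{2n})$ which is a solution of $$\dot u=J\nabla\mathcal{H}(t,u)\ \text{ a.e. on }[0,T],\qquad u(0)=u(T),$$ and such that $v=-J\widetilde u$, where $\widetilde u=u-\frac1T\int_0^Tu\,dt$, minimizes the dual action $$\chi(v)=\int_0^T\frac12\langle J\dot v,v\rangle+\mathcal{H}^\star(t,\dot v)\,dt$$ over $\mathbf{W}^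1_T\mathbf{L}^{G^\star}([0,T],\mathbb{R}^{2n})$.
   Context: $J=\begin{pmatrix}0&I_n\\-I_n&0\end{pmatrix}$ is the canonical symplectic matrix. $\nabla\mathcal{H}(t,u)$ is the gradient in $u$. $\Gamma(\mathbb{R}^{m})$ is the set of differentiable, strictly convex functions $F\colon\mathbb{R}^m\to\mathbb{R}$ with $\lim_{|u|\to\infty}F(u)/|u|=\infty$. The convex conjugate of $F$ is $F^\star(v)=\sup_u\{\langle u,v\rangle-F(u)\}$; $\mathcal{H}^\star(t,\cdot)$ is the conjugate of $\mathcal{H}(t,\cdot)$. A G-function is a convex function $G\colon\mathbb{R}^m\to[0,\infty)$ with $G(u)=0\iff u=0$, $G(-u)=G(u)$, and $\lim_{|u|\to\infty}G(u)/|u|=\infty$; then $G^\star$ is also a G-function. $G\in\Delta_2$ means there is $C>0$ with $G(2u)\le CG(u)+1$ for all $u$. $G_1\prec G_2$ means there are $K>0$, $C\ge0$ with $G_1(u)\le G_2(Ku)+C$ for all $u$. A G-function $F$ on $\mathbb{R}^{2n}$ is semi-symplectic if $F^\star(J\cdot)\prec F$. Orlicz space: $\mathbf{L}^G([0,T],\mathbb{R}^m)$ is the set of (classes of) measurable $u\colon[0,T]\to\mathbb{R}^m$ with $\int_0^TG(\lambda u)\,dt<\infty$ for some $\lambda>0$, with the Luxemburg norm $\|u\|_{\mathbf{L}^G}=\inf\{\lambda>0:\int_0^TG(u/\lambda)\,dt\le1\}$. $\mathbf{W}^1\mathbf{L}^G$ is the space of absolutely continuous $u\in\mathbf{L}^G$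 with $\dot u\in \mathbf{L}^G$, and $\mathbf{W}^1_T\mathbf{L}^G=\{u\in\mathbf{W}^1\mathbf{L}^G:u(0)=u(T)\}$. For a G-function $F$ on $\mathbb{R}^{2n}$, $$C_F(T)=-\inf\left\{\frac{\int_0^T\langle J\dot u,u\rangle\,dt}{\int_0^TF(T\dot u)\,dt}:\ u\in\mathbf{W}^1_T\mathbf{L}^F([0,T],\mathbb{R}^{2n}),\ u\text{ nonconstant}\right\}\in[0,+\infty],$$ and condition (2) in particular requires $C_{G^\star}(T)<\infty$. *)

theory Defs
  imports "HOL-Analysis.Analysis"
begin

section \<open>Symplectic structure and gradient\<close>

text \<open>The space of dimension \<open>2n\<close> is \<open>real ^ ('n + 'n)\<close>: the \<open>Inl\<close> indices are the first
  \<open>n\<close> coordinates, the \<open>Inr\<close> indices the last \<open>n\<close>.\<close>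

definition symplectic_J :: "real ^ ('n + 'n) ^ ('n::finite + 'n)" where
  "symplectic_J = (\<chi> i j. case (i, j) of
      (Inl a, Inr b) \<Rightarrow> if a = b then 1 else 0
    | (Inr a, Inl b) \<Rightarrow> if a = b then - 1 else 0
    | _ \<Rightarrow> 0)"

definition gradient :: "('a::real_inner \<Rightarrow> real) \<Rightarrow> 'a \<Rightarrow> 'a" where
  "gradient f x = (THE D. GDERIV f x :> D)"

text \<open>The derivative is taken within \<open>S\<close>, so it is one-sided at boundary points of \<open>S\<close>.\<close>

definition C1_on :: "'a::real_normed_vector set \<Rightarrow> ('a \<Rightarrow> 'b::real_normed_vector) \<Rightarrow> bool" where
  "C1_on S f \<longleftrightarrow> (\<exists>f' :: 'a \<Rightarrow> 'a \<Rightarrow>\<^sub>L 'b.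
     (\<forall>x\<in>S. (f has_derivative blinfun_apply (f' x)) (at x within S)) \<and> continuous_on S f')"


section \<open>Convex functions and G-functions\<close>

definition superlinear :: "('a::euclidean_space \<Rightarrow> real) \<Rightarrow> bool" where
  "superlinear F \<longleftrightarrow> filterlim (\<lambda>u. F u / norm u) at_top at_infinity"

definition strictly_convex :: "('a::real_vector \<Rightarrow> real) \<Rightarrow> bool" where
  "strictly_convex F \<longleftrightarrow> (\<forall>x y t. x \<noteq> y \<longrightarrow> 0 < t \<longrightarrow> t < 1 \<longrightarrow>
     F ((1 - t) *\<^sub>R x + t *\<^sub>R y) < (1 - t) * F x + t * F y)"

definition Gamma_class :: "('a::euclidean_space \<Rightarrow> real) set" where
  "Gamma_class = {F. F differentiable_on UNIV \<and> strictly_convex F \<and> superlinear F}"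

definition G_function :: "('a::euclidean_space \<Rightarrow> real) \<Rightarrow> bool" where
  "G_function G \<longleftrightarrow> convex_on UNIV G \<and> (\<forall>u. 0 \<le> G u) \<and> (\<forall>u. G u = 0 \<longleftrightarrow> u = 0) \<and>
     (\<forall>u. G (- u) = G u) \<and> superlinear G"

text \<open>A supremum in \<open>real\<close> is meaningful only for sets bounded above. Lemma
  \<open>bdd_above_convex_conjugate\<close> shows that this is the case for all continuous superlinear
  functions, in particular for all G-functions and all members of \<open>Gamma_class\<close>.\<close>

definition convex_conjugate :: "('a::euclidean_space \<Rightarrow> real) \<Rightarrow> 'a \<Rightarrow> real" where
  "convex_conjugate F v = (SUP u. u \<bullet> v - F u)"

lemma bdd_above_convex_conjugate:
  fixes F :: "'a::euclidean_space \<Rightarrow> real"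
  assumes cont: "continuous_on UNIV F" and sup: "superlinear F"
  shows "bdd_above (range (\<lambda>u. u \<bullet> v - F u))"
proof -
  have "\<forall>\<^sub>F u in at_infinity. norm v \<le> F u / norm u"
    using sup unfolding superlinear_def filterlim_at_top by blast
  then obtain b where b: "\<And>u. b \<le> norm u \<Longrightarrow> norm v \<le> F u / norm u"
    unfolding eventually_at_infinity by blast
  define R where "R = max b 1"
  have out: "u \<bullet> v - F u \<le> 0" if "R \<le> norm u" for u
  proof -
    have "norm v \<le> F u / norm u" "0 < norm u"
      using that b[of u] by (auto simp: R_def)
    then have "norm v * norm u \<le> F u"
      by (simp add: field_simps)
    moreover have "u \<bullet> v \<le> norm u * norm v"
      by (rule norm_cauchy_schwarz)
    ultimately show ?thesis
      by (simp add: mult.commute)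
  qed
  have "compact ((\<lambda>u. u \<bullet> v - F u) ` cball 0 R)"
    by (intro compact_continuous_image continuous_intros continuous_on_subset[OF cont]) auto
  then have "bdd_above ((\<lambda>u. u \<bullet> v - F u) ` cball 0 R)"
    by (intro bounded_imp_bdd_above compact_imp_bounded)
  then obtain M where "\<And>u. norm u \<le> R \<Longrightarrow> u \<bullet> v - F u \<le> M"
    by (fastforce simp: bdd_above_def)
  with out have "u \<bullet> v - F u \<le> max 0 M" for u
    by (meson linear max.coboundedI1 max.coboundedI2)
  then show ?thesis
    by (intro bdd_aboveI) auto
qed

definition Delta2 :: "('a::real_vector \<Rightarrow> real) \<Rightarrow> bool" where
  "Delta2 G \<longleftrightarrow> (\<exists>C>0. \<forall>u. G (2 *\<^sub>R u) \<le> C * G u + 1)"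

definition dominated_by :: "('a::real_vector \<Rightarrow> real) \<Rightarrow> ('a \<Rightarrow> real) \<Rightarrow> bool" (infix "\<prec>\<^sub>G" 50) where
  "G1 \<prec>\<^sub>G G2 \<longleftrightarrow> (\<exists>K>0. \<exists>C\<ge>0. \<forall>u. G1 u \<le> G2 (K *\<^sub>R u) + C)"

definition semi_symplectic :: "(real ^ ('n::finite + 'n) \<Rightarrow> real) \<Rightarrow> bool" where
  "semi_symplectic F \<longleftrightarrow> (\<lambda>u. convex_conjugate F (symplectic_J *v u)) \<prec>\<^sub>G F"


section \<open>Orlicz and Orlicz--Sobolev spaces\<close>

text \<open>Functions on \<open>[0,T]\<close> are total functions on \<open>real\<close>, of which only the values on \<open>{0..T}\<close>
  matter; classes modulo null sets are represented by their members.\<close>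

definition orlicz :: "real \<Rightarrow> ('a::euclidean_space \<Rightarrow> real) \<Rightarrow> (real \<Rightarrow> 'a) set" where
  "orlicz T G = {u \<in> borel_measurable (lebesgue_on {0..T}).
     \<exists>c>0. (\<integral>\<^sup>+t. ennreal (G (c *\<^sub>R u t)) \<partial>lebesgue_on {0..T}) < \<infinity>}"

definition abs_continuous_on :: "real \<Rightarrow> real \<Rightarrow> (real \<Rightarrow> 'a::real_normed_vector) \<Rightarrow> bool" where
  "abs_continuous_on a b u \<longleftrightarrow> (\<forall>\<epsilon>>0. \<exists>\<delta>>0. \<forall>D.
     finite D \<and> (\<forall>(x, y)\<in>D. a \<le> x \<and> x \<le> y \<and> y \<le> b) \<and>
     disjoint_family_on (\<lambda>(x, y). {x<..<y}) D \<and> (\<Sum>(x, y)\<in>D. y - x) < \<delta> \<longrightarrow>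
     (\<Sum>(x, y)\<in>D. norm (u y - u x)) < \<epsilon>)"

text \<open>The a.e. derivative; at points of non-differentiability, which form a null set if \<open>u\<close> is
  absolutely continuous, the value is unspecified.\<close>

abbreviation time_deriv :: "real \<Rightarrow> (real \<Rightarrow> 'a::real_normed_vector) \<Rightarrow> real \<Rightarrow> 'a" where
  "time_deriv T u t \<equiv> vector_derivative u (at t within {0..T})"

definition W1L :: "real \<Rightarrow> ('a::euclidean_space \<Rightarrow> real) \<Rightarrow> (real \<Rightarrow> 'a) set" where
  "W1L T G = {u \<in> orlicz T G. abs_continuous_on 0 T u \<and> time_deriv T u \<in> orlicz T G}"

definition W1L_per :: "real \<Rightarrow> ('a::euclidean_space \<Rightarrow> real) \<Rightarrow> (real \<Rightarrow> 'a) set" where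
  "W1L_per T G = {u \<in> W1L T G. u 0 = u T}"


section \<open>The constant and the dual action\<close>

text \<open>The denominator may be infinite if \<open>F\<close> is not \<open>\<Delta>\<^sub>2\<close>; the quotient is then \<open>0\<close>.\<close>

definition C_const :: "(real ^ ('n::finite + 'n) \<Rightarrow> real) \<Rightarrow> real \<Rightarrow> ereal" where
  "C_const F T = - (INF u \<in> {u \<in> W1L_per T F. \<not> u constant_on {0..T}}.
     ereal (LINT t|lebesgue_on {0..T}. (symplectic_J *v time_deriv T u t) \<bullet> u t) /
     enn2ereal (\<integral>\<^sup>+t. ennreal (F (T *\<^sub>R time_deriv T u t)) \<partial>lebesgue_on {0..T}))"

text \<open>Integral with values in the extended reals: positive part minus negative part
  (\<open>ennreal\<close> maps negative numbers to \<open>0\<close>). It is meaningful as soon as one of the two is finite.\<close>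

definition ext_integral :: "'a measure \<Rightarrow> ('a \<Rightarrow> real) \<Rightarrow> ereal" where
  "ext_integral M f = enn2ereal (\<integral>\<^sup>+x. ennreal (f x) \<partial>M) - enn2ereal (\<integral>\<^sup>+x. ennreal (- f x) \<partial>M)"

text \<open>The dual action is in general \<open>+\<infinity>\<close> for some \<open>v\<close>, since \<open>H\<^sup>\<star>(t, v'(t))\<close> need not be
  integrable. A bound \<open>H(t, u) \<le> G(\<Lambda> u) + \<alpha>(t)\<close> with \<open>G 0 = 0\<close> and \<open>\<alpha>\<close> integrable yields
  \<open>H\<^sup>\<star>(t, w) \<ge> - \<alpha>(t)\<close>, so the negative part of the integrand is then integrable.\<close>

definition dual_action ::
    "real \<Rightarrow> (real \<Rightarrow> real ^ ('n::finite + 'n) \<Rightarrow> real) \<Rightarrow> (real \<Rightarrow> real ^ ('n + 'n)) \<Rightarrow> ereal" where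
  "dual_action T H v = ext_integral (lebesgue_on {0..T})
     (\<lambda>t. 1 / 2 * ((symplectic_J *v time_deriv T v t) \<bullet> v t) +
          convex_conjugate (H t) (time_deriv T v t))"

end

theory Submission
  imports Defs "HOL-Complex_Analysis.Great_Picard"
begin

text \<open>By the upper bound on \<open>H\<close> and the definition of \<open>C\<close>, the dual action dominates a positive multiple
  of \<open>\<integral> G\<^sup>\<star>(T v')\<close> up to a constant. Superlinearity of \<open>G\<^sup>\<star>\<close> makes minimizing sequences uniformly absolutely
  continuous, so a subsequence converges uniformly. The quadratic part passes to the limit by
  integration by parts, and the convex part is lower semicontinuous because it is the supremum of
  the functionals \<open>v \<mapsto> \<integral> \<langle>p, v'\<rangle> - H(t, p)\<close> with \<open>p\<close> absolutely continuous, each of which depends on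
  \<open>v\<close> continuously in the uniform norm. A minimizer satisfies the Euler--Lagrange equation
  \<open>\<nabla>H\<^sup>\<star>(t, v') = J v + c\<close>: it suffices to vary \<open>v'\<close> on the sets where it is bounded, which needs no growth
  condition on \<open>H\<^sup>\<star>\<close>. Legendre duality turns \<open>u = J v + c\<close> into a solution.

  Since \<open>H\<close> is continuous on the compact interval of times, superlinearity of each \<open>H(t, \<cdot>)\<close> is
  uniform in \<open>t\<close>. This makes \<open>H\<^sup>\<star>\<close> and its gradient jointly continuous.\<close>

section \<open>Lebesgue differentiation\<close>

text \<open>The constants of condition (2) enter as follows. Write F for the conjugate of G, \<rho>
  = 1 / (\<Lambda> T) and \<mu> = max {1, C / 2}. Conjugating the upper bound on H gives
  \<open>H_star t w\<close> >= F(w / \<Lambda>) - \<alpha>(t), and \<rho> >= 1 allows F(w /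
  \<Lambda>) >= \<rho> F(T w); the quadratic part is at least -\<mu> times the integral of F(T v').
  Condition (2) says \<mu> < \<rho>, and \<rho> - \<mu> is the coercivity factor.

  Absolute continuity is given by its epsilon-delta definition, whereas the argument needs
  derivatives a.e., the fundamental theorem and integration by parts. The link is the positive
  variation: it makes a function a difference of monotone ones, whose Stieltjes measures have
  Radon-Nikodym densities.

  Adding a constant to v changes neither v' nor, by periodicity, the action. This normalizes
  minimizing sequences at time 0 and shows that -J (u - m) is a minimizer for each constant m once u
  = J v + c. Membership of u' in the Orlicz class of G comes from a uniform bound: u is bounded, and
  gradients of H over bounded sets are bounded.\<close>

lemma lebesgue_differentiation:
  fixes f :: "real \<Rightarrow> 'a::euclidean_space"
  assumes f: "f integrable_on {a..b}"
  shows "AE x in lebesgue_on {a..b}.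
    ((\<lambda>x. integral {a..x} f) has_vector_derivative f x) (at x within {a..b})"
proof -
  define g where "g = (\<lambda>x. if x \<in> {a..b} then f x else 0)"
  have "g integrable_on UNIV"
    unfolding g_def using f by (simp only: integrable_restrict_UNIV)
  then have g: "g integrable_on {c..d}" for c d
    by (rule integrable_on_subinterval) auto
  then have 1: "g integrable_on cbox c d" for c d
    by simp
  \<comment> \<open>The continuity statement obtained below controls only increments to the right of
    a point. Left increments of g at x are right increments of the reflected function at -x, which
    is why the reflection of \<open>N2\<close> is excluded as well.\<close>
  have 2: "(\<lambda>x. g (- x)) integrable_on cbox c d" for c d
    using g[of "- d" "- c"] Henstock_Kurzweil_Integration.integrable_reflect_real[where f = g and a = "- d" and b = "- c"] by simp
  obtain N1 where N1: "negligible N1"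
    "\<And>x e. x \<notin> N1 \<Longrightarrow> 0 < e \<Longrightarrow> \<exists>d>0. \<forall>h. 0 < h \<and> h < d \<longrightarrow>
       norm (integral {x..x + h} g /\<^sub>R h - g x) < e"
    using integrable_ccontinuous_explicit[of g, OF 1] by auto
  obtain N2 where N2: "negligible N2"
    "\<And>x e. x \<notin> N2 \<Longrightarrow> 0 < e \<Longrightarrow> \<exists>d>0. \<forall>h. 0 < h \<and> h < d \<longrightarrow>
       norm (integral {x..x + h} (\<lambda>x. g (- x)) /\<^sub>R h - g (- x)) < e"
    using integrable_ccontinuous_explicit[of "\<lambda>x. g (- x)", OF 2] by auto
  have N2': "negligible (uminus ` N2)"
    by (intro negligible_differentiable_image_negligible N2) (auto intro!: derivative_intros)
  have der: "((\<lambda>x. integral {a..x} f) has_vector_derivative f x) (at x within {a..b})"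
    if x: "x \<in> {a..b}" "x \<notin> N1" "x \<notin> uminus ` N2" for x
  proof -
    have x2: "- x \<notin> N2"
      using x(3) by force
    have gx: "g x = f x"
      using x(1) by (simp add: g_def)
    have close: "norm (integral {a..y} f - integral {a..x} f - (y - x) *\<^sub>R f x) \<le> e * \<bar>y - x\<bar>"
      if "0 < e" and d: "0 < d" "\<And>h. 0 < h \<and> h < d \<Longrightarrow> norm (integral {x..x + h} g /\<^sub>R h - g x) < e"
        and d': "0 < d'" "\<And>h. 0 < h \<and> h < d' \<Longrightarrow>
            norm (integral {-x..-x + h} (\<lambda>x. g (- x)) /\<^sub>R h - g x) < e"
        and y: "y \<in> {a..b}" "\<bar>y - x\<bar> < min d d'" for e d d' y
    proof (cases "y = x")
      case False
      \<comment> \<open>The mean of f over the interval between x and y. In both orders the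
        remainder is y - x times the difference of I and f x.\<close>
      define I where "I = integral {min x y..max x y} f /\<^sub>R \<bar>y - x\<bar>"
      have fg: "integral {min x y..max x y} g = integral {min x y..max x y} f"
        using x y by (intro integral_cong) (auto simp: g_def)
      have "norm (I - f x) < e"
      proof (cases "x < y")
        case True
        then show ?thesis
          using d(2)[of "y - x"] y fg gx by (simp add: I_def)
      next
        case less: False
        have "integral {-x..-y} (\<lambda>x. g (- x)) = integral {y..x} g"
          by (rule Henstock_Kurzweil_Integration.integral_reflect_real)
        then show ?thesis
          using less False d'(2)[of "x - y"] y fg gx by (simp add: I_def)
      qed
      moreover have "integral {a..min x y} f + integral {min x y..max x y} f = integral {a..max x y} f"
        using x y by (intro Henstock_Kurzweil_Integration.integral_combine integrable_on_subinterval[OF f]) auto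
      then have "integral {a..min x y} f + \<bar>y - x\<bar> *\<^sub>R I = integral {a..max x y} f"
        using False by (simp add: I_def)
      then have "(y - x) *\<^sub>R I = integral {a..y} f - integral {a..x} f"
        by (cases "x < y") (auto simp: algebra_simps)
      then have "integral {a..y} f - integral {a..x} f - (y - x) *\<^sub>R f x = (y - x) *\<^sub>R (I - f x)"
        by (simp only: scaleR_diff_right)
      ultimately show ?thesis
        by (simp add: mult.commute[of e] mult_left_mono)
    qed simp
    show ?thesis
      unfolding has_vector_derivative_def has_derivative_within_alt2
    proof (intro conjI allI impI bounded_linear_scaleR_left)
      fix e :: real assume "e > 0"
      obtain d where d: "0 < d" "\<And>h. 0 < h \<and> h < d \<Longrightarrow> norm (integral {x..x + h} g /\<^sub>R h - g x) < e"
        using N1(2)[OF x(2) \<open>e > 0\<close>] by blast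
      obtain d' where d': "0 < d'" "\<And>h. 0 < h \<and> h < d' \<Longrightarrow>
            norm (integral {-x..-x + h} (\<lambda>x. g (- x)) /\<^sub>R h - g x) < e"
        using N2(2)[OF x2 \<open>e > 0\<close>] by auto
      show "\<forall>\<^sub>F y in at x within {a..b}. norm (integral {a..y} f - integral {a..x} f - (y - x) *\<^sub>R f x)
          \<le> e * norm (y - x)"
        unfolding eventually_at using close[OF \<open>e > 0\<close> d d'] d(1) d'(1)
        by (intro exI[of _ "min d d'"]) (auto simp: dist_real_def)
    qed
  qed
  have "negligible (N1 \<union> uminus ` N2)"
    using N1 N2' by auto
  then have "AE x in lebesgue. x \<notin> N1 \<union> uminus ` N2"
    using AE_not_in negligible_iff_null_sets by blast
  then show ?thesis
    using der by (auto simp: AE_restrict_space_iff elim!: AE_mp)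
qed

section \<open>Absolutely continuous functions are indefinite integrals\<close>

definition interval_family :: "real \<Rightarrow> real \<Rightarrow> (real \<times> real) set \<Rightarrow> bool" where
  "interval_family a b D \<longleftrightarrow> finite D \<and> (\<forall>(x, y)\<in>D. a \<le> x \<and> x \<le> y \<and> y \<le> b) \<and>
     disjoint_family_on (\<lambda>(x, y). {x<..<y}) D"

abbreviation sum_lengths :: "(real \<times> real) set \<Rightarrow> real" where
  "sum_lengths D \<equiv> \<Sum>(x, y)\<in>D. y - x"

abbreviation sum_increments :: "(real \<Rightarrow> real) \<Rightarrow> (real \<times> real) set \<Rightarrow> real" where
  "sum_increments g D \<equiv> \<Sum>(x, y)\<in>D. g y - g x"

abbreviation sum_norm_increments :: "(real \<Rightarrow> 'a::real_normed_vector) \<Rightarrow> (real \<times> real) set \<Rightarrow> real" where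
  "sum_norm_increments u D \<equiv> \<Sum>(x, y)\<in>D. norm (u y - u x)"

lemma abs_continuous_on_iff:
  "abs_continuous_on a b u \<longleftrightarrow> (\<forall>\<epsilon>>0. \<exists>\<delta>>0. \<forall>D. interval_family a b D \<longrightarrow>
     sum_lengths D < \<delta> \<longrightarrow> sum_norm_increments u D < \<epsilon>)"
  unfolding abs_continuous_on_def interval_family_def by meson

text \<open>Two open intervals are disjoint iff the smaller right end is at most the larger left
  end. This order form is preserved by monotone maps and suits linear arithmetic. Degenerate pairs
  (x, x) are allowed.\<close>

lemma interval_family_alt:
  "interval_family a b D \<longleftrightarrow> finite D \<and> (\<forall>p\<in>D. a \<le> fst p \<and> fst p \<le> snd p \<and> snd p \<le> b) \<and>
     (\<forall>p\<in>D. \<forall>q\<in>D. p \<noteq> q \<longrightarrow> min (snd p) (snd q) \<le> max (fst p) (fst q))"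
  unfolding interval_family_def disjoint_family_on_def case_prod_unfold
  by (simp add: Int_greaterThanLessThan del: min.bounded_iff max.bounded_iff)

lemma interval_family_empty: "interval_family a b {}"
  by (simp add: interval_family_def disjoint_family_on_def)

lemma interval_family_single: "a \<le> x \<Longrightarrow> x \<le> y \<Longrightarrow> y \<le> b \<Longrightarrow> interval_family a b {(x, y)}"
  by (simp add: interval_family_def disjoint_family_on_def)

lemma interval_family_mono:
  "interval_family a b D \<Longrightarrow> a' \<le> a \<Longrightarrow> b \<le> b' \<Longrightarrow> interval_family a' b' D"
  by (fastforce simp: interval_family_def)

lemma interval_family_filter: "interval_family a b D \<Longrightarrow> interval_family a b {p \<in> D. P p}"
  by (auto simp: interval_family_def disjoint_family_on_def)

lemma interval_family_length:
  assumes D: "interval_family a b D" and S: "(\<Union>(x, y)\<in>D. {x<..<y}) \<subseteq> S" "S \<in> lmeasurable"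
  shows "sum_lengths D \<le> measure lebesgue S"
proof -
  have "sum_lengths D = (\<Sum>p\<in>D. measure lebesgue (case p of (x, y) \<Rightarrow> {x<..<y}))"
    using D by (intro sum.cong) (auto simp: interval_family_def)
  also have "\<dots> = measure lebesgue (\<Union>p\<in>D. case p of (x, y) \<Rightarrow> {x<..<y})"
    using D by (intro measure_finite_Union[symmetric]) (auto simp: interval_family_def)
  also have "\<dots> \<le> measure lebesgue S"
    using D S by (intro measure_mono_fmeasurable)
      (auto simp: interval_family_def intro!: sets.finite_UN)
  finally show ?thesis .
qed

lemma interval_family_length_le:
  assumes "interval_family a b D" and "a \<le> b"
  shows "sum_lengths D \<le> b - a"
  using interval_family_length[of a b D "{a..b}"] assms by (fastforce simp: interval_family_def)

text \<open>Meant for clamping at a point, where \<open>c\<close> is far from injective.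
  Monotonicity preserves the order form of disjointness. If two different members have the same
  image, that image is degenerate and contributes 0, so merging them in the image set does not
  change the sum.\<close>

lemma interval_family_image:
  fixes g c :: "real \<Rightarrow> real"
  assumes D: "interval_family a b D" and c: "mono c" "\<And>x. a \<le> x \<Longrightarrow> x \<le> b \<Longrightarrow> a' \<le> c x \<and> c x \<le> b'"
  shows "interval_family a' b' (map_prod c c ` D)"
    and "(\<Sum>(x, y)\<in>map_prod c c ` D. g y - g x) = (\<Sum>(x, y)\<in>D. g (c y) - g (c x))"
proof -
  have fin: "finite D" and bd: "\<And>p. p \<in> D \<Longrightarrow> a \<le> fst p \<and> fst p \<le> snd p \<and> snd p \<le> b"
    and disj: "\<And>p q. p \<in> D \<Longrightarrow> q \<in> D \<Longrightarrow> p \<noteq> q \<Longrightarrow> min (snd p) (snd q) \<le> max (fst p) (fst q)"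
    using D by (auto simp: interval_family_alt)
  have sep: "min (c (snd p)) (c (snd q)) \<le> max (c (fst p)) (c (fst q))" if "p \<in> D" "q \<in> D" "p \<noteq> q" for p q
    using monoD[OF c(1) disj[OF that]] c(1) by (simp only: min_of_mono max_of_mono)
  show "interval_family a' b' (map_prod c c ` D)"
    unfolding interval_family_alt
  proof (intro conjI ballI impI)
    fix p q assume "p \<in> map_prod c c ` D" "q \<in> map_prod c c ` D" "p \<noteq> q"
    then obtain p' q' where "p' \<in> D" "q' \<in> D" "p' \<noteq> q'" "p = map_prod c c p'" "q = map_prod c c q'"
      unfolding image_iff by metis
    then show "min (snd p) (snd q) \<le> max (fst p) (fst q)"
      using sep[of p' q'] by simp
  next
    fix p assume "p \<in> map_prod c c ` D"
    then obtain p' where p': "p = map_prod c c p'" "p' \<in> D" by (rule imageE)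
    have "a \<le> fst p'" "fst p' \<le> snd p'" "snd p' \<le> b"
      using bd[OF p'(2)] by simp_all
    then show "a' \<le> fst p" "fst p \<le> snd p" "snd p \<le> b'"
      using c(2)[of "fst p'"] c(2)[of "snd p'"] monoD[OF c(1), of "fst p'" "snd p'"] by (simp_all add: p'(1))
  qed (use fin in simp)
  show "(\<Sum>(x, y)\<in>map_prod c c ` D. g y - g x) = (\<Sum>(x, y)\<in>D. g (c y) - g (c x))"
  proof (subst sum.reindex_nontrivial[OF fin])
    fix p q assume pq: "p \<in> D" "q \<in> D" "p \<noteq> q" "map_prod c c p = map_prod c c q"
    have "c (fst p) = c (fst q)" "c (snd p) = c (snd q)"
      using arg_cong[OF pq(4), of fst] arg_cong[OF pq(4), of snd] by simp_all
    then have "c (fst p) = c (snd p)"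
      using sep[OF pq(1-3)] monoD[OF c(1), of "fst p" "snd p"] bd[OF pq(1)] by simp
    then show "(case map_prod c c p of (x, y) \<Rightarrow> g y - g x) = 0"
      by (simp add: case_prod_unfold)
  qed (simp add: case_prod_unfold)
qed

text \<open>Clamping at s from above and from below cuts a member around s into two; a member on one
  side of s becomes degenerate on the other and contributes 0 there.\<close>

lemma interval_family_split:
  fixes g :: "real \<Rightarrow> real"
  assumes D: "interval_family a b D" and s: "a \<le> s" "s \<le> b"
  obtains D1 D2 where "interval_family a s D1" "interval_family s b D2"
    "sum_increments g D = sum_increments g D1 + sum_increments g D2"
proof -
  define l where "l = (\<lambda>x. min x s)"
  define r where "r = (\<lambda>x. max x s)"
  have l: "mono l" "\<And>x. a \<le> x \<Longrightarrow> x \<le> b \<Longrightarrow> a \<le> l x \<and> l x \<le> s"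
    and r: "mono r" "\<And>x. a \<le> x \<Longrightarrow> x \<le> b \<Longrightarrow> s \<le> r x \<and> r x \<le> b"
    using s by (auto simp: l_def r_def intro!: monoI)
  have "sum_increments g D = (\<Sum>(x, y)\<in>D. g (l y) - g (l x)) + (\<Sum>(x, y)\<in>D. g (r y) - g (r x))"
    unfolding sum.distrib[symmetric] by (intro sum.cong) (auto simp: l_def r_def min_def max_def)
  then show ?thesis
    using interval_family_image(1)[OF D l] interval_family_image(1)[OF D r]
      interval_family_image(2)[OF D l, of g] interval_family_image(2)[OF D r, of g]
    by (intro that[of "map_prod l l ` D" "map_prod r r ` D"]) simp_all
qed

text \<open>The only possible common member is the degenerate pair (s, s), whose increment is
  0.\<close>

lemma interval_family_join:
  fixes g :: "real \<Rightarrow> real"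
  assumes D1: "interval_family a s D1" and D2: "interval_family s b D2" and s: "a \<le> s" "s \<le> b"
  shows "interval_family a b (D1 \<union> D2)"
    "(\<Sum>(x, y)\<in>D1 \<union> D2. g y - g x) = sum_increments g D1 + sum_increments g D2"
proof -
  have fin: "finite D1" "finite D2"
    and bd: "\<And>x y. (x, y) \<in> D1 \<Longrightarrow> a \<le> x \<and> x \<le> y \<and> y \<le> s"
      "\<And>x y. (x, y) \<in> D2 \<Longrightarrow> s \<le> x \<and> x \<le> y \<and> y \<le> b"
    using assms by (auto simp: interval_family_def)
  show "interval_family a b (D1 \<union> D2)"
    unfolding interval_family_alt
  proof (intro conjI ballI impI)
    fix p q assume pq: "p \<in> D1 \<union> D2" "q \<in> D1 \<union> D2" "p \<noteq> q"
    have "\<And>p. p \<in> D1 \<Longrightarrow> snd p \<le> s" "\<And>p. p \<in> D2 \<Longrightarrow> s \<le> fst p"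
      using bd by auto
    then show "min (snd p) (snd q) \<le> max (fst p) (fst q)"
      using pq D1 D2 unfolding interval_family_alt by (metis Un_iff min.coboundedI1 min.coboundedI2
          max.coboundedI1 max.coboundedI2 order_trans)
  qed (use fin bd s in \<open>force\<close>)+
  show "(\<Sum>(x, y)\<in>D1 \<union> D2. g y - g x) = sum_increments g D1 + sum_increments g D2"
  proof (intro sum.union_inter_neutral fin ballI)
    fix p assume "p \<in> D1 \<inter> D2"
    then show "(case p of (x, y) \<Rightarrow> g y - g x) = 0"
      using bd(1)[of "fst p" "snd p"] bd(2)[of "fst p" "snd p"] by (cases p) (auto dest: antisym)
  qed
qed

text \<open>The families need not cover the interval, so a supremum of signed sums already leaves
  out the pieces on which g decreases; the empty family makes it nonnegative.\<close>

definition pos_variation :: "(real \<Rightarrow> real) \<Rightarrow> real \<Rightarrow> real \<Rightarrow> real" where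
  "pos_variation g a b = (SUP D\<in>Collect (interval_family a b). \<Sum>(x, y)\<in>D. g y - g x)"

lemma bdd_above_pos_variation:
  fixes g :: "real \<Rightarrow> real"
  assumes g: "abs_continuous_on a b g" and "a \<le> b"
  shows "bdd_above ((\<lambda>D. \<Sum>(x, y)\<in>D. g y - g x) ` Collect (interval_family a b))"
proof -
  obtain \<delta> where \<delta>: "\<delta> > 0" "\<And>D. interval_family a b D \<Longrightarrow>
     sum_lengths D < \<delta> \<Longrightarrow> sum_norm_increments g D < 1"
    using g unfolding abs_continuous_on_iff by (meson zero_less_one)
  have small: "sum_increments g D \<le> 1" if D: "interval_family s t D" "a \<le> s" "s \<le> t" "t \<le> b" "t - s < \<delta>" for s t D
  proof -
    have "sum_lengths D < \<delta>"
      using interval_family_length_le[OF D(1)] that by linarith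
    moreover have "interval_family a b D"
      using interval_family_mono[OF D(1)] that by auto
    moreover have "sum_increments g D \<le> sum_norm_increments g D" by (intro sum_mono) auto
    ultimately show ?thesis
      using \<delta>(2)[of D] by linarith
  qed
  \<comment> \<open>Induction on the number of pieces of length \<delta> / 2. Splitting off the last
    piece costs at most 1 by \<open>small\<close>, which asks for a length strictly below
    \<delta>.\<close>
  have main: "\<forall>t D. a \<le> t \<and> t \<le> b \<and> t - a \<le> n * (\<delta> / 2) \<and> interval_family a t D \<longrightarrow>
      sum_increments g D \<le> n + 1" for n :: nat
  proof (induction n)
    case 0
    then show ?case
      using small[of a _ ] \<delta>(1) by auto
  next
    case (Suc n)
    show ?case
    proof (intro allI impI)
      fix t D assume t: "a \<le> t \<and> t \<le> b \<and> t - a \<le> Suc n * (\<delta> / 2) \<and> interval_family a t D"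
      define s where "s = max a (t - \<delta> / 2)"
      have s: "a \<le> s" "s \<le> t" "t - s < \<delta>" "s - a \<le> n * (\<delta> / 2)"
        using t \<delta>(1) by (auto simp: s_def algebra_simps max_def)
      obtain D1 D2 where "interval_family a s D1" "interval_family s t D2"
        "sum_increments g D = sum_increments g D1 + sum_increments g D2"
        using interval_family_split t s by metis
      moreover have "sum_increments g D1 \<le> n + 1"
        using Suc.IH[rule_format, of s D1] s t calculation by auto
      moreover have "sum_increments g D2 \<le> 1"
        using small[of s t D2] s t calculation by auto
      ultimately show "sum_increments g D \<le> Suc n + 1" by simp
    qed
  qed
  obtain n :: nat where "(b - a) / (\<delta> / 2) \<le> n"
    using real_arch_simple by blast
  then have "b - a \<le> n * (\<delta> / 2)"
    using \<delta>(1) by (simp add: field_simps)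
  then show ?thesis
    using main[of n] \<open>a \<le> b\<close> by (intro bdd_aboveI[where M = "real (n + 1)"]) auto
qed

lemma abs_continuous_subset:
  "abs_continuous_on a b g \<Longrightarrow> a \<le> a' \<Longrightarrow> b' \<le> b \<Longrightarrow> abs_continuous_on a' b' g"
  unfolding abs_continuous_on_iff by (meson interval_family_mono)

context
  fixes g :: "real \<Rightarrow> real" and a b :: real
  assumes g: "abs_continuous_on a b g"
begin

lemma pos_variation_ge:
  assumes "a \<le> s" "s \<le> t" "t \<le> b" "interval_family s t D"
  shows "sum_increments g D \<le> pos_variation g s t"
  unfolding pos_variation_def
  using bdd_above_pos_variation[OF abs_continuous_subset[OF g assms(1,3)] assms(2)] assms(4)
  by (intro cSUP_upper) auto

lemma pos_variation_le:
  assumes "\<And>D. interval_family s t D \<Longrightarrow> sum_increments g D \<le> B"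
  shows "pos_variation g s t \<le> B"
  unfolding pos_variation_def using assms interval_family_empty by (intro cSUP_least) auto

text \<open>Splitting a family at s bounds the left side. Joining arbitrary families on the two
  sides, with one supremum taken after the other, bounds the right side.\<close>

lemma pos_variation_add:
  assumes "a \<le> r" "r \<le> s" "s \<le> t" "t \<le> b"
  shows "pos_variation g r t = pos_variation g r s + pos_variation g s t"
proof (rule antisym)
  show "pos_variation g r t \<le> pos_variation g r s + pos_variation g s t"
  proof (rule pos_variation_le)
    fix D assume "interval_family r t D"
    then obtain D1 D2 where "interval_family r s D1" "interval_family s t D2"
      "sum_increments g D = sum_increments g D1 + sum_increments g D2"
      using interval_family_split assms by metis
    then show "sum_increments g D \<le> pos_variation g r s + pos_variation g s t"
      using pos_variation_ge assms by (simp add: add_mono)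
  qed
  have "pos_variation g r s \<le> pos_variation g r t - pos_variation g s t"
  proof (rule pos_variation_le)
    fix D1 assume D1: "interval_family r s D1"
    have "pos_variation g s t \<le> pos_variation g r t - sum_increments g D1"
    proof (rule pos_variation_le)
      fix D2 assume D2: "interval_family s t D2"
      have "(\<Sum>(x, y)\<in>D1 \<union> D2. g y - g x) \<le> pos_variation g r t"
        using interval_family_join(1)[OF D1 D2] assms by (intro pos_variation_ge) auto
      then show "sum_increments g D2 \<le> pos_variation g r t - sum_increments g D1"
        using interval_family_join(2)[OF D1 D2, of g] assms by auto
    qed
    then show "sum_increments g D1 \<le> pos_variation g r t - pos_variation g s t" by simp
  qed
  then show "pos_variation g r s + pos_variation g s t \<le> pos_variation g r t" by simp
qed

lemma pos_variation_nonneg: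
  assumes "a \<le> s" "s \<le> t" "t \<le> b"
  shows "0 \<le> pos_variation g s t" and "g t - g s \<le> pos_variation g s t"
  using pos_variation_ge[OF assms interval_family_empty]
    pos_variation_ge[OF assms interval_family_single[of s s t t]] assms by auto

text \<open>Each member of a family D is refined by a family whose increments nearly attain the
  positive variation there. All refinements together form one family of no greater total length, so
  the modulus of g itself controls the sum.\<close>

lemma abs_continuous_pos_variation: "abs_continuous_on a b (pos_variation g a)"
  unfolding abs_continuous_on_iff
proof (intro allI impI)
  fix \<epsilon> :: real assume "\<epsilon> > 0"
  then obtain \<delta> where \<delta>: "\<delta> > 0" "\<And>D. interval_family a b D \<Longrightarrow>
     sum_lengths D < \<delta> \<Longrightarrow> sum_norm_increments g D < \<epsilon> / 2"
    using g unfolding abs_continuous_on_iff by (meson half_gt_zero)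
  show "\<exists>\<delta>>0. \<forall>D. interval_family a b D \<longrightarrow> sum_lengths D < \<delta> \<longrightarrow>
      (\<Sum>(x, y)\<in>D. norm (pos_variation g a y - pos_variation g a x)) < \<epsilon>"
  proof (intro exI[of _ \<delta>] conjI allI impI \<delta>(1))
    fix D assume D: "interval_family a b D" and len: "sum_lengths D < \<delta>"
    have fin: "finite D" and bd: "\<And>x y. (x, y) \<in> D \<Longrightarrow> a \<le> x \<and> x \<le> y \<and> y \<le> b"
      and disj: "disjoint_family_on (\<lambda>(x, y). {x<..<y}) D"
      using D by (auto simp: interval_family_def)
    \<comment> \<open>The slack per member: over all of D it adds up to at most \<epsilon> / 4, on
      top of the \<epsilon> / 2 that comes from g.\<close>
    define \<eta> where "\<eta> = \<epsilon> / 4 / (card D + 1)"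
    have \<eta>: "\<eta> > 0"
      using \<open>\<epsilon> > 0\<close> by (auto simp: \<eta>_def)
    \<comment> \<open>Degenerate pairs are dropped. They contribute nothing, but the same pair (x,
      x) could occur in the refinements of two neighbouring members, and the sum over the union
      needs disjoint index sets.\<close>
    have "\<exists>E. interval_family (fst p) (snd p) E \<and> (\<forall>q\<in>E. fst q < snd q) \<and>
       pos_variation g (fst p) (snd p) - \<eta> < sum_increments g E" if "p \<in> D" for p
    proof -
      have "\<exists>E. interval_family (fst p) (snd p) E \<and>
        pos_variation g (fst p) (snd p) - \<eta> < sum_increments g E"
      proof (rule ccontr)
        assume "\<not> ?thesis"
        then have "pos_variation g (fst p) (snd p) \<le> pos_variation g (fst p) (snd p) - \<eta>"
          by (intro pos_variation_le) (meson not_le)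
        then show False using \<eta> by simp
      qed
      then obtain E where E: "interval_family (fst p) (snd p) E"
        "pos_variation g (fst p) (snd p) - \<eta> < sum_increments g E"
        by blast
      have "sum_increments g E = (\<Sum>(x, y)\<in>{q \<in> E. fst q < snd q}. g y - g x)"
        using E(1) unfolding interval_family_alt
        by (intro sum.mono_neutral_right) (auto simp: order_less_le)
      then show ?thesis
        using E interval_family_filter[OF E(1)] by (intro exI[of _ "{q \<in> E. fst q < snd q}"]) auto
    qed
    then obtain E where E: "\<And>p. p \<in> D \<Longrightarrow> interval_family (fst p) (snd p) (E p)"
      "\<And>p q. p \<in> D \<Longrightarrow> q \<in> E p \<Longrightarrow> fst q < snd q"
      "\<And>p. p \<in> D \<Longrightarrow> pos_variation g (fst p) (snd p) - \<eta> < (\<Sum>(x, y)\<in>E p. g y - g x)"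
      by metis
    have Ebd: "fst p \<le> fst q \<and> snd q \<le> snd p" if "p \<in> D" "q \<in> E p" for p q
      using E(1)[OF that(1)] that(2) by (fastforce simp: interval_family_def)
    have apart: "min (snd q) (snd q') \<le> max (fst q) (fst q')"
      if "p \<in> D" "p' \<in> D" "p \<noteq> p'" "q \<in> E p" "q' \<in> E p'" for p p' q q'
    proof -
      have "min (snd p) (snd p') \<le> max (fst p) (fst p')"
        using D that unfolding interval_family_alt by blast
      then show ?thesis
        using Ebd[of p q] Ebd[of p' q'] that by linarith
    qed
    have Efam: "interval_family a b (\<Union>p\<in>D. E p)"
      unfolding interval_family_alt
    proof (intro conjI ballI impI)
      show "finite (\<Union>p\<in>D. E p)"
        using fin E(1) by (auto simp: interval_family_def)
    next
      fix q assume "q \<in> (\<Union>p\<in>D. E p)"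
      then obtain p where p: "p \<in> D" "q \<in> E p" by auto
      show "a \<le> fst q" "fst q \<le> snd q" "snd q \<le> b"
        using Ebd[OF p] E(2)[OF p] bd[of "fst p" "snd p"] p by auto
    next
      fix q q' assume "q \<in> (\<Union>p\<in>D. E p)" "q' \<in> (\<Union>p\<in>D. E p)" and ne: "q \<noteq> q'"
      then obtain p p' where p: "p \<in> D" "q \<in> E p" "p' \<in> D" "q' \<in> E p'" by auto
      show "min (snd q) (snd q') \<le> max (fst q) (fst q')"
      proof (cases "p = p'")
        case True
        then show ?thesis
          using E(1)[OF p(1)] p ne unfolding interval_family_alt by blast
      next
        case False
        then show ?thesis
          using apart[of p p' q q'] p by blast
      qed
    qed
    have E_disj: "E p \<inter> E p' = {}" if "p \<in> D" "p' \<in> D" "p \<noteq> p'" for p p'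
    proof (rule ccontr)
      assume "\<not> ?thesis"
      then obtain q where "q \<in> E p" "q \<in> E p'" by blast
      then show False
        using apart[OF that, of q q] E(2)[OF that(1), of q] by auto
    qed
    have sumU: "(\<Sum>q\<in>(\<Union>p\<in>D. E p). h q) = (\<Sum>p\<in>D. \<Sum>q\<in>E p. h q)" for h :: "real \<times> real \<Rightarrow> real"
      using fin E(1) E_disj by (intro sum.UNION_disjoint) (auto simp: interval_family_def)
    have "(\<Sum>(x, y)\<in>(\<Union>p\<in>D. E p). y - x) \<le> sum_lengths D"
      unfolding sumU
    proof (rule sum_mono)
      fix p assume p: "p \<in> D"
      show "(\<Sum>(x, y)\<in>E p. y - x) \<le> (case p of (x, y) \<Rightarrow> y - x)"
        using interval_family_length_le[OF E(1)[OF p]] bd[of "fst p" "snd p"] p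
        by (auto split: prod.splits)
    qed
    then have "(\<Sum>(x, y)\<in>(\<Union>p\<in>D. E p). norm (g y - g x)) < \<epsilon> / 2"
      using \<delta>(2)[OF Efam] len by linarith
    moreover have "(\<Sum>(x, y)\<in>(\<Union>p\<in>D. E p). g y - g x) \<le> (\<Sum>(x, y)\<in>(\<Union>p\<in>D. E p). norm (g y - g x))"
      by (intro sum_mono) auto
    ultimately have "(\<Sum>p\<in>D. \<Sum>(x, y)\<in>E p. g y - g x) < \<epsilon> / 2"
      unfolding sumU by linarith
    moreover have "(\<Sum>p\<in>D. pos_variation g (fst p) (snd p) - \<eta>) \<le> (\<Sum>p\<in>D. \<Sum>(x, y)\<in>E p. g y - g x)"
      using E(3) by (intro sum_mono less_imp_le) auto
    moreover have "card D * \<eta> \<le> \<epsilon> / 4"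
      using \<open>\<epsilon> > 0\<close> by (simp add: \<eta>_def field_simps)
    ultimately have "(\<Sum>p\<in>D. pos_variation g (fst p) (snd p)) < \<epsilon>"
      using \<open>\<epsilon> > 0\<close> by (simp add: sum_subtractf)
    moreover have "(\<Sum>(x, y)\<in>D. norm (pos_variation g a y - pos_variation g a x))
        = (\<Sum>p\<in>D. pos_variation g (fst p) (snd p))"
    proof (intro sum.cong refl)
      fix p assume "p \<in> D"
      then show "(case p of (x, y) \<Rightarrow> norm (pos_variation g a y - pos_variation g a x))
          = pos_variation g (fst p) (snd p)"
        using bd[of "fst p" "snd p"] pos_variation_add[of a "fst p" "snd p"]
          pos_variation_nonneg(1)[of "fst p" "snd p"] by (auto split: prod.splits)
    qed
    ultimately show "(\<Sum>(x, y)\<in>D. norm (pos_variation g a y - pos_variation g a x)) < \<epsilon>"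
      by simp
  qed
qed

end

text \<open>Comparison principle behind differences, sums, scalar products and isometric images. The
  \<open>C + 1\<close> in the choice of \<eta> covers C = 0.\<close>

lemma abs_continuous_bound:
  assumes u: "abs_continuous_on a b u" and v: "abs_continuous_on a b v" and C: "0 \<le> C"
    and le: "\<And>x y. x \<in> {a..b} \<Longrightarrow> y \<in> {a..b} \<Longrightarrow>
      norm (w y - w x) \<le> C * (norm (u y - u x) + norm (v y - v x))"
  shows "abs_continuous_on a b w"
  unfolding abs_continuous_on_iff
proof (intro allI impI)
  fix \<epsilon> :: real assume "\<epsilon> > 0"
  define \<eta> where "\<eta> = \<epsilon> / (2 * (C + 1))"
  have "\<eta> > 0"
    using \<open>\<epsilon> > 0\<close> C by (simp add: \<eta>_def)
  obtain \<delta>1 where \<delta>1: "\<delta>1 > 0" "\<And>D. interval_family a b D \<Longrightarrow>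
     sum_lengths D < \<delta>1 \<Longrightarrow> sum_norm_increments u D < \<eta>"
    using u \<open>\<eta> > 0\<close> unfolding abs_continuous_on_iff by meson
  obtain \<delta>2 where \<delta>2: "\<delta>2 > 0" "\<And>D. interval_family a b D \<Longrightarrow>
     sum_lengths D < \<delta>2 \<Longrightarrow> sum_norm_increments v D < \<eta>"
    using v \<open>\<eta> > 0\<close> unfolding abs_continuous_on_iff by meson
  show "\<exists>\<delta>>0. \<forall>D. interval_family a b D \<longrightarrow> sum_lengths D < \<delta> \<longrightarrow>
      sum_norm_increments w D < \<epsilon>"
  proof (intro exI[of _ "min \<delta>1 \<delta>2"] conjI allI impI)
    fix D assume D: "interval_family a b D" "sum_lengths D < min \<delta>1 \<delta>2"
    have "sum_norm_increments w D
        \<le> (\<Sum>(x, y)\<in>D. C * (norm (u y - u x) + norm (v y - v x)))"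
      using D(1) by (intro sum_mono) (auto simp: interval_family_def intro!: le)
    also have "\<dots> = C * (sum_norm_increments u D + sum_norm_increments v D)"
      by (simp add: sum_distrib_left case_prod_unfold flip: sum.distrib)
    also have "\<dots> \<le> C * (\<eta> + \<eta>)"
      using \<delta>1(2)[OF D(1)] \<delta>2(2)[OF D(1)] D(2) C by (intro mult_left_mono add_mono) auto
    also have "\<dots> = \<epsilon> * (C / (C + 1))"
      using C by (simp add: \<eta>_def divide_simps)
    also have "\<dots> < \<epsilon> * 1"
      using \<open>\<epsilon> > 0\<close> C by (intro mult_strict_left_mono) auto
    finally show "sum_norm_increments w D < \<epsilon>" by simp
  qed (use \<delta>1 \<delta>2 in auto)
qed

lemma abs_continuous_continuous:
  assumes u: "abs_continuous_on a b u"
  shows "continuous_on {a..b} u"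
  unfolding continuous_on_iff
proof (intro ballI allI impI)
  fix x \<epsilon> :: real assume x: "x \<in> {a..b}" and "\<epsilon> > 0"
  then obtain \<delta> where \<delta>: "\<delta> > 0" "\<And>D. interval_family a b D \<Longrightarrow>
     sum_lengths D < \<delta> \<Longrightarrow> sum_norm_increments u D < \<epsilon>"
    using u unfolding abs_continuous_on_iff by meson
  show "\<exists>d>0. \<forall>x'\<in>{a..b}. dist x' x < d \<longrightarrow> dist (u x') (u x) < \<epsilon>"
  proof (intro exI[of _ \<delta>] conjI ballI impI \<delta>(1))
    fix y assume y: "y \<in> {a..b}" "dist y x < \<delta>"
    have "interval_family a b {(min x y, max x y)}"
      using x y by (intro interval_family_single) auto
    then show "dist (u y) (u x) < \<epsilon>"
      using \<delta>(2)[of "{(min x y, max x y)}"] y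
      by (auto simp: dist_real_def dist_norm min_def max_def norm_minus_commute split: if_splits)
  qed
qed

section \<open>Stieltjes measure of a monotone absolutely continuous function\<close>

lemma abs_continuous_mono_integral:
  fixes p :: "real \<Rightarrow> real"
  assumes ab: "a < b" and p: "abs_continuous_on a b p"
    and mono: "\<And>x y. a \<le> x \<Longrightarrow> x \<le> y \<Longrightarrow> y \<le> b \<Longrightarrow> p x \<le> p y"
  obtains f where "f absolutely_integrable_on {a..b}"
    "\<And>t. t \<in> {a..b} \<Longrightarrow> (f has_integral (p t - p a)) {a..t}"
proof -
  \<comment> \<open>The clamped extension is monotone and continuous on the whole line and constant
    outside [a, b], so its Stieltjes measure \<mu> has no atoms and lives on [a, b]. Absolute
    continuity of p turns into absolute continuity of \<mu> with respect to Lebesgue measure, and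
    the Radon-Nikodym density is the function sought.\<close>
  define Q where "Q = (\<lambda>x. p (max a (min b x)))"
  have Qp: "Q x = p x" if "x \<in> {a..b}" for x
    using that by (auto simp: Q_def min_def max_def)
  have Qmono: "Q x \<le> Q y" if "x \<le> y" for x y
    unfolding Q_def using that ab by (intro mono) auto
  have Qcont: "continuous_on UNIV Q"
    unfolding Q_def using ab
    by (intro continuous_on_compose2[OF abs_continuous_continuous[OF p]] continuous_intros) auto
  define \<mu> where "\<mu> = interval_measure Q"
  have Icc: "emeasure \<mu> {x..y} = ennreal (Q y - Q x)" if "x \<le> y" for x y
    unfolding \<mu>_def using that Qmono Qcont by (intro emeasure_interval_measure_Icc) auto
  have sets_\<mu> [simp, measurable_cong]: "sets \<mu> = sets borel" by (simp add: \<mu>_def)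
  have inner: "emeasure \<mu> (N \<inter> {a..b}) = 0" if N: "N \<in> null_sets lborel" for N :: "real set"
  proof -
    have [measurable]: "N \<in> sets borel"
      using N by auto
    have "emeasure \<mu> (N \<inter> {a..b}) \<le> 0 + ennreal \<epsilon>" if "\<epsilon> > 0" for \<epsilon> :: real
    proof -
      obtain \<delta> where \<delta>: "\<delta> > 0" "\<And>D. interval_family a b D \<Longrightarrow>
         sum_lengths D < \<delta> \<Longrightarrow> sum_norm_increments p D < \<epsilon>"
        using p \<open>\<epsilon> > 0\<close> unfolding abs_continuous_on_iff by meson
      have "N \<in> null_sets lebesgue"
        using N by (simp add: null_sets_completionI)
      then have S: "N \<inter> {a..b} \<in> null_sets lebesgue"
        by (metis inf_le1 null_sets_completion_subset)
      then have S': "N \<inter> {a..b} \<in> lmeasurable" "measure lebesgue (N \<inter> {a..b}) = 0"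
        using negligible_iff_null_sets negligible_iff_measure by blast+
      have sub: "N \<inter> {a..b} \<subseteq> cbox a b" and half: "\<delta> / 2 > 0"
        using \<delta>(1) by auto
      \<comment> \<open>A null set is covered by countably many nonoverlapping closed intervals
        whose union has measure at most \<delta> / 2. Every finite subfamily is then an interval
        family of length below \<delta>, hence of \<mu>-measure at most \<epsilon>.\<close>
      obtain \<D> where \<D>: "countable \<D>"
        "\<And>K. K \<in> \<D> \<Longrightarrow> K \<subseteq> cbox a b \<and> K \<noteq> {} \<and> (\<exists>c d. K = cbox c d)"
        "pairwise (\<lambda>A B. interior A \<inter> interior B = {}) \<D>"
        "N \<inter> {a..b} \<subseteq> \<Union>\<D>" "\<Union>\<D> \<in> lmeasurable"
        "measure lebesgue (\<Union>\<D>) \<le> measure lebesgue (N \<inter> {a..b}) + \<delta> / 2"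
        by (rule measurable_outer_intervals_bounded[OF S'(1) sub half]) (rule that)
      have K: "K = {Inf K..Sup K} \<and> a \<le> Inf K \<and> Inf K \<le> Sup K \<and> Sup K \<le> b" if "K \<in> \<D>" for K
        using \<D>(2)[OF that] by (auto simp: cSup_atLeastAtMost cInf_atLeastAtMost)
      have Kcc: "{Inf K..Sup K} = K" and Kle: "a \<le> Inf K" "Inf K \<le> Sup K" "Sup K \<le> b" if "K \<in> \<D>" for K
        using K[OF that] by blast+
      have Kint: "interior K = {Inf K<..<Sup K}" if "K \<in> \<D>" for K
        using interior_atLeastAtMost_real[of "Inf K" "Sup K"] unfolding Kcc[OF that] .
      have Kb: "K \<in> sets borel" if "K \<in> \<D>" for K
        using atLeastAtMost_borel[of "Inf K" "Sup K"] Kcc[OF that] by simp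
      have fin: "emeasure \<mu> (\<Union>\<F>) \<le> ennreal \<epsilon>" if \<F>: "finite \<F>" "\<F> \<subseteq> \<D>" for \<F>
      proof -
        define D where "D = (\<lambda>K. (Inf K, Sup K)) ` \<F>"
        have inj: "inj_on (\<lambda>K. (Inf K, Sup K)) \<F>"
        proof (rule inj_onI)
          fix K L assume "K \<in> \<F>" "L \<in> \<F>" "(Inf K, Sup K) = (Inf L, Sup L)"
          then show "K = L"
            using Kcc[of K] Kcc[of L] \<F> by auto
        qed
        have D: "interval_family a b D"
          unfolding interval_family_def disjoint_family_on_def
        proof (intro conjI ballI impI)
          fix q r assume "q \<in> D" "r \<in> D" "q \<noteq> r"
          then obtain K L where KL: "K \<in> \<F>" "L \<in> \<F>" "K \<noteq> L" "q = (Inf K, Sup K)" "r = (Inf L, Sup L)"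
            by (auto simp: D_def)
          have "interior K \<inter> interior L = {}"
            using \<D>(3) KL \<F> by (auto simp: pairwise_def)
          moreover have "interior K = {Inf K<..<Sup K}" "interior L = {Inf L<..<Sup L}"
            using Kint KL \<F> by blast+
          ultimately show "(case q of (x, y) \<Rightarrow> {x<..<y}) \<inter> (case r of (x, y) \<Rightarrow> {x<..<y}) = {}"
            using KL by simp
        qed (use \<F> Kle in \<open>auto simp: D_def\<close>)
        have "(\<Union>(x, y)\<in>D. {x<..<y}) \<subseteq> \<Union>\<D>"
        proof -
          have "{Inf K<..<Sup K} \<subseteq> K" if "K \<in> \<F>" for K
          proof -
            have "{Inf K<..<Sup K} \<subseteq> {Inf K..Sup K}" by auto
            then show ?thesis
              using Kcc[of K] that \<F> by auto
          qed
          then show ?thesis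
            using \<F> by (fastforce simp: D_def)
        qed
        then have "sum_lengths D < \<delta>"
          using interval_family_length[OF D _ \<D>(5)] \<D>(6) S'(2) \<delta>(1) by simp
        then have "sum_norm_increments p D < \<epsilon>" by (rule \<delta>(2)[OF D])
        moreover have "sum_norm_increments p D = (\<Sum>K\<in>\<F>. Q (Sup K) - Q (Inf K))"
          unfolding D_def
        proof (subst sum.reindex[OF inj], intro sum.cong)
          fix K assume "K \<in> \<F>"
          then show "((\<lambda>(x, y). norm (p y - p x)) \<circ> (\<lambda>K. (Inf K, Sup K))) K = Q (Sup K) - Q (Inf K)"
            using Kle[of K] mono[of "Inf K" "Sup K"] \<F> by (auto simp: Qp)
        qed simp
        ultimately have *: "(\<Sum>K\<in>\<F>. Q (Sup K) - Q (Inf K)) \<le> \<epsilon>" by simp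
        have "\<F> \<subseteq> sets \<mu>"
          using Kb \<F> by auto
        then have "emeasure \<mu> (\<Union>K\<in>\<F>. K) \<le> (\<Sum>K\<in>\<F>. emeasure \<mu> K)"
          using \<F> by (intro emeasure_subadditive_finite) auto
        also have "\<dots> = (\<Sum>K\<in>\<F>. ennreal (Q (Sup K) - Q (Inf K)))"
        proof (intro sum.cong refl)
          fix K assume "K \<in> \<F>"
          then show "emeasure \<mu> K = ennreal (Q (Sup K) - Q (Inf K))"
            using Icc[of "Inf K" "Sup K"] Kcc[of K] Kle[of K] \<F> by auto
        qed
        also have "\<dots> = ennreal (\<Sum>K\<in>\<F>. Q (Sup K) - Q (Inf K))"
          using Kle \<F> Qmono by (intro sum_ennreal) auto
        finally show ?thesis
          using * by (simp add: ennreal_leI order_trans)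
      qed
      have "emeasure \<mu> (\<Union>\<D>) \<le> ennreal \<epsilon>"
      proof (cases "\<D> = {}")
        case False
        \<comment> \<open>Finite partial unions along an enumeration increase to the whole union, so
          the bound for finite subfamilies carries over by continuity from below; repetitions in the
          enumeration are harmless.\<close>
        define A where "A = (\<lambda>n::nat. \<Union>(from_nat_into \<D> ` {..<n}))"
        have "\<D> \<subseteq> sets \<mu>"
          using Kb by auto
        then have "range A \<subseteq> sets \<mu>"
          using from_nat_into[OF False] by (auto simp: A_def)
        moreover have "incseq A" by (force simp: A_def incseq_def)
        moreover have "(\<Union>n. A n) = \<Union>\<D>"
        proof -
          have "(\<Union>n. A n) = \<Union>(range (from_nat_into \<D>))"
            by (auto simp: A_def intro!: exI[of _ "Suc _"])
          then show ?thesis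
            using range_from_nat_into[OF False \<D>(1)] by simp
        qed
        ultimately have "emeasure \<mu> (\<Union>\<D>) = (SUP n. emeasure \<mu> (A n))"
          by (metis SUP_emeasure_incseq)
        also have "\<dots> \<le> ennreal \<epsilon>"
          unfolding A_def using from_nat_into[OF False] by (intro SUP_least fin) auto
        finally show ?thesis .
      qed simp
      moreover have "emeasure \<mu> (N \<inter> {a..b}) \<le> emeasure \<mu> (\<Union>\<D>)"
      proof (intro emeasure_mono sets.countable_Union \<D>(1,4))
        show "\<D> \<subseteq> sets \<mu>"
          using Kb by auto
      qed
      ultimately show ?thesis
        by simp
    qed
    then have "emeasure \<mu> (N \<inter> {a..b}) \<le> 0" by (rule ennreal_le_epsilon)
    then show ?thesis by simp
  qed
  have "absolutely_continuous lborel \<mu>"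
    unfolding absolutely_continuous_def
  proof
    fix N :: "real set" assume N: "N \<in> null_sets lborel"
    then have [measurable]: "N \<in> sets borel" by auto
    \<comment> \<open>Q is constant outside [a, b], so the two half-lines, exhausted by bounded
      intervals, carry no mass.\<close>
    have "emeasure \<mu> {a - real n..a} = 0" for n
      using ab by (subst Icc) (auto simp: Q_def)
    then have 1: "emeasure \<mu> (\<Union>n. {a - real n..a}) = 0" by (intro emeasure_UN_eq_0) auto
    have "emeasure \<mu> {b..b + real n} = 0" for n
      using ab by (subst Icc) (auto simp: Q_def)
    then have 2: "emeasure \<mu> (\<Union>n. {b..b + real n}) = 0" by (intro emeasure_UN_eq_0) auto
    have "x \<in> (N \<inter> {a..b}) \<union> (\<Union>n. {a - real n..a}) \<union> (\<Union>n. {b..b + real n})" if "x \<in> N" for x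
    proof -
      obtain n :: nat where "\<bar>x\<bar> + \<bar>a\<bar> + \<bar>b\<bar> \<le> n"
        using real_arch_simple by blast
      then show ?thesis
        using that by (auto intro!: exI[of _ n])
    qed
    then have "emeasure \<mu> N \<le> emeasure \<mu> ((N \<inter> {a..b}) \<union> (\<Union>n. {a - real n..a}) \<union> (\<Union>n. {b..b + real n}))"
      by (intro emeasure_mono subsetI) (assumption | simp)+
    also have "\<dots> \<le> emeasure \<mu> ((N \<inter> {a..b}) \<union> (\<Union>n. {a - real n..a})) + emeasure \<mu> (\<Union>n. {b..b + real n})"
      by (intro emeasure_subadditive) auto
    also have "\<dots> \<le> (emeasure \<mu> (N \<inter> {a..b}) + emeasure \<mu> (\<Union>n. {a - real n..a})) + emeasure \<mu> (\<Union>n. {b..b + real n})"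
      by (intro add_right_mono emeasure_subadditive) auto
    finally have "emeasure \<mu> N = 0"
      using inner[OF N] 1 2 by simp
    then show "N \<in> null_sets \<mu>" by (intro null_setsI) auto
  qed
  then obtain f where f: "f \<in> borel_measurable lborel" "density lborel f = \<mu>"
    using sigma_finite_measure.Radon_Nikodym[OF sigma_finite_lborel, of \<mu>] by auto
  have [measurable]: "f \<in> borel_measurable borel"
    using f by simp
  have f_int: "(\<integral>\<^sup>+x. f x * indicator {r..s} x \<partial>lborel) = ennreal (Q s - Q r)" if "r \<le> s" for r s
    using emeasure_density[of f lborel "{r..s}"] Icc[OF that] f by simp
  \<comment> \<open>The density takes values in \<open>ennreal\<close>. It is finite a.e. on [a, b]
    because the total mass Q b - Q a is finite, so it may be replaced there by a real
    function.\<close>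
  have "AE x in lborel. f x * indicator {a..b} x \<noteq> \<infinity>"
    using f_int[of a b] ab by (intro nn_integral_PInf_AE) auto
  then have fin: "AE x in lborel. x \<in> {a..b} \<longrightarrow> f x \<noteq> \<infinity>" by eventually_elim auto
  have hint: "((\<lambda>x. enn2real (f x)) has_integral (p t - p a)) {a..t}" if t: "t \<in> {a..b}" for t
  proof -
    have "(\<integral>\<^sup>+x. ennreal (enn2real (f x) * indicator {a..t} x) \<partial>lborel)
        = (\<integral>\<^sup>+x. f x * indicator {a..t} x \<partial>lborel)"
    proof (intro nn_integral_cong_AE)
      show "AE x in lborel. ennreal (enn2real (f x) * indicator {a..t} x) = f x * indicator {a..t} x"
        using fin by eventually_elim (use t in \<open>auto split: split_indicator simp: top.not_eq_extremum\<close>)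
    qed
    also have "\<dots> = ennreal (p t - p a)"
      using f_int[of a t] t ab by (simp add: Qp)
    finally have "((\<lambda>x. enn2real (f x) * indicator {a..t} x) has_integral (p t - p a)) UNIV"
      using mono[of a t] t by (intro nn_integral_has_integral) auto
    moreover have "(\<lambda>x. enn2real (f x) * indicator {a..t} x) = (\<lambda>x. if x \<in> {a..t} then enn2real (f x) else 0)"
      by (rule ext) (simp add: indicator_def del: atLeastAtMost_iff)
    ultimately show ?thesis
      by (simp only: has_integral_restrict_UNIV)
  qed
  have "(\<lambda>x. enn2real (f x)) absolutely_integrable_on {a..b}"
  proof (rule nonnegative_absolutely_integrable_1)
    have "b \<in> {a..b}"
      using ab by simp
    then show "(\<lambda>x. enn2real (f x)) integrable_on {a..b}"
      by (rule has_integral_integrable[OF hint])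
  qed (rule enn2real_nonneg)
  then show ?thesis
    using hint by (rule that)
qed

text \<open>Jordan decomposition: g is its positive variation minus the function "positive variation
  minus g". Both are absolutely continuous, and the second is monotone since an increment of g never
  exceeds the positive variation over the same interval.\<close>

lemma abs_continuous_imp_integral_real:
  fixes g :: "real \<Rightarrow> real"
  assumes ab: "a < b" and g: "abs_continuous_on a b g"
  obtains f where "f absolutely_integrable_on {a..b}"
    "\<And>t. t \<in> {a..b} \<Longrightarrow> (f has_integral (g t - g a)) {a..t}"
proof -
  let ?P = "pos_variation g a"
  have P: "abs_continuous_on a b ?P" by (rule abs_continuous_pos_variation[OF g])
  have P_diff: "?P y - ?P x = pos_variation g x y" if "a \<le> x" "x \<le> y" "y \<le> b" for x y
    using pos_variation_add[OF g, of a x y] that by simp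
  have Pg: "abs_continuous_on a b (\<lambda>t. ?P t - g t)"
    by (rule abs_continuous_bound[OF P g, of 1]) auto
  obtain f1 where f1: "f1 absolutely_integrable_on {a..b}"
    "\<And>t. t \<in> {a..b} \<Longrightarrow> (f1 has_integral (?P t - ?P a)) {a..t}"
  proof (rule abs_continuous_mono_integral[OF ab P])
    show "?P x \<le> ?P y" if "a \<le> x" "x \<le> y" "y \<le> b" for x y
      using pos_variation_nonneg(1)[OF g that] P_diff[OF that] by simp
  qed (rule that)
  have "?P x - g x \<le> ?P y - g y" if "a \<le> x" "x \<le> y" "y \<le> b" for x y
    using pos_variation_nonneg(2)[OF g that] P_diff[OF that] by simp
  then obtain f2 where f2: "f2 absolutely_integrable_on {a..b}"
    "\<And>t. t \<in> {a..b} \<Longrightarrow> (f2 has_integral ((?P t - g t) - (?P a - g a))) {a..t}"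
    using abs_continuous_mono_integral[OF ab Pg] by (metis (no_types, lifting))
  show ?thesis
  proof
    show "(\<lambda>t. f1 t - f2 t) absolutely_integrable_on {a..b}"
      using f1 f2 by (intro set_integral_diff) auto
    fix t assume "t \<in> {a..b}"
    from has_integral_diff[OF f1(2)[OF this] f2(2)[OF this]]
    show "((\<lambda>t. f1 t - f2 t) has_integral (g t - g a)) {a..t}" by (simp add: algebra_simps)
  qed
qed

lemma abs_continuous_imp_integral:
  fixes u :: "real \<Rightarrow> 'a::euclidean_space"
  assumes ab: "a < b" and u: "abs_continuous_on a b u"
  obtains f where "f absolutely_integrable_on {a..b}"
    "\<And>t. t \<in> {a..b} \<Longrightarrow> (f has_integral (u t - u a)) {a..t}"
proof -
  have "\<exists>f. f absolutely_integrable_on {a..b} \<and>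
      (\<forall>t\<in>{a..b}. (f has_integral (u t \<bullet> i - u a \<bullet> i)) {a..t})" if "i \<in> Basis" for i
  proof -
    have ui: "abs_continuous_on a b (\<lambda>t. u t \<bullet> i)"
    proof (rule abs_continuous_bound[OF u u, of 1])
      fix x y
      have "\<bar>(u y - u x) \<bullet> i\<bar> \<le> norm (u y - u x)"
        using that by (rule Basis_le_norm)
      then show "norm (u y \<bullet> i - u x \<bullet> i) \<le> 1 * (norm (u y - u x) + norm (u y - u x))"
        by (simp add: inner_diff_left)
    qed simp
    obtain f where "f absolutely_integrable_on {a..b}"
      "\<And>t. t \<in> {a..b} \<Longrightarrow> (f has_integral (u t \<bullet> i - u a \<bullet> i)) {a..t}"
      by (rule abs_continuous_imp_integral_real[OF ab ui]) (rule that)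
    then show ?thesis by blast
  qed
  then obtain f where f: "\<And>i. i \<in> Basis \<Longrightarrow> f i absolutely_integrable_on {a..b}"
    "\<And>i t. i \<in> Basis \<Longrightarrow> t \<in> {a..b} \<Longrightarrow> (f i has_integral (u t \<bullet> i - u a \<bullet> i)) {a..t}"
    by metis
  show ?thesis
  proof
    show "(\<lambda>t. \<Sum>i\<in>Basis. f i t *\<^sub>R i) absolutely_integrable_on {a..b}"
      using f(1) by (intro absolutely_integrable_sum absolutely_integrable_scaleR_right) auto
    fix t assume "t \<in> {a..b}"
    then have "((\<lambda>t. \<Sum>i\<in>Basis. f i t *\<^sub>R i) has_integral (\<Sum>i\<in>Basis. (u t \<bullet> i - u a \<bullet> i) *\<^sub>R i)) {a..t}"
      using f(2) by (intro has_integral_sum has_integral_scaleR_left) auto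
    moreover have "(\<Sum>i\<in>Basis. (u t \<bullet> i - u a \<bullet> i) *\<^sub>R i) = u t - u a"
      by (metis (mono_tags, lifting) euclidean_representation inner_diff_left sum.cong)
    ultimately show "((\<lambda>t. \<Sum>i\<in>Basis. f i t *\<^sub>R i) has_integral (u t - u a)) {a..t}" by simp
  qed
qed

section \<open>Calculus of absolutely continuous functions\<close>

lemma integrable_lebesgue_on_iff:
  "S \<in> sets lebesgue \<Longrightarrow> integrable (lebesgue_on S) f \<longleftrightarrow> f absolutely_integrable_on S"
  by (simp add: integrable_restrict_space set_integrable_def)

text \<open>Completeness of Lebesgue measure, transferred to S by extension with 0. It matters
  because \<open>vector_derivative\<close> has unspecified values on a null set.\<close>

lemma measurable_cong_AE_lebesgue_on:
  fixes f g :: "'a::euclidean_space \<Rightarrow> 'b::euclidean_space"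
  assumes S: "S \<in> sets lebesgue" and f: "f \<in> borel_measurable (lebesgue_on S)"
    and ae: "AE x in lebesgue_on S. f x = g x"
  shows "g \<in> borel_measurable (lebesgue_on S)"
proof -
  have "(\<lambda>x. if x \<in> S then f x else 0) \<in> borel_measurable lebesgue"
    using f S by (simp add: borel_measurable_if)
  moreover have "AE x in lebesgue. (if x \<in> S then f x else 0) = (if x \<in> S then g x else 0)"
    using ae S by (simp add: AE_restrict_space_iff)
  ultimately have "(\<lambda>x. if x \<in> S then g x else 0) \<in> borel_measurable lebesgue"
    by (rule borel_measurable_AE)
  then show ?thesis
    using S by (simp add: borel_measurable_if)
qed

lemma integrable_cong_AE_lebesgue_on:
  fixes f g :: "'a::euclidean_space \<Rightarrow> 'b::euclidean_space"
  assumes S: "S \<in> sets lebesgue" and f: "integrable (lebesgue_on S) f"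
    and ae: "AE x in lebesgue_on S. f x = g x"
  shows "integrable (lebesgue_on S) g"
  using integrable_cong_AE_imp[OF f measurable_cong_AE_lebesgue_on[OF S _ ae]] f ae by auto

lemma has_integral_lebesgue_on:
  fixes f :: "real \<Rightarrow> 'b::euclidean_space"
  assumes "integrable (lebesgue_on {a..b}) f" "a \<le> x" "y \<le> b"
  shows "(f has_integral (LINT t|lebesgue_on {x..y}. f t)) {x..y}"
  using assms by (intro has_integral_integral_lebesgue_on Equivalence_Lebesgue_Henstock_Integration.integrable_subinterval[OF assms(1)]) auto

lemma LINT_eq_of_has_integral:
  fixes f :: "real \<Rightarrow> 'b::euclidean_space"
  assumes "integrable (lebesgue_on {a..b}) f" "(f has_integral I) {a..b}"
  shows "(LINT t|lebesgue_on {a..b}. f t) = I"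
  using has_integral_lebesgue_on[OF assms(1), of a b] assms(2) has_integral_unique by blast

lemma integrable_inner_continuous:
  fixes f g :: "real \<Rightarrow> 'b::euclidean_space"
  assumes f: "integrable (lebesgue_on {a..b}) f" and g: "continuous_on {a..b} g"
  shows "integrable (lebesgue_on {a..b}) (\<lambda>t. f t \<bullet> g t)"
proof -
  have "bounded (g ` {a..b})"
    using g by (simp add: compact_continuous_image compact_imp_bounded)
  moreover have "g \<in> borel_measurable (lebesgue_on {a..b})"
    using g by (simp add: continuous_imp_measurable_on_sets_lebesgue)
  moreover have "bilinear (\<lambda>x y :: 'b. x \<bullet> y)"
    by (simp add: bilinear_conv_bounded_bilinear bounded_bilinear_inner)
  ultimately have "(\<lambda>t. g t \<bullet> f t) absolutely_integrable_on {a..b}"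
    using f absolutely_integrable_bounded_measurable_product[of "\<lambda>x y. x \<bullet> y" g "{a..b}" f]
    by (simp add: integrable_lebesgue_on_iff)
  then show ?thesis
    by (simp add: integrable_lebesgue_on_iff inner_commute)
qed

context
  fixes u :: "real \<Rightarrow> 'a::euclidean_space" and a b :: real
  assumes ab: "a < b" and u: "abs_continuous_on a b u"
begin

text \<open>The density f of u is a derivative of u a.e. by Lebesgue differentiation, and
  derivatives within a nondegenerate closed interval are unique. So \<open>vector_derivative\<close>
  agrees a.e. with f and inherits its integrability and its integrals.\<close>

lemma
  shows abs_continuous_AE_deriv: "AE t in lebesgue_on {a..b}.
      (u has_vector_derivative vector_derivative u (at t within {a..b})) (at t within {a..b})"
    and abs_continuous_integrable_deriv:
      "integrable (lebesgue_on {a..b}) (\<lambda>t. vector_derivative u (at t within {a..b}))"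
    and abs_continuous_has_integral_deriv: "a \<le> x \<Longrightarrow> x \<le> y \<Longrightarrow> y \<le> b \<Longrightarrow>
      ((\<lambda>t. vector_derivative u (at t within {a..b})) has_integral (u y - u x)) {x..y}"
proof -
  obtain f where f: "f absolutely_integrable_on {a..b}"
    "\<And>t. t \<in> {a..b} \<Longrightarrow> (f has_integral (u t - u a)) {a..t}"
    by (rule abs_continuous_imp_integral[OF ab u]) (rule that)
  have "f integrable_on {a..b}"
    using f(1) by (simp add: absolutely_integrable_on_def)
  then have ae: "AE t in lebesgue_on {a..b}. (u has_vector_derivative f t) (at t within {a..b})"
  proof (rule eventually_mono[OF eventually_conj[OF lebesgue_differentiation AE_space]])
    fix t assume t: "((\<lambda>x. integral {a..x} f) has_vector_derivative f t) (at t within {a..b}) \<and>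
      t \<in> space (lebesgue_on {a..b})"
    then have d: "((\<lambda>x. u a + integral {a..x} f) has_vector_derivative 0 + f t) (at t within {a..b})"
      by (intro has_vector_derivative_add has_vector_derivative_const) auto
    show "(u has_vector_derivative f t) (at t within {a..b})"
    proof (rule has_vector_derivative_transform)
      show "((\<lambda>x. u a + integral {a..x} f) has_vector_derivative f t) (at t within {a..b})"
        using d by simp
      show "u x = u a + integral {a..x} f" if "x \<in> {a..b}" for x
        using integral_unique[OF f(2)[OF that]] by simp
    qed (use t in simp)
  qed
  have eq: "AE t in lebesgue_on {a..b}. f t = vector_derivative u (at t within {a..b})"
    using ae AE_space
  proof eventually_elim
    case (elim t)
    then show ?case
      using vector_derivative_within_closed_interval[OF ab _ elim(1)] by simp
  qed
  show "AE t in lebesgue_on {a..b}.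
      (u has_vector_derivative vector_derivative u (at t within {a..b})) (at t within {a..b})"
    using ae eq by eventually_elim simp
  show "integrable (lebesgue_on {a..b}) (\<lambda>t. vector_derivative u (at t within {a..b}))"
    by (rule integrable_cong_AE_lebesgue_on[OF _ _ eq]) (simp_all add: integrable_lebesgue_on_iff f(1))
  show "((\<lambda>t. vector_derivative u (at t within {a..b})) has_integral (u y - u x)) {x..y}"
    if xy: "a \<le> x" "x \<le> y" "y \<le> b"
  proof -
    have "(f has_integral (u y - u x)) {x..y}"
    proof -
      have "f integrable_on {x..y}"
        by (rule integrable_on_subinterval[OF has_integral_integrable[OF f(2)[of y]]]) (use xy in auto)
      then obtain I where I: "(f has_integral I) {x..y}" by blast
      have "(f has_integral (u x - u a) + I) {a..y}"
        by (rule has_integral_combine[OF xy(1,2) f(2) I]) (use xy in simp)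
      moreover have "(f has_integral (u y - u a)) {a..y}"
        using f(2)[of y] xy by simp
      ultimately have "(u x - u a) + I = u y - u a" by (rule has_integral_unique)
      then have "I = u y - u x" by (simp add: algebra_simps)
      then show ?thesis
        using I by simp
    qed
    moreover have "AE t in lebesgue. t \<in> {a..b} \<longrightarrow> f t = vector_derivative u (at t within {a..b})"
      using eq by (simp add: AE_restrict_space_iff)
    then have "AE t in lborel. t \<in> {a..b} \<longrightarrow> f t = vector_derivative u (at t within {a..b})"
      by (simp only: AE_completion_iff)
    then have "AE t in lborel. t \<in> {x..y} \<longrightarrow> f t = vector_derivative u (at t within {a..b})"
      by (rule eventually_mono) (use xy in simp)
    ultimately show ?thesis
      by (simp only: has_integral_AE)
  qed
qed

end

section \<open>Absolute continuity from integral bounds\<close>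

lemma sum_integral_interval_family_le:
  fixes \<psi> :: "real \<Rightarrow> real"
  assumes D: "interval_family a b D" and \<psi>: "\<psi> integrable_on {a..b}" "\<And>t. t \<in> {a..b} \<Longrightarrow> 0 \<le> \<psi> t"
  shows "(\<Sum>(x, y)\<in>D. integral {x..y} \<psi>) \<le> integral {a..b} \<psi>"
proof -
  define S where "S = (\<lambda>(x::real, y). {x<..<y})"
  have D': "finite D" "\<And>p. p \<in> D \<Longrightarrow> a \<le> fst p \<and> fst p \<le> snd p \<and> snd p \<le> b"
    "disjoint_family_on S D"
    using D by (auto simp: interval_family_def S_def)
  have "((\<lambda>t. if t \<in> S p then \<psi> t else 0) has_integral (case p of (x, y) \<Rightarrow> integral {x..y} \<psi>)) {a..b}"
    if p: "p \<in> D" for p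
  proof -
    have "\<psi> integrable_on {fst p..snd p}"
      using D'(2)[OF p] by (intro integrable_on_subinterval[OF \<psi>(1)]) auto
    then have "(\<psi> has_integral (integral {fst p..snd p} \<psi>)) {fst p<..<snd p}"
      by (simp add: integrable_integral flip: has_integral_Icc_iff_Ioo)
    moreover have "{fst p<..<snd p} \<subseteq> {a..b}"
      using D'(2)[OF p] by auto
    ultimately have "((\<lambda>t. if t \<in> {fst p<..<snd p} then \<psi> t else 0) has_integral
        (integral {fst p..snd p} \<psi>)) {a..b}"
      by (simp only: has_integral_restrict)
    then show ?thesis
      by (simp only: S_def case_prod_unfold)
  qed
  then have "((\<lambda>t. \<Sum>p\<in>D. if t \<in> S p then \<psi> t else 0) has_integral
      (\<Sum>p\<in>D. case p of (x, y) \<Rightarrow> integral {x..y} \<psi>)) {a..b}"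
    using D'(1) by (intro has_integral_sum) auto
  then show ?thesis
  proof (rule has_integral_le[OF _ integrable_integral[OF \<psi>(1)]])
    fix t assume t: "t \<in> {a..b}"
    \<comment> \<open>Disjointness: the indicators of the open members add up to the indicator of
      their union, which is at most 1.\<close>
    have "(\<Sum>p\<in>D. if t \<in> S p then \<psi> t else 0) = (\<Sum>p\<in>D. indicator (S p) t) * \<psi> t"
      unfolding sum_distrib_right by (intro sum.cong) (auto simp: indicator_def)
    also have "(\<Sum>p\<in>D. indicator (S p) t) = (indicator (\<Union>p\<in>D. S p) t :: real)"
      using D' by (simp add: indicator_UN_disjoint)
    also have "\<dots> * \<psi> t \<le> \<psi> t"
      using \<psi>(2)[OF t] by (auto simp: indicator_def)
    finally show "(\<Sum>p\<in>D. if t \<in> S p then \<psi> t else 0) \<le> \<psi> t" .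
  qed
qed

lemma sum_increments_le:
  fixes u :: "real \<Rightarrow> 'a::real_normed_vector" and \<psi> :: "real \<Rightarrow> real"
  assumes D: "interval_family a b D" and \<psi>: "\<psi> integrable_on {a..b}" "\<And>t. t \<in> {a..b} \<Longrightarrow> 0 \<le> \<psi> t"
    and le: "\<And>x y. a \<le> x \<Longrightarrow> x \<le> y \<Longrightarrow> y \<le> b \<Longrightarrow> norm (u y - u x) \<le> integral {x..y} \<psi> + C * (y - x)"
  shows "sum_norm_increments u D \<le> integral {a..b} \<psi> + C * sum_lengths D"
proof -
  have "sum_norm_increments u D \<le> (\<Sum>(x, y)\<in>D. integral {x..y} \<psi> + C * (y - x))"
    using D le by (intro sum_mono) (auto simp: interval_family_def)
  also have "\<dots> = (\<Sum>(x, y)\<in>D. integral {x..y} \<psi>) + C * sum_lengths D"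
    by (simp add: case_prod_unfold sum.distrib sum_distrib_left)
  also have "\<dots> \<le> integral {a..b} \<psi> + C * sum_lengths D"
    using sum_integral_interval_family_le[OF D \<psi>] by simp
  finally show ?thesis .
qed

text \<open>A family of length below \<epsilon> / (2 (C + 1)) is short enough. The nonstrict affine
  bound comes directly out of integral estimates and passes to pointwise limits with the same C;
  minimizing sequences need both.\<close>

lemma abs_continuous_onI_affine:
  assumes "\<And>\<epsilon>. \<epsilon> > 0 \<Longrightarrow> \<exists>C\<ge>0. \<forall>D. interval_family a b D \<longrightarrow>
    sum_norm_increments u D \<le> \<epsilon> + C * sum_lengths D"
  shows "abs_continuous_on a b u"
  unfolding abs_continuous_on_iff
proof (intro allI impI)
  fix \<epsilon> :: real assume "\<epsilon> > 0"
  then obtain C where C: "C \<ge> 0" "\<And>D. interval_family a b D \<Longrightarrow>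
    sum_norm_increments u D \<le> \<epsilon> / 2 + C * sum_lengths D"
    using assms[of "\<epsilon> / 2"] by auto
  show "\<exists>\<delta>>0. \<forall>D. interval_family a b D \<longrightarrow> sum_lengths D < \<delta> \<longrightarrow>
      sum_norm_increments u D < \<epsilon>"
  proof (intro exI[of _ "\<epsilon> / (2 * (C + 1))"] conjI allI impI)
    fix D assume D: "interval_family a b D" "sum_lengths D < \<epsilon> / (2 * (C + 1))"
    have pos: "0 \<le> sum_lengths D"
      using D(1) by (intro sum_nonneg) (auto simp: interval_family_def)
    have "C * sum_lengths D \<le> (C + 1) * sum_lengths D"
      using pos by (intro mult_right_mono) auto
    also have "\<dots> < (C + 1) * (\<epsilon> / (2 * (C + 1)))"
      using D(2) C(1) by (intro mult_strict_left_mono) auto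
    also have "\<dots> = \<epsilon> / 2"
      using C(1) by (simp add: divide_simps)
    finally show "sum_norm_increments u D < \<epsilon>"
      using C(2)[OF D(1)] by simp
  qed (use \<open>\<epsilon> > 0\<close> C in auto)
qed

text \<open>The part of \<open>norm (f t)\<close> above a level n has integral below \<epsilon> for
  large n, by dominated convergence, and what remains is bounded by n. The level serves as the
  constant C.\<close>

lemma abs_continuous_indefinite_integral:
  fixes f :: "real \<Rightarrow> 'a::euclidean_space"
  assumes f: "integrable (lebesgue_on {a..b}) f"
    and u: "\<And>x y. a \<le> x \<Longrightarrow> x \<le> y \<Longrightarrow> y \<le> b \<Longrightarrow> (f has_integral (u y - u x)) {x..y}"
  shows "abs_continuous_on a b u"
proof (rule abs_continuous_onI_affine)
  fix \<epsilon> :: real assume "\<epsilon> > 0"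
  define \<psi> where "\<psi> = (\<lambda>(n::nat) t. if norm (f t) > n then norm (f t) else 0)"
  have [measurable]: "f \<in> borel_measurable (lebesgue_on {a..b})"
    using f by auto
  have meas: "\<psi> n \<in> borel_measurable (lebesgue_on {a..b})" for n
    unfolding \<psi>_def by measurable
  have \<psi>_int: "integrable (lebesgue_on {a..b}) (\<psi> n)" for n
    by (rule Bochner_Integration.integrable_bound[OF f meas]) (auto simp: \<psi>_def)
  have "(\<lambda>n. LINT t|lebesgue_on {a..b}. \<psi> n t) \<longlonglongrightarrow> (LINT t|lebesgue_on {a..b}. 0)"
  proof (rule integral_dominated_convergence[where w = "\<lambda>t. norm (f t)"])
    show "AE t in lebesgue_on {a..b}. (\<lambda>n. \<psi> n t) \<longlonglongrightarrow> 0"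
    proof (intro AE_I2 tendsto_eventually)
      fix t
      obtain n :: nat where "norm (f t) \<le> n"
        using real_arch_simple by blast
      then have "\<forall>m\<ge>n. \<psi> m t = 0" by (auto simp: \<psi>_def)
      then show "\<forall>\<^sub>F n in sequentially. \<psi> n t = 0" by (auto simp: eventually_sequentially)
    qed
  qed (use f meas in \<open>auto simp: \<psi>_def\<close>)
  then have "\<forall>\<^sub>F n in sequentially. (LINT t|lebesgue_on {a..b}. \<psi> n t) < \<epsilon>"
    using \<open>\<epsilon> > 0\<close> by (intro order_tendstoD) auto
  then obtain n where n: "(LINT t|lebesgue_on {a..b}. \<psi> n t) < \<epsilon>"
    by (auto simp: eventually_sequentially)
  have I: "integral {a..b} (\<psi> n) < \<epsilon>"
    using n \<psi>_int by (simp add: lebesgue_integral_eq_integral)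
  have \<psi>_on: "\<psi> n integrable_on {a..b}"
    using \<psi>_int by (simp add: integrable_on_lebesgue_on)
  have le: "norm (u y - u x) \<le> integral {x..y} (\<psi> n) + n * (y - x)" if xy: "a \<le> x" "x \<le> y" "y \<le> b" for x y :: real
  proof -
    have on: "\<psi> n integrable_on {x..y}"
      using xy by (intro integrable_on_subinterval[OF \<psi>_on]) auto
    have "norm (integral {x..y} f) \<le> integral {x..y} (\<lambda>t. \<psi> n t + n)"
    proof (rule integral_norm_bound_integral)
      show "f integrable_on {x..y}"
        using u[OF xy] by auto
      show "(\<lambda>t. \<psi> n t + n) integrable_on {x..y}"
        using on by (intro integrable_add) auto
    qed (auto simp: \<psi>_def)
    also have "\<dots> = integral {x..y} (\<psi> n) + n * (y - x)"
      using on xy by (subst Henstock_Kurzweil_Integration.integral_add) (auto simp: mult.commute)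
    finally show ?thesis
      using u[OF xy] by (simp add: integral_unique)
  qed
  show "\<exists>C\<ge>0. \<forall>D. interval_family a b D \<longrightarrow>
    sum_norm_increments u D \<le> \<epsilon> + C * sum_lengths D"
  proof (intro exI[of _ "real n"] conjI allI impI)
    fix D assume D: "interval_family a b D"
    have "sum_norm_increments u D \<le> integral {a..b} (\<psi> n) + n * sum_lengths D"
      using le by (intro sum_increments_le[OF D \<psi>_on]) (auto simp: \<psi>_def)
    then show "sum_norm_increments u D \<le> \<epsilon> + n * sum_lengths D"
      using I by linarith
  qed simp
qed

lemma continuous_on_Icc_bounded:
  fixes f :: "real \<Rightarrow> 'a::real_normed_vector"
  assumes "continuous_on {a..b} f"
  obtains B where "\<And>t. t \<in> {a..b} \<Longrightarrow> norm (f t) \<le> B"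
proof -
  have "bounded (f ` {a..b})"
    using assms by (simp add: compact_continuous_image compact_imp_bounded)
  then show ?thesis
    using that unfolding bounded_iff by blast
qed

lemma abs_continuous_inner:
  fixes u w :: "real \<Rightarrow> 'a::euclidean_space"
  assumes u: "abs_continuous_on a b u" and w: "abs_continuous_on a b w"
  shows "abs_continuous_on a b (\<lambda>t. u t \<bullet> w t)"
proof -
  obtain B1 where B1: "\<And>t. t \<in> {a..b} \<Longrightarrow> norm (u t) \<le> B1"
    using continuous_on_Icc_bounded[OF abs_continuous_continuous[OF u]] by blast
  obtain B2 where B2: "\<And>t. t \<in> {a..b} \<Longrightarrow> norm (w t) \<le> B2"
    using continuous_on_Icc_bounded[OF abs_continuous_continuous[OF w]] by blast
  define B where "B = \<bar>B1\<bar> + \<bar>B2\<bar>"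
  have B': "norm (u t) \<le> B" "norm (w t) \<le> B" if "t \<in> {a..b}" for t
    using B1[OF that] B2[OF that] by (auto simp: B_def)
  show ?thesis
  proof (rule abs_continuous_bound[OF u w, of B])
    fix x y assume xy: "x \<in> {a..b}" "y \<in> {a..b}"
    have "u y \<bullet> w y - u x \<bullet> w x = (u y - u x) \<bullet> w y + u x \<bullet> (w y - w x)"
      by (simp add: inner_diff_left inner_diff_right)
    also have "norm \<dots> \<le> norm (u y - u x) * norm (w y) + norm (u x) * norm (w y - w x)"
      unfolding real_norm_def by (intro order_trans[OF abs_triangle_ineq] add_mono Cauchy_Schwarz_ineq2)
    also have "\<dots> \<le> norm (u y - u x) * B + B * norm (w y - w x)"
      using B' xy by (intro add_mono mult_left_mono mult_right_mono) auto
    finally show "norm (u y \<bullet> w y - u x \<bullet> w x) \<le> B * (norm (u y - u x) + norm (w y - w x))"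
      by (simp add: algebra_simps)
  qed (simp add: B_def)
qed

text \<open>The scalar product is itself absolutely continuous, so the fundamental theorem applies
  to it, and the product rule identifies its derivative a.e.\<close>

lemma abs_continuous_integral_by_parts:
  fixes u w :: "real \<Rightarrow> 'a::euclidean_space"
  assumes ab: "a < b" and u: "abs_continuous_on a b u" and w: "abs_continuous_on a b w"
  shows "(LINT t|lebesgue_on {a..b}. vector_derivative u (at t within {a..b}) \<bullet> w t)
    + (LINT t|lebesgue_on {a..b}. u t \<bullet> vector_derivative w (at t within {a..b})) = u b \<bullet> w b - u a \<bullet> w a"
proof -
  let ?du = "\<lambda>t. vector_derivative u (at t within {a..b})"
  let ?dw = "\<lambda>t. vector_derivative w (at t within {a..b})"
  let ?dp = "\<lambda>t. vector_derivative (\<lambda>t. u t \<bullet> w t) (at t within {a..b})"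
  have i1: "integrable (lebesgue_on {a..b}) (\<lambda>t. ?du t \<bullet> w t)"
    by (intro integrable_inner_continuous abs_continuous_integrable_deriv[OF ab u]
        abs_continuous_continuous w)
  have "integrable (lebesgue_on {a..b}) (\<lambda>t. ?dw t \<bullet> u t)"
    by (intro integrable_inner_continuous abs_continuous_integrable_deriv[OF ab w]
        abs_continuous_continuous u)
  then have i2: "integrable (lebesgue_on {a..b}) (\<lambda>t. u t \<bullet> ?dw t)"
    by (simp only: inner_commute)
  have p: "abs_continuous_on a b (\<lambda>t. u t \<bullet> w t)" by (rule abs_continuous_inner[OF u w])
  have "AE t in lebesgue_on {a..b}. ?dp t = ?du t \<bullet> w t + u t \<bullet> ?dw t"
    using abs_continuous_AE_deriv[OF ab u] abs_continuous_AE_deriv[OF ab w] AE_space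
  proof eventually_elim
    case (elim t)
    have "((\<lambda>t. u t \<bullet> w t) has_vector_derivative u t \<bullet> ?dw t + ?du t \<bullet> w t) (at t within {a..b})"
      by (rule bounded_bilinear.has_vector_derivative[OF bounded_bilinear_inner elim(1,2)])
    then show ?case
      using vector_derivative_within_closed_interval[OF ab, of t "\<lambda>t. u t \<bullet> w t"] elim(3) by simp
  qed
  then have "(LINT t|lebesgue_on {a..b}. ?dp t) = (LINT t|lebesgue_on {a..b}. ?du t \<bullet> w t + u t \<bullet> ?dw t)"
    by (rule integral_cong_AE[OF borel_measurable_integrable[OF abs_continuous_integrable_deriv[OF ab p]]
          borel_measurable_integrable[OF Bochner_Integration.integrable_add[OF i1 i2]]])
  moreover have "(LINT t|lebesgue_on {a..b}. ?dp t) = u b \<bullet> w b - u a \<bullet> w a"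
    by (rule LINT_eq_of_has_integral[OF abs_continuous_integrable_deriv[OF ab p]
          abs_continuous_has_integral_deriv[OF ab p]]) (use ab in simp_all)
  ultimately show ?thesis
    using i1 i2 by simp
qed

section \<open>Legendre transform of a superlinear family\<close>

lemma strictly_convexD:
  assumes "strictly_convex F" "0 \<le> s" "s \<le> 1"
  shows "F ((1 - s) *\<^sub>R x + s *\<^sub>R y) \<le> (1 - s) * F x + s * F y"
proof (cases "x = y \<or> s = 0 \<or> s = 1")
  case True
  then show ?thesis
    by (auto simp: algebra_simps)
next
  case False
  then show ?thesis
    using assms unfolding strictly_convex_def by (intro less_imp_le) (auto simp: less_le)
qed

lemma superlinearD:
  assumes "superlinear F"
  obtains R where "R \<ge> 1" "\<And>u. norm u \<ge> R \<Longrightarrow> M * norm u \<le> F u"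
proof -
  have "\<forall>\<^sub>F u in at_infinity. M \<le> F u / norm u"
    using assms unfolding superlinear_def filterlim_at_top by blast
  then obtain b where b: "\<And>u. b \<le> norm u \<Longrightarrow> M \<le> F u / norm u"
    unfolding eventually_at_infinity by blast
  show ?thesis
  proof (rule that[of "max b 1"])
    fix u :: 'a assume u: "max b 1 \<le> norm u"
    then have "0 < norm u" "M \<le> F u / norm u"
      using b[of u] by linarith+
    then show "M * norm u \<le> F u" by (simp add: pos_le_divide_eq)
  qed simp
qed

text \<open>Otherwise a subsequence keeps a fixed distance from l; being bounded, it has a
  convergent subsequence, whose limit would have to be l.\<close>

lemma tendsto_of_subsequence_limits:
  fixes x :: "nat \<Rightarrow> 'a::heine_borel"
  assumes bdd: "bounded (range x)"
    and lim: "\<And>r l'. strict_mono r \<Longrightarrow> (x \<circ> r) \<longlonglongrightarrow> l' \<Longrightarrow> l' = l"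
  shows "x \<longlonglongrightarrow> l"
proof (rule ccontr)
  assume "\<not> ?thesis"
  then obtain e where e: "e > 0" "\<exists>\<^sub>F n in sequentially. e \<le> dist (x n) l"
    unfolding tendsto_iff frequently_def by (auto simp: not_le)
  define S where "S = {n. e \<le> dist (x n) l}"
  have "infinite S"
    using e(2) by (simp add: S_def frequently_sequentially infinite_nat_iff_unbounded_le)
  then obtain r :: "nat \<Rightarrow> nat" where r: "strict_mono r" "\<And>n. r n \<in> S"
    using infinite_enumerate by blast
  have "bounded (range (x \<circ> r))"
    using bdd by (rule bounded_subset) auto
  then obtain l' r' where r': "strict_mono r'" "((x \<circ> r) \<circ> r') \<longlonglongrightarrow> l'"
    using bounded_imp_convergent_subsequence by blast
  have "l' = l"
    using lim[of "r \<circ> r'" l'] r r' by (simp add: strict_mono_o o_assoc)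
  then have "\<forall>\<^sub>F n in sequentially. dist (((x \<circ> r) \<circ> r') n) l < e"
    using r'(2) e(1) by (auto simp: tendsto_iff)
  then show False
    using r(2) by (auto simp: S_def eventually_sequentially not_le[symmetric])
qed

locale superlinear_family =
  fixes K :: "real set" and H :: "real \<Rightarrow> 'a::euclidean_space \<Rightarrow> real"
  assumes K: "compact K"
    and cont: "continuous_on (K \<times> UNIV) (\<lambda>(t, u). H t u)"
    and convex: "\<And>t. t \<in> K \<Longrightarrow> strictly_convex (H t)"
    and superlin: "\<And>t. t \<in> K \<Longrightarrow> superlinear (H t)"
begin

lemma continuous_at_time: "t \<in> K \<Longrightarrow> continuous_on S (H t)"
  using continuous_on_compose2[OF cont, of S "\<lambda>u. (t, u)"] by (force intro!: continuous_intros)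

lemma tendsto_H:
  assumes "\<And>n. t n \<in> K" "t \<longlonglongrightarrow> t0" "t0 \<in> K" "u \<longlonglongrightarrow> u0"
  shows "(\<lambda>n. H (t n) (u n)) \<longlonglongrightarrow> H t0 u0"
proof -
  have "((\<lambda>(t, u). H t u) \<circ> (\<lambda>n. (t n, u n))) \<longlonglongrightarrow> (\<lambda>(t, u). H t u) (t0, u0)"
    using cont[unfolded continuous_on_sequentially, rule_format, of "(t0, u0)" "\<lambda>n. (t n, u n)"] assms
    by (auto intro!: tendsto_Pair)
  then show ?thesis
    by (simp add: o_def)
qed

lemma bounded_H: "\<exists>B\<ge>0. \<forall>t\<in>K. \<forall>u. norm u \<le> r \<longrightarrow> \<bar>H t u\<bar> \<le> B"
proof -
  have "compact ((\<lambda>(t, u). H t u) ` (K \<times> cball 0 r))"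
    by (intro compact_continuous_image continuous_on_subset[OF cont] compact_Times K) auto
  then obtain B where "\<And>y. y \<in> (\<lambda>(t, u). H t u) ` (K \<times> cball 0 r) \<Longrightarrow> \<bar>y\<bar> \<le> B"
    using compact_imp_bounded bounded_real by metis
  then have "\<bar>H t u\<bar> \<le> B" if "t \<in> K" "norm u \<le> r" for t u
    using that by force
  then have "\<bar>H t u\<bar> \<le> max B 0" if "t \<in> K" "norm u \<le> r" for t u
    using that by fastforce
  then show ?thesis
    by (intro exI[of _ "max B 0"]) auto
qed

text \<open>Convexity pulls a violation at a far point back to a sphere of fixed radius R: on the
  segment from 0 the increments over \<open>H t 0\<close> grow at most linearly. By compactness of K
  the violations accumulate on this sphere, contradicting superlinearity at the limit time.\<close>

lemma uniformly_superlinear: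
  "\<exists>R. \<forall>t\<in>K. \<forall>u. norm u \<ge> R \<longrightarrow> M * norm u \<le> H t u - H t 0"
proof (rule ccontr)
  assume "\<not> ?thesis"
  then have "\<forall>n::nat. \<exists>t u. t \<in> K \<and> real n \<le> norm u \<and> H t u - H t 0 < M * norm u"
    by (meson not_le)
  then obtain t u where tu: "\<And>n::nat. t n \<in> K" "\<And>n. real n \<le> norm (u n)"
    "\<And>n. H (t n) (u n) - H (t n) 0 < M * norm (u n)"
    by metis
  obtain t0 r where r: "t0 \<in> K" "strict_mono r" "(t \<circ> r) \<longlonglongrightarrow> t0"
    using K tu(1) unfolding compact_def by metis
  \<comment> \<open>The slope exceeds M by enough that, as R >= 1, the function \<open>H t0\<close>
    is strictly above M R + \<open>H t0 0\<close> on the sphere of radius R; in the limit of the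
    violations only a nonstrict inequality is left to contradict.\<close>
  obtain R where R: "R \<ge> 1" "\<And>u. norm u \<ge> R \<Longrightarrow> (\<bar>M\<bar> + 2 + \<bar>H t0 0\<bar>) * norm u \<le> H t0 u"
    using superlinearD[OF superlin[OF r(1)]] by blast
  define s where "s = (\<lambda>n. R / norm (u (r n)))"
  define z where "z = (\<lambda>n. s n *\<^sub>R u (r n))"
  \<comment> \<open>From index N on, \<open>u (r n)\<close> has norm at least R, so the contraction
    factor s lies between 0 and 1.\<close>
  define N where "N = nat \<lceil>R\<rceil>"
  have big: "R \<le> norm (u (r (n + N)))" for n
  proof -
    have "R \<le> real (n + N)" by (simp add: N_def) linarith
    also have "\<dots> \<le> r (n + N)"
      using seq_suble[OF r(2), of "n + N"] by (simp only: of_nat_le_iff)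
    also have "\<dots> \<le> norm (u (r (n + N)))" by (rule tu(2))
    finally show ?thesis .
  qed
  have nz: "norm (z (n + N)) = R" for n
    using big[of n] R(1) by (auto simp: z_def s_def)
  have s01: "0 \<le> s (n + N) \<and> s (n + N) \<le> 1" for n
    using big[of n] R(1) by (auto simp: s_def divide_le_eq_1)
  have less: "H (t (r (n + N))) (z (n + N)) - H (t (r (n + N))) 0 \<le> M * R" for n
  proof -
    let ?t = "t (r (n + N))" and ?u = "u (r (n + N))" and ?s = "s (n + N)"
    have "H ?t ((1 - ?s) *\<^sub>R 0 + ?s *\<^sub>R ?u) \<le> (1 - ?s) * H ?t 0 + ?s * H ?t ?u"
      using s01 by (intro strictly_convexD convex tu(1)) auto
    then have "H ?t (z (n + N)) - H ?t 0 \<le> ?s * (H ?t ?u - H ?t 0)"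
      by (simp add: z_def algebra_simps)
    also have "\<dots> \<le> ?s * (M * norm ?u)"
      using s01[of n] tu(3)[of "r (n + N)"] by (intro mult_left_mono) auto
    also have "\<dots> = M * R"
      using big[of n] R(1) by (auto simp: s_def)
    finally show ?thesis .
  qed
  have "bounded (range (\<lambda>n. z (n + N)))"
    unfolding bounded_iff using nz by (auto intro!: exI[of _ R])
  then obtain z0 r' where r': "strict_mono r'" "((\<lambda>n. z (n + N)) \<circ> r') \<longlonglongrightarrow> z0"
    using bounded_imp_convergent_subsequence by blast
  have t0: "(\<lambda>n. t (r (r' n + N))) \<longlonglongrightarrow> t0"
  proof -
    have "(\<lambda>n. (t \<circ> r) (n + N)) \<longlonglongrightarrow> t0" by (rule LIMSEQ_ignore_initial_segment[OF r(3)])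
    then show ?thesis
      using LIMSEQ_subseq_LIMSEQ[OF _ r'(1)] by (force simp: o_def)
  qed
  have "(\<lambda>n. H (t (r (r' n + N))) (z (r' n + N)) - H (t (r (r' n + N))) 0) \<longlonglongrightarrow> H t0 z0 - H t0 0"
    using r'(2) by (intro tendsto_diff tendsto_H tu(1) t0 r(1)) (auto simp: o_def)
  then have "H t0 z0 - H t0 0 \<le> M * R" by (rule LIMSEQ_le_const2) (use less in auto)
  moreover have "norm z0 = R"
  proof (rule LIMSEQ_unique)
    show "(\<lambda>n. norm (((\<lambda>n. z (n + N)) \<circ> r') n)) \<longlonglongrightarrow> norm z0" by (rule tendsto_norm[OF r'(2)])
    show "(\<lambda>n. norm (((\<lambda>n. z (n + N)) \<circ> r') n)) \<longlonglongrightarrow> R" by (simp add: nz)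
  qed
  moreover have "(\<bar>M\<bar> + 2 + \<bar>H t0 0\<bar>) * R \<ge> M * R + 2 + \<bar>H t0 0\<bar>"
  proof -
    have "M * R \<le> \<bar>M\<bar> * R"
      using R(1) by (intro mult_right_mono) auto
    moreover have "(2 + \<bar>H t0 0\<bar>) * 1 \<le> (2 + \<bar>H t0 0\<bar>) * R"
      using R(1) by (intro mult_left_mono) auto
    ultimately show ?thesis
      by (simp add: algebra_simps)
  qed
  ultimately show False
    using R(2)[of z0] by auto
qed

lemma linear_lower_bound: "\<exists>C. \<forall>t\<in>K. \<forall>u. M * norm u - C \<le> H t u"
proof -
  obtain R where R: "\<And>t u. t \<in> K \<Longrightarrow> norm u \<ge> R \<Longrightarrow> M * norm u \<le> H t u - H t 0"
    using uniformly_superlinear[of M] by blast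
  obtain B where B: "B \<ge> 0" "\<And>t u. t \<in> K \<Longrightarrow> norm u \<le> \<bar>R\<bar> \<Longrightarrow> \<bar>H t u\<bar> \<le> B"
    using bounded_H[of "\<bar>R\<bar>"] by blast
  show ?thesis
  proof (intro exI[of _ "B + \<bar>M\<bar> * \<bar>R\<bar>"] ballI allI)
    fix t u assume t: "t \<in> K"
    have 0: "\<bar>H t 0\<bar> \<le> B"
      using B(2)[OF t] by simp
    show "M * norm u - (B + \<bar>M\<bar> * \<bar>R\<bar>) \<le> H t u"
    proof (cases "norm u \<le> \<bar>R\<bar>")
      case True
      have "M * norm u \<le> \<bar>M\<bar> * \<bar>R\<bar>"
        using True by (metis abs_ge_zero abs_mult abs_norm_cancel mult_left_mono order_trans abs_ge_self)
      then show ?thesis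
        using B(2)[OF t True] by linarith
    next
      case False
      then have "M * norm u \<le> H t u - H t 0" by (intro R t) linarith
      moreover have "0 \<le> \<bar>M\<bar> * \<bar>R\<bar>" by simp
      ultimately show ?thesis
        using 0 by linarith
    qed
  qed
qed

section \<open>Maximizers in the conjugate and their continuity\<close>

abbreviation "H_star t \<equiv> convex_conjugate (H t)"

text \<open>This is the gradient of the conjugate at w, taken as the point where the supremum is
  attained. Coercivity provides such a point and strict convexity makes it unique, so the choice is
  determined. Its subgradient inequality does the work of a derivative of
  \<open>H_star\<close>.\<close>

definition conj_max :: "real \<Rightarrow> 'a \<Rightarrow> 'a" where
  "conj_max t w = (SOME q. \<forall>u. u \<bullet> w - H t u \<le> q \<bullet> w - H t q)"

text \<open>Outside a large ball, growth of H with slope \<open>norm w\<close> puts the function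
  below its value at 0, so a maximum over the ball is global.\<close>

lemma conj_max:
  assumes t: "t \<in> K"
  shows "u \<bullet> w - H t u \<le> conj_max t w \<bullet> w - H t (conj_max t w)"
proof -
  obtain R where R: "\<And>u. norm u \<ge> R \<Longrightarrow> norm w * norm u \<le> H t u - H t 0"
    using uniformly_superlinear[of "norm w"] t by blast
  have "continuous_on (cball 0 \<bar>R\<bar>) (\<lambda>u. u \<bullet> w - H t u)"
    by (intro continuous_intros continuous_at_time t)
  then obtain q where q: "q \<in> cball 0 \<bar>R\<bar>" "\<And>u. u \<in> cball 0 \<bar>R\<bar> \<Longrightarrow> u \<bullet> w - H t u \<le> q \<bullet> w - H t q"
    using continuous_attains_sup[of "cball 0 \<bar>R\<bar>" "\<lambda>u. u \<bullet> w - H t u"] by auto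
  have "u \<bullet> w - H t u \<le> q \<bullet> w - H t q" for u
  proof (cases "norm u \<le> \<bar>R\<bar>")
    case True
    then show ?thesis
      using q(2) by simp
  next
    case False
    then have "R \<le> norm u" by linarith
    then have "u \<bullet> w \<le> H t u - H t 0"
      using R[of u] norm_cauchy_schwarz[of u w] by (simp add: mult.commute)
    moreover have "0 \<bullet> w - H t 0 \<le> q \<bullet> w - H t q" by (rule q(2)) simp
    ultimately show ?thesis
      by simp
  qed
  then have "\<exists>q. \<forall>u. u \<bullet> w - H t u \<le> q \<bullet> w - H t q" by blast
  from someI_ex[OF this] show ?thesis
    unfolding conj_max_def by blast
qed

lemma conj_max_unique:
  assumes t: "t \<in> K" and p: "\<And>u. u \<bullet> w - H t u \<le> p \<bullet> w - H t p"
  shows "p = conj_max t w"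
proof (rule ccontr)
  let ?q = "conj_max t w"
  assume "p \<noteq> ?q"
  then have "H t ((1 - 1/2) *\<^sub>R p + (1/2) *\<^sub>R ?q) < (1 - 1/2) * H t p + (1/2) * H t ?q"
    by (intro convex[OF t, unfolded strictly_convex_def, rule_format]) auto
  moreover have "((1 - 1/2) *\<^sub>R p + (1/2) *\<^sub>R ?q) \<bullet> w = (p \<bullet> w + ?q \<bullet> w) / 2"
    by (simp add: inner_add_left)
  moreover note p[of "(1 - 1/2) *\<^sub>R p + (1/2) *\<^sub>R ?q"] p[of ?q] conj_max[OF t, of p w]
  ultimately show False
    by (simp add: field_simps)
qed

lemma convex_conjugate_eq:
  assumes t: "t \<in> K"
  shows "H_star t w = conj_max t w \<bullet> w - H t (conj_max t w)"
  unfolding convex_conjugate_def by (rule cSup_eq_maximum) (use conj_max[OF t] in auto)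

lemma Fenchel: "t \<in> K \<Longrightarrow> u \<bullet> w - H t u \<le> H_star t w"
  using conj_max convex_conjugate_eq by simp

text \<open>The maximizer at w is a competitor at w'.\<close>

lemma conj_subgradient:
  assumes "t \<in> K"
  shows "H_star t w + conj_max t w \<bullet> (w' - w) \<le> H_star t w'"
  using Fenchel[OF assms, of "conj_max t w" w'] convex_conjugate_eq[OF assms, of w]
  by (simp add: inner_diff_right)

text \<open>Comparison with the competitor 0: growth of H with slope r + 1, against slope r from the
  linear term, leaves a bound on the norm of the maximizer itself.\<close>

lemma bounded_conj_max: "\<exists>B. \<forall>t\<in>K. \<forall>w. norm w \<le> r \<longrightarrow> norm (conj_max t w) \<le> B"
proof -
  obtain C where C: "\<And>t u. t \<in> K \<Longrightarrow> (r + 1) * norm u - C \<le> H t u"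
    using linear_lower_bound[of "r + 1"] by blast
  obtain B where B: "\<And>t u. t \<in> K \<Longrightarrow> norm u \<le> 0 \<Longrightarrow> \<bar>H t u\<bar> \<le> B"
    using bounded_H[of 0] by blast
  show ?thesis
  proof (intro exI[of _ "C + B"] ballI allI impI)
    fix t and w :: 'a assume t: "t \<in> K" and w: "norm w \<le> r"
    let ?q = "conj_max t w"
    have "- H t 0 \<le> ?q \<bullet> w - H t ?q"
      using conj_max[OF t, of 0 w] by simp
    moreover have "?q \<bullet> w \<le> norm ?q * r"
      using norm_cauchy_schwarz[of ?q w] mult_left_mono[OF w norm_ge_zero[of ?q]] by linarith
    moreover have "\<bar>H t 0\<bar> \<le> B"
      using B[OF t] by simp
    ultimately show "norm ?q \<le> C + B"
      using C[OF t, of ?q] by (simp add: algebra_simps)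
  qed
qed

text \<open>Maximizers stay bounded, and a limit of maximizers is a maximizer by joint continuity of
  H; uniqueness identifies it.\<close>

lemma continuous_conj_max: "continuous_on (K \<times> UNIV) (\<lambda>(t, w). conj_max t w)"
  unfolding continuous_on_sequentially
proof (intro ballI allI impI)
  fix x :: "nat \<Rightarrow> real \<times> 'a" and p
  assume p: "p \<in> K \<times> UNIV" and x: "(\<forall>n. x n \<in> K \<times> UNIV) \<and> x \<longlonglongrightarrow> p"
  obtain t0 w0 where p_eq: "p = (t0, w0)" by fastforce
  define t where "t = (\<lambda>n. fst (x n))"
  define w where "w = (\<lambda>n. snd (x n))"
  have t: "t0 \<in> K" "\<And>n. t n \<in> K" "t \<longlonglongrightarrow> t0" and w: "w \<longlonglongrightarrow> w0"
    using p x tendsto_fst[of x p sequentially] tendsto_snd[of x p sequentially]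
    by (auto simp: p_eq t_def w_def mem_Times_iff)
  obtain r where r: "\<And>n. norm (w n) \<le> r"
    using convergent_imp_bounded[OF w] by (auto simp: bounded_iff)
  obtain B where B: "\<And>n. norm (conj_max (t n) (w n)) \<le> B"
    using bounded_conj_max[of r] t(2) r by blast
  have "(\<lambda>n. conj_max (t n) (w n)) \<longlonglongrightarrow> conj_max t0 w0"
  proof (rule tendsto_of_subsequence_limits)
    show "bounded (range (\<lambda>n. conj_max (t n) (w n)))"
      unfolding bounded_iff using B by auto
    fix s l assume s: "strict_mono s" "((\<lambda>n. conj_max (t n) (w n)) \<circ> s) \<longlonglongrightarrow> l"
    have ts: "(\<lambda>n. t (s n)) \<longlonglongrightarrow> t0" and ws: "(\<lambda>n. w (s n)) \<longlonglongrightarrow> w0"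
      using LIMSEQ_subseq_LIMSEQ[OF t(3) s(1)] LIMSEQ_subseq_LIMSEQ[OF w s(1)] by (simp_all add: o_def)
    have qs: "(\<lambda>n. conj_max (t (s n)) (w (s n))) \<longlonglongrightarrow> l"
      using s(2) by (simp add: o_def)
    show "l = conj_max t0 w0"
    proof (rule conj_max_unique[OF t(1)])
      fix u
      show "u \<bullet> w0 - H t0 u \<le> l \<bullet> w0 - H t0 l"
      proof (rule LIMSEQ_le)
        show "(\<lambda>n. u \<bullet> w (s n) - H (t (s n)) u) \<longlonglongrightarrow> u \<bullet> w0 - H t0 u"
          by (intro tendsto_intros tendsto_H t ts ws)
        show "(\<lambda>n. conj_max (t (s n)) (w (s n)) \<bullet> w (s n) - H (t (s n)) (conj_max (t (s n)) (w (s n))))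
            \<longlonglongrightarrow> l \<bullet> w0 - H t0 l"
          by (intro tendsto_intros tendsto_H t ts ws qs)
      qed (use conj_max[OF t(2)] in auto)
    qed
  qed
  then show "((\<lambda>(t, w). conj_max t w) \<circ> x) \<longlonglongrightarrow> (\<lambda>(t, w). conj_max t w) p"
    by (simp add: o_def p_eq t_def w_def case_prod_unfold)
qed

lemma continuous_conjugate: "continuous_on (K \<times> UNIV) (\<lambda>(t, w). H_star t w)"
proof -
  have "continuous_on (K \<times> UNIV) (\<lambda>p. (\<lambda>(t, w). conj_max t w) p \<bullet> snd p
      - (\<lambda>(t, u). H t u) (fst p, (\<lambda>(t, w). conj_max t w) p))"
    by (intro continuous_intros continuous_conj_max continuous_on_compose2[OF cont]) auto
  then show ?thesis
    by (rule continuous_on_cong[THEN iffD1, rotated 2]) (auto simp: convex_conjugate_eq)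
qed

text \<open>First-order condition at the maximum of \<open>u \<bullet> w - H t u\<close>. This is
  Legendre reciprocity: the gradient of the conjugate inverts the gradient of H.\<close>

lemma GDERIV_conj_max:
  assumes t: "t \<in> K" and diff: "H t differentiable (at (conj_max t w))"
  shows "GDERIV (H t) (conj_max t w) :> w"
proof -
  let ?q = "conj_max t w"
  obtain L where L: "(H t has_derivative L) (at ?q)"
    using diff by (auto simp: differentiable_def)
  have "((\<lambda>u. u \<bullet> w - H t u) has_derivative (\<lambda>h. h \<bullet> w - L h)) (at ?q)"
    by (auto intro!: derivative_eq_intros L)
  then have "(\<lambda>h. h \<bullet> w - L h) = (\<lambda>h. 0)"
    by (rule has_derivative_local_max) (use conj_max[OF t] in auto)
  then have "L = (\<lambda>h. h \<bullet> w)" by (auto simp: fun_eq_iff)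
  then show ?thesis
    using L by (simp add: gderiv_def)
qed

lemma gradient_conj_max:
  assumes t: "t \<in> K" and diff: "H t differentiable (at (conj_max t w))"
  shows "gradient (H t) (conj_max t w) = w"
  unfolding gradient_def
proof (rule the_equality)
  show "GDERIV (H t) (conj_max t w) :> w" by (rule GDERIV_conj_max[OF assms])
  fix D assume "GDERIV (H t) (conj_max t w) :> D"
  then have "(\<lambda>h. h \<bullet> D) = (\<lambda>h. h \<bullet> w)"
    using GDERIV_conj_max[OF assms] unfolding gderiv_def by (rule has_derivative_unique)
  then have "(D - w) \<bullet> D = (D - w) \<bullet> w" by metis
  then show "D = w" by (metis inner_diff_right inner_eq_zero_iff eq_iff_diff_eq_0)
qed

text \<open>Testing the maximality of q with q + sgn w bounds norm w by the increment of H from q to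
  q + sgn w. Read through reciprocity, gradients of H over a bounded set are bounded uniformly in t;
  this makes the derivative of the solution bounded.\<close>

lemma norm_le_of_bounded_conj_max:
  assumes r: "r \<ge> 0"
  shows "\<exists>B. \<forall>t\<in>K. \<forall>w. norm (conj_max t w) \<le> r \<longrightarrow> norm w \<le> B"
proof -
  obtain B where B: "B \<ge> 0" "\<And>t u. t \<in> K \<Longrightarrow> norm u \<le> r + 1 \<Longrightarrow> \<bar>H t u\<bar> \<le> B"
    using bounded_H[of "r + 1"] by blast
  show ?thesis
  proof (intro exI[of _ "2 * B"] ballI allI impI)
    fix t and w :: 'a assume t: "t \<in> K" and q: "norm (conj_max t w) \<le> r"
    let ?q = "conj_max t w"
    have "norm (?q + sgn w) \<le> r + 1"
      using norm_triangle_ineq[of ?q "sgn w"] q by (simp add: norm_sgn split: if_splits)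
    then have "\<bar>H t (?q + sgn w)\<bar> \<le> B" "\<bar>H t ?q\<bar> \<le> B"
      using B(2)[OF t] q by auto
    moreover have "sgn w \<bullet> w = norm w"
      by (cases "w = 0") (simp_all add: sgn_div_norm dot_square_norm power2_eq_square)
    ultimately show "norm w \<le> 2 * B"
      using conj_max[OF t, of "?q + sgn w" w] by (simp add: inner_add_left)
  qed
qed

end

section \<open>Integrands and test functions\<close>

lemma integrable_bounded_Icc:
  fixes f :: "real \<Rightarrow> 'a::euclidean_space"
  assumes "f \<in> borel_measurable (lebesgue_on {a..b})" "AE t in lebesgue_on {a..b}. norm (f t) \<le> B"
  shows "integrable (lebesgue_on {a..b}) f"
proof -
  interpret finite_measure "lebesgue_on {a..b}"
    by (rule finite_measure_lebesgue_on) simp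
  show ?thesis
    using assms by (intro integrable_const_bound[of _ B])
qed

text \<open>Clamping t to [a, b] extends \<Phi> continuously to the whole space, where composition
  with the measurable pair of t and f t is measurable.\<close>

lemma measurable_Caratheodory:
  fixes \<Phi> :: "real \<Rightarrow> 'a::euclidean_space \<Rightarrow> 'b::euclidean_space"
  assumes ab: "a \<le> b" and \<Phi>: "continuous_on ({a..b} \<times> UNIV) (\<lambda>(t, w). \<Phi> t w)"
    and f: "f \<in> borel_measurable (lebesgue_on {a..b})"
  shows "(\<lambda>t. \<Phi> t (f t)) \<in> borel_measurable (lebesgue_on {a..b})"
proof -
  define \<Psi> where "\<Psi> = (\<lambda>t. \<Phi> (max a (min b t)))"
  have "continuous_on UNIV (\<lambda>p. (\<lambda>(t, w). \<Phi> t w) (max a (min b (fst p)), snd p))"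
    using ab by (intro continuous_on_compose2[OF \<Phi>] continuous_intros) auto
  then have cont: "continuous_on UNIV (\<lambda>p. \<Psi> (fst p) (snd p))" by (simp add: \<Psi>_def)
  have id: "(\<lambda>t. t) \<in> borel_measurable (lebesgue_on {a..b})"
    using id_borel_measurable_lebesgue_on[of "{a..b}"] by (simp add: id_def)
  have "(\<lambda>t. \<Psi> t (f t)) \<in> borel_measurable (lebesgue_on {a..b})"
    by (rule borel_measurable_continuous_Pair[OF id f cont])
  then show ?thesis
    by (rule measurable_cong[THEN iffD1, rotated]) (auto simp: \<Psi>_def min_def max_def)
qed

lemma abs_continuous_lipschitz:
  assumes "L \<ge> 0" "\<And>x y. a \<le> x \<Longrightarrow> x \<le> y \<Longrightarrow> y \<le> b \<Longrightarrow> norm (u y - u x) \<le> L * (y - x)"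
  shows "abs_continuous_on a b u"
proof (rule abs_continuous_onI_affine)
  fix \<epsilon> :: real assume "\<epsilon> > 0"
  have "sum_norm_increments u D \<le> \<epsilon> + L * sum_lengths D" if D: "interval_family a b D" for D
  proof -
    have "sum_norm_increments u D \<le> (\<Sum>(x, y)\<in>D. L * (y - x))"
      using D assms(2) by (intro sum_mono) (auto simp: interval_family_def)
    then show ?thesis
      using \<open>\<epsilon> > 0\<close> by (simp add: case_prod_unfold sum_distrib_left)
  qed
  then show "\<exists>C\<ge>0. \<forall>D. interval_family a b D \<longrightarrow>
      sum_norm_increments u D \<le> \<epsilon> + C * sum_lengths D"
    using assms(1) by blast
qed

text \<open>The approximants are the difference quotients of the indefinite integral.\<close>

lemma bounded_measurable_approx_abs_continuous:
  fixes q :: "real \<Rightarrow> 'a::euclidean_space"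
  assumes ab: "a < b" and q: "q \<in> borel_measurable (lebesgue_on {a..b})"
    and B: "\<And>t. t \<in> {a..b} \<Longrightarrow> norm (q t) \<le> B"
  obtains p where "\<And>n::nat. abs_continuous_on a b (p n)" "\<And>n t. norm (p n t) \<le> B"
    "AE t in lebesgue_on {a..b}. (\<lambda>n. p n t) \<longlonglongrightarrow> q t"
proof -
  have B0: "B \<ge> 0"
    using order_trans[OF norm_ge_zero B[of a]] ab by simp
  have "integrable (lebesgue_on {a..b}) q"
    using q B by (intro integrable_bounded_Icc[of _ _ _ B]) auto
  then have q_int: "q integrable_on {a..b}" by (simp add: integrable_on_lebesgue_on)
  define I where "I = (\<lambda>x. integral {a..x} q)"
  \<comment> \<open>Clamping keeps the forward quotient defined near b. It is nonexpansive, so the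
    clamped integral is still Lipschitz with constant B and every quotient is bounded by B.\<close>
  define cl where "cl = (\<lambda>x. max a (min b x))"
  have lip0: "norm (I y - I x) \<le> B * (y - x)" if "a \<le> x" "x \<le> y" "y \<le> b" for x y
  proof -
    have "integral {a..x} q + integral {x..y} q = integral {a..y} q"
      using that integrable_on_subinterval[OF q_int]
      by (intro Henstock_Kurzweil_Integration.integral_combine) auto
    then have "I y - I x = integral {x..y} q" by (auto simp: I_def algebra_simps)
    moreover have "norm (integral {x..y} q) \<le> integral {x..y} (\<lambda>_. B)"
      using that integrable_on_subinterval[OF q_int, of x y] B
      by (intro integral_norm_bound_integral) auto
    ultimately show ?thesis
      using that by (simp add: mult.commute)
  qed
  have lip: "norm (I (cl y) - I (cl x)) \<le> B * \<bar>y - x\<bar>" for x y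
  proof -
    have 1: "norm (I (cl y) - I (cl x)) \<le> B * \<bar>y - x\<bar>" if "x \<le> y" for x y
    proof -
      have "norm (I (cl y) - I (cl x)) \<le> B * (cl y - cl x)"
        using ab that by (intro lip0) (auto simp: cl_def)
      also have "\<dots> \<le> B * \<bar>y - x\<bar>"
        using that B0 by (intro mult_left_mono) (auto simp: cl_def)
      finally show ?thesis .
    qed
    show ?thesis
      using 1[of x y] 1[of y x] by (cases "x \<le> y") (auto simp: norm_minus_commute abs_minus_commute)
  qed
  define p where "p = (\<lambda>(n::nat) t. real (Suc n) *\<^sub>R (I (cl (t + 1 / Suc n)) - I (cl t)))"
  show ?thesis
  proof
    fix n
    show "abs_continuous_on a b (p n)"
    proof (rule abs_continuous_lipschitz)
      fix x y assume "x \<le> (y::real)"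
      have "p n y - p n x = real (Suc n) *\<^sub>R ((I (cl (y + 1 / Suc n)) - I (cl (x + 1 / Suc n))) - (I (cl y) - I (cl x)))"
        by (simp add: p_def scaleR_diff_right algebra_simps)
      also have "norm \<dots> \<le> real (Suc n) * (B * (y - x) + B * (y - x))"
        unfolding norm_scaleR
      proof (intro mult_mono)
        show "norm ((I (cl (y + 1 / Suc n)) - I (cl (x + 1 / Suc n))) - (I (cl y) - I (cl x))) \<le> B * (y - x) + B * (y - x)"
          using lip[of "y + 1 / Suc n" "x + 1 / Suc n"] lip[of y x] \<open>x \<le> y\<close>
            norm_triangle_ineq4[of "I (cl (y + 1 / Suc n)) - I (cl (x + 1 / Suc n))" "I (cl y) - I (cl x)"]
          by (simp del: of_nat_Suc)
      qed auto
      finally show "norm (p n y - p n x) \<le> (real (Suc n) * (2 * B)) * (y - x)"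
        by (simp add: algebra_simps)
    qed (use B0 in simp)
    fix t
    have "norm (p n t) \<le> real (Suc n) * (B * \<bar>1 / Suc n\<bar>)"
      unfolding p_def norm_scaleR using lip[of "t + 1 / Suc n" t] by (intro mult_mono) auto
    then show "norm (p n t) \<le> B" by simp
  next
    \<comment> \<open>At b the clamped forward quotient is 0 and says nothing about q b, so this
      point is discarded.\<close>
    have "AE t in lebesgue_on {a..b}. t \<noteq> b"
      using ab by (intro AE_I'[of "{b}"]) (auto simp: null_sets_restrict_space)
    with lebesgue_differentiation[OF q_int] show "AE t in lebesgue_on {a..b}. (\<lambda>n. p n t) \<longlonglongrightarrow> q t"
      using AE_space
    proof eventually_elim
      case (elim t)
      then have t: "a \<le> t" "t < b" and der: "(I has_vector_derivative q t) (at t within {a..b})"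
        by (auto simp: I_def)
      then have lim: "((\<lambda>y. (1 / norm (y - t)) *\<^sub>R (I y - (I t + (y - t) *\<^sub>R q t))) \<longlongrightarrow> 0) (at t within {a..b})"
        by (simp add: has_vector_derivative_def has_derivative_within)
      have pos: "0 < 1 / real (Suc n)" for n
        by simp
      have seq: "(\<lambda>n. t + 1 / real (Suc n)) \<longlonglongrightarrow> t"
        using LIMSEQ_inverse_real_of_nat_add[of t] by (simp add: divide_inverse)
      have ev: "\<forall>\<^sub>F n in sequentially. t + 1 / real (Suc n) < b"
        using order_tendstoD(2)[OF seq t(2)] .
      have "filterlim (\<lambda>n. t + 1 / real (Suc n)) (at t within {a..b}) sequentially"
        unfolding filterlim_at
      proof (intro conjI seq)
        show "\<forall>\<^sub>F n in sequentially. t + 1 / real (Suc n) \<in> {a..b} \<and> t + 1 / real (Suc n) \<noteq> t"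
          using ev
        proof eventually_elim
          case (elim n)
          moreover have "t < t + 1 / real (Suc n)" "a \<le> t + 1 / real (Suc n)"
            using t(1) pos[of n] by linarith+
          ultimately show ?case
            by (simp del: of_nat_Suc)
        qed
      qed
      from filterlim_compose[OF lim this]
      have "(\<lambda>n. real (Suc n) *\<^sub>R (I (t + 1 / real (Suc n)) - (I t + (1 / real (Suc n)) *\<^sub>R q t))) \<longlonglongrightarrow> 0"
        by (simp del: of_nat_Suc)
      then have "(\<lambda>n. real (Suc n) *\<^sub>R (I (t + 1 / real (Suc n)) - I t) - q t) \<longlonglongrightarrow> 0"
        by (simp add: scaleR_diff_right scaleR_add_right diff_diff_eq del: of_nat_Suc)
      then have "(\<lambda>n. real (Suc n) *\<^sub>R (I (t + 1 / real (Suc n)) - I t)) \<longlonglongrightarrow> q t"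
        by (rule LIM_zero_cancel)
      moreover have "\<forall>\<^sub>F n in sequentially. real (Suc n) *\<^sub>R (I (t + 1 / real (Suc n)) - I t) = p n t"
        using ev
      proof eventually_elim
        case (elim n)
        moreover have "a \<le> t + 1 / real (Suc n)"
          using t(1) pos[of n] by linarith
        ultimately have "cl (t + 1 / real (Suc n)) = t + 1 / real (Suc n)" "cl t = t"
          using t by (auto simp: cl_def max_def min_def simp del: of_nat_Suc)
        then show ?case
          by (simp add: p_def del: of_nat_Suc)
      qed
      ultimately show ?case
        by (rule Lim_transform_eventually)
    qed
  qed
qed

section \<open>The dual variational problem\<close>

lemma bounded_Caratheodory:
  fixes \<Phi> :: "real \<Rightarrow> 'a::euclidean_space \<Rightarrow> 'b::euclidean_space"
  assumes \<Phi>: "continuous_on ({a..b} \<times> UNIV) (\<lambda>(t, w). \<Phi> t w)"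
  obtains B where "\<And>t w. t \<in> {a..b} \<Longrightarrow> norm w \<le> r \<Longrightarrow> norm (\<Phi> t w) \<le> B"
proof -
  have "compact ((\<lambda>(t, u). \<Phi> t u) ` ({a..b} \<times> cball 0 r))"
    by (intro compact_continuous_image continuous_on_subset[OF \<Phi>] compact_Times) auto
  then obtain B where "\<forall>y\<in>(\<lambda>(t, u). \<Phi> t u) ` ({a..b} \<times> cball 0 r). norm y \<le> B"
    using compact_imp_bounded bounded_iff by metis
  then have "norm (\<Phi> t w) \<le> B" if "t \<in> {a..b}" "norm w \<le> r" for t w
    using that by force
  then show ?thesis
    by (rule that)
qed

lemma integrable_Caratheodory:
  fixes \<Phi> :: "real \<Rightarrow> 'a::euclidean_space \<Rightarrow> 'b::euclidean_space"
  assumes ab: "a \<le> b" and \<Phi>: "continuous_on ({a..b} \<times> UNIV) (\<lambda>(t, w). \<Phi> t w)"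
    and f: "f \<in> borel_measurable (lebesgue_on {a..b})" "\<And>t. t \<in> {a..b} \<Longrightarrow> norm (f t) \<le> r"
  shows "integrable (lebesgue_on {a..b}) (\<lambda>t. \<Phi> t (f t))"
proof -
  obtain B where B: "\<And>t w. t \<in> {a..b} \<Longrightarrow> norm w \<le> r \<Longrightarrow> norm (\<Phi> t w) \<le> B"
    by (rule bounded_Caratheodory[OF \<Phi>, of r]) (rule that)
  show ?thesis
    using f(2) by (intro integrable_bounded_Icc[of _ _ _ B] measurable_Caratheodory[OF ab \<Phi> f(1)] AE_I2 B) auto
qed

lemma integral_inner_diff_bound:
  fixes f w1 w2 :: "real \<Rightarrow> 'a::euclidean_space"
  assumes f: "integrable (lebesgue_on {a..b}) f" and w: "continuous_on {a..b} w1" "continuous_on {a..b} w2"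
    and e: "\<And>t. t \<in> {a..b} \<Longrightarrow> norm (w1 t - w2 t) \<le> e"
  shows "\<bar>(LINT t|lebesgue_on {a..b}. f t \<bullet> w1 t) - (LINT t|lebesgue_on {a..b}. f t \<bullet> w2 t)\<bar>
    \<le> e * (LINT t|lebesgue_on {a..b}. norm (f t))"
proof -
  have i: "integrable (lebesgue_on {a..b}) (\<lambda>t. f t \<bullet> (w1 t - w2 t))"
    by (intro integrable_inner_continuous f continuous_intros w)
  have "(LINT t|lebesgue_on {a..b}. f t \<bullet> w1 t) - (LINT t|lebesgue_on {a..b}. f t \<bullet> w2 t)
      = (LINT t|lebesgue_on {a..b}. f t \<bullet> (w1 t - w2 t))"
    using integrable_inner_continuous[OF f w(1)] integrable_inner_continuous[OF f w(2)]
    by (simp add: inner_diff_right)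
  also have "\<bar>\<dots>\<bar> \<le> (LINT t|lebesgue_on {a..b}. norm (f t \<bullet> (w1 t - w2 t)))"
    using integral_norm_bound[of "lebesgue_on {a..b}" "\<lambda>t. f t \<bullet> (w1 t - w2 t)"] by simp
  also have "\<dots> \<le> (LINT t|lebesgue_on {a..b}. e * norm (f t))"
  proof (rule integral_mono)
    fix t assume "t \<in> space (lebesgue_on {a..b})"
    then have "norm (f t) * norm (w1 t - w2 t) \<le> norm (f t) * e"
      using e by (intro mult_left_mono) auto
    then show "norm (f t \<bullet> (w1 t - w2 t)) \<le> e * norm (f t)"
      using Cauchy_Schwarz_ineq2[of "f t" "w1 t - w2 t"] by (simp add: mult.commute)
  qed (use i f in auto)
  finally show ?thesis by simp
qed

lemma integral_inner_tendsto:
  fixes f w :: "real \<Rightarrow> 'a::euclidean_space"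
  assumes f: "integrable (lebesgue_on {a..b}) f" and w: "continuous_on {a..b} w"
    and wn: "\<And>n. continuous_on {a..b} (wn n)" and unif: "uniform_limit {a..b} wn w sequentially"
  shows "(\<lambda>n. LINT t|lebesgue_on {a..b}. f t \<bullet> wn n t) \<longlonglongrightarrow> (LINT t|lebesgue_on {a..b}. f t \<bullet> w t)"
proof (rule tendstoI)
  fix e :: real assume "e > 0"
  define A where "A = (LINT t|lebesgue_on {a..b}. norm (f t))"
  have A: "A \<ge> 0" by (simp add: A_def)
  have "\<forall>\<^sub>F n in sequentially. \<forall>t\<in>{a..b}. dist (wn n t) (w t) < e / (A + 1)"
    using unif \<open>e > 0\<close> A by (intro uniform_limitD) auto
  then show "\<forall>\<^sub>F n in sequentially. dist (LINT t|lebesgue_on {a..b}. f t \<bullet> wn n t)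
      (LINT t|lebesgue_on {a..b}. f t \<bullet> w t) < e"
  proof eventually_elim
    case (elim n)
    have "\<bar>(LINT t|lebesgue_on {a..b}. f t \<bullet> wn n t) - (LINT t|lebesgue_on {a..b}. f t \<bullet> w t)\<bar>
        \<le> e / (A + 1) * A"
      unfolding A_def using elim
      by (intro integral_inner_diff_bound f w wn) (auto simp: dist_norm A_def less_imp_le)
    also have "\<dots> = e * (A / (A + 1))" by simp
    also have "\<dots> < e * 1"
      using \<open>e > 0\<close> A by (intro mult_strict_left_mono) auto
    finally show ?case
      by (simp add: dist_real_def)
  qed
qed

section \<open>Translations and the symplectic form\<close>

lemma abs_continuous_const: "abs_continuous_on a b (\<lambda>_. c)"
  by (rule abs_continuous_lipschitz[of 0]) auto

lemma abs_continuous_add: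
  "abs_continuous_on a b u \<Longrightarrow> abs_continuous_on a b w \<Longrightarrow> abs_continuous_on a b (\<lambda>t. u t + w t)"
  by (rule abs_continuous_bound[of a b u w 1])
    (auto intro!: norm_triangle_ineq simp: add_diff_add)

text \<open>The equality holds at every t, also where v is not differentiable: the predicate from
  which \<open>vector_derivative\<close> chooses is unchanged by a translation. Integrands of
  translated functions therefore coincide literally.\<close>

lemma time_deriv_add_const:
  "time_deriv T (\<lambda>t. v t + c) t = time_deriv T v t"
  by (simp add: vector_derivative_def has_vector_derivative_add_const)

lemma time_deriv_const:
  assumes "0 < T" "t \<in> {0..T}"
  shows "time_deriv T (\<lambda>_. c :: 'a::euclidean_space) t = 0"
  by (rule vector_derivative_within_closed_interval[OF assms has_vector_derivative_const])

text \<open>The properties of the symplectic matrix on which the variational argument rests;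
  skewness and square -1 together make J an isometry.\<close>

locale skew_structure =
  fixes J :: "'a::euclidean_space \<Rightarrow> 'a"
  assumes linear: "linear J" and skew: "J x \<bullet> y = - (x \<bullet> J y)" and square: "J (J x) = - x"
begin

lemma bounded_linear: "bounded_linear J"
  using linear by (simp add: linear_conv_bounded_linear)

lemma norm_J: "norm (J x) = norm x"
  using skew[of x "J x"] by (simp add: square norm_eq_sqrt_inner)

lemma abs_continuous_J:
  assumes "abs_continuous_on a b w"
  shows "abs_continuous_on a b (\<lambda>t. J (w t))"
  by (rule abs_continuous_bound[OF assms assms, of 1])
    (auto simp: norm_J simp flip: linear_diff[OF linear])

definition symp_form :: "real \<Rightarrow> (real \<Rightarrow> 'a) \<Rightarrow> (real \<Rightarrow> 'a) \<Rightarrow> real" where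
  "symp_form T u w = (LINT t|lebesgue_on {0..T}. J (time_deriv T u t) \<bullet> w t)"

lemma integrable_J_deriv:
  assumes "0 < T" "abs_continuous_on 0 T u"
  shows "integrable (lebesgue_on {0..T}) (\<lambda>t. J (time_deriv T u t))"
  by (rule integrable_bounded_linear[OF bounded_linear abs_continuous_integrable_deriv[OF assms]])

text \<open>Integration by parts gives one sign and skewness of J another, while periodicity cancels
  the boundary terms. Symmetry allows the derivative to be put on whichever argument stays fixed in
  a limit.\<close>

lemma symp_form_sym:
  assumes T: "0 < T" and u: "abs_continuous_on 0 T u" "u 0 = u T"
    and w: "abs_continuous_on 0 T w" "w 0 = w T"
  shows "symp_form T u w = symp_form T w u"
proof -
  note parts = abs_continuous_integral_by_parts[OF T u(1) abs_continuous_J[OF w(1)]]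
  have "AE t in lebesgue_on {0..T}. u t \<bullet> time_deriv T (\<lambda>t. J (w t)) t = J (time_deriv T w t) \<bullet> u t"
    using abs_continuous_AE_deriv[OF T w(1)] AE_space
  proof eventually_elim
    case (elim t)
    have "((\<lambda>t. J (w t)) has_vector_derivative J (time_deriv T w t)) (at t within {0..T})"
      by (rule bounded_linear.has_vector_derivative[OF bounded_linear elim(1)])
    then have "time_deriv T (\<lambda>t. J (w t)) t = J (time_deriv T w t)"
      using elim(2) by (intro vector_derivative_within_closed_interval[OF T]) auto
    then show ?case
      by (simp add: inner_commute)
  qed
  moreover have "(\<lambda>t. u t \<bullet> time_deriv T (\<lambda>t. J (w t)) t) \<in> borel_measurable (lebesgue_on {0..T})"
    using integrable_inner_continuous[OF abs_continuous_integrable_deriv[OF T abs_continuous_J[OF w(1)]]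
        abs_continuous_continuous[OF u(1)]] by (simp add: inner_commute borel_measurable_integrable)
  moreover have "(\<lambda>t. J (time_deriv T w t) \<bullet> u t) \<in> borel_measurable (lebesgue_on {0..T})"
    by (rule borel_measurable_integrable[OF integrable_inner_continuous[OF integrable_J_deriv[OF T w(1)]
        abs_continuous_continuous[OF u(1)]]])
  ultimately have "(LINT t|lebesgue_on {0..T}. u t \<bullet> time_deriv T (\<lambda>t. J (w t)) t) = symp_form T w u"
    unfolding symp_form_def by (intro integral_cong_AE)
  moreover have "(LINT t|lebesgue_on {0..T}. time_deriv T u t \<bullet> J (w t)) = - symp_form T u w"
    by (simp add: symp_form_def skew)
  ultimately show ?thesis
    using parts u(2) w(2) by simp
qed

text \<open>By symmetry the derivative falls on the constant.\<close>

lemma symp_form_const: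
  assumes T: "0 < T" and u: "abs_continuous_on 0 T u" "u 0 = u T"
  shows "symp_form T u (\<lambda>_. c) = 0"
proof -
  have "symp_form T u (\<lambda>_. c) = symp_form T (\<lambda>_. c) u"
    by (rule symp_form_sym[OF T u abs_continuous_const]) simp
  also have "\<dots> = (LINT t|lebesgue_on {0..T}. 0)"
    unfolding symp_form_def
    by (rule Bochner_Integration.integral_cong) (auto simp: time_deriv_const[OF T] linear_0[OF linear])
  finally show ?thesis by simp
qed

lemma symp_form_add_const:
  assumes T: "0 < T" and u: "abs_continuous_on 0 T u" "u 0 = u T"
  shows "symp_form T (\<lambda>t. u t + c) (\<lambda>t. u t + c) = symp_form T u u"
proof -
  have "symp_form T (\<lambda>t. u t + c) (\<lambda>t. u t + c) = symp_form T u u + symp_form T u (\<lambda>_. c)"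
    unfolding symp_form_def time_deriv_add_const inner_add_right
    by (intro Bochner_Integration.integral_add integrable_inner_continuous integrable_J_deriv T u(1)
        abs_continuous_continuous continuous_on_const)
  then show ?thesis
    by (simp add: symp_form_const[OF T u])
qed

end

text \<open>The abstract problem, with F in the place of the conjugate of G.
  \<open>conj_lower\<close> gains \<rho> times the integral of F(T v'), \<open>form_lower\<close>
  limits the loss from the indefinite quadratic part to \<mu> times the same integral, and
  \<open>\<mu> < \<rho>\<close> leaves a positive remainder.\<close>

locale dual_problem = skew_structure J + superlinear_family "{0..T}" H
  for J :: "'a::euclidean_space \<Rightarrow> 'a" and T :: real and H :: "real \<Rightarrow> 'a \<Rightarrow> real" +
  fixes F :: "'a \<Rightarrow> real" and \<alpha> :: "real \<Rightarrow> real" and \<rho> \<mu> :: real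
  assumes T: "0 < T"
    and F_cont: "continuous_on UNIV F" and F_nonneg: "\<And>w. 0 \<le> F w"
    and F_lower: "\<And>M. \<exists>C. \<forall>w. M * norm w - C \<le> F w"
    and \<rho>: "0 < \<rho>" "\<mu> < \<rho>"
    and \<alpha>: "integrable (lebesgue_on {0..T}) \<alpha>"
    and conj_lower: "AE t in lebesgue_on {0..T}. \<forall>w. \<rho> * F (T *\<^sub>R w) - \<alpha> t \<le> H_star t w"
    and form_lower: "\<And>v. abs_continuous_on 0 T v \<Longrightarrow> v 0 = v T \<Longrightarrow>
      integrable (lebesgue_on {0..T}) (\<lambda>t. F (T *\<^sub>R time_deriv T v t)) \<Longrightarrow>
      - \<mu> * (LINT t|lebesgue_on {0..T}. F (T *\<^sub>R time_deriv T v t)) \<le> 1 / 2 * symp_form T v v"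
begin

abbreviation "D \<equiv> time_deriv T :: (real \<Rightarrow> 'a) \<Rightarrow> real \<Rightarrow> 'a"
abbreviation "L \<equiv> lebesgue_on {0..T}"

abbreviation "modular v \<equiv> LINT t|L. F (T *\<^sub>R D v t)"

abbreviation "conj_energy v \<equiv> LINT t|L. H_star t (D v t)"

text \<open>The periodic functions of finite action. Integrability belongs to the set because the
  Lebesgue integral of a nonintegrable function is 0 by convention, which would falsify
  \<open>energy\<close>.\<close>

definition admissible :: "(real \<Rightarrow> 'a) set" where
  "admissible = {v. abs_continuous_on 0 T v \<and> v 0 = v T \<and> integrable L (\<lambda>t. H_star t (D v t))}"

definition energy :: "(real \<Rightarrow> 'a) \<Rightarrow> real" where
  "energy v = 1 / 2 * symp_form T v v + conj_energy v"

section \<open>Coercivity of the energy\<close>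

lemma deriv_measurable: "abs_continuous_on 0 T v \<Longrightarrow> D v \<in> borel_measurable L"
  by (rule borel_measurable_integrable[OF abs_continuous_integrable_deriv[OF T]])

lemma admissible_translate:
  assumes "v \<in> admissible"
  shows "(\<lambda>t. v t + c) \<in> admissible" "energy (\<lambda>t. v t + c) = energy v"
  using assms symp_form_add_const[OF T, of v c]
  by (auto simp: admissible_def energy_def time_deriv_add_const
      intro!: abs_continuous_add abs_continuous_const)

lemma integrable_H_zero: "integrable L (\<lambda>t. H t 0)"
  using T by (intro integrable_Caratheodory[OF _ cont, of "\<lambda>_. 0" 0]) auto

lemma zero_admissible: "(\<lambda>_. 0) \<in> admissible"
proof -
  have "integrable L (\<lambda>t. H_star t 0)"
    using T by (intro integrable_Caratheodory[OF _ continuous_conjugate, of "\<lambda>_. 0" 0]) auto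
  then have "integrable L (\<lambda>t. H_star t (D (\<lambda>_. 0) t))"
    by (rule Bochner_Integration.integrable_cong[THEN iffD1, rotated 2]) (auto simp: time_deriv_const[OF T])
  then show ?thesis
    by (simp add: admissible_def abs_continuous_const)
qed

text \<open>F is nonnegative and a.e. at most the sum of \<open>H_star\<close> and \<alpha> divided
  by \<rho>, which is an integrable majorant.\<close>

lemma admissible_integrable_F:
  assumes v: "abs_continuous_on 0 T v" "integrable L (\<lambda>t. H_star t (D v t))"
  shows "integrable L (\<lambda>t. F (T *\<^sub>R D v t))"
    "\<rho> * modular v - (LINT t|L. \<alpha> t) \<le> conj_energy v"
proof -
  have meas: "(\<lambda>t. F (T *\<^sub>R D v t)) \<in> borel_measurable L"
    by (intro borel_measurable_continuous_on[OF F_cont] borel_measurable_scaleR deriv_measurable v) simp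
  have le: "AE t in L. \<rho> * F (T *\<^sub>R D v t) - \<alpha> t \<le> H_star t (D v t)"
    using conj_lower by eventually_elim blast
  show 1: "integrable L (\<lambda>t. F (T *\<^sub>R D v t))"
  proof (rule Bochner_Integration.integrable_bound[OF _ meas])
    show "integrable L (\<lambda>t. (H_star t (D v t) + \<alpha> t) / \<rho>)"
      using v(2) \<alpha> by simp
    show "AE t in L. norm (F (T *\<^sub>R D v t)) \<le> norm ((H_star t (D v t) + \<alpha> t) / \<rho>)"
      using le
    proof eventually_elim
      case (elim t)
      then have "F (T *\<^sub>R D v t) \<le> (H_star t (D v t) + \<alpha> t) / \<rho>"
        using \<rho>(1) by (simp add: pos_le_divide_eq mult.commute)
      then show ?case
        using F_nonneg[of "T *\<^sub>R D v t"] unfolding real_norm_def by linarith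
    qed
  qed
  have "\<rho> * modular v - (LINT t|L. \<alpha> t) = (LINT t|L. \<rho> * F (T *\<^sub>R D v t) - \<alpha> t)"
    using 1 \<alpha> by simp
  also have "\<dots> \<le> conj_energy v"
    using 1 \<alpha> v(2) by (intro integral_mono_AE le) auto
  finally show "\<rho> * modular v - (LINT t|L. \<alpha> t) \<le> conj_energy v" .
qed

lemma energy_lower:
  assumes "v \<in> admissible"
  shows "(\<rho> - \<mu>) * modular v - (LINT t|L. \<alpha> t) \<le> energy v"
  using assms admissible_integrable_F[of v] form_lower[of v]
  by (auto simp: admissible_def energy_def algebra_simps)

text \<open>De la Vallee-Poussin: superlinearity of \<open>F\<close> makes sublevel sets of the energy uniformly
  absolutely continuous.\<close>

lemma uniform_absolute_continuity:
  assumes "\<epsilon> > 0" "B \<ge> 0"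
  obtains C where "C \<ge> 0"
    "\<And>v E. v \<in> admissible \<Longrightarrow> modular v \<le> B \<Longrightarrow> interval_family 0 T E \<Longrightarrow>
       sum_norm_increments v E \<le> \<epsilon> + C * sum_lengths E"
    "\<And>v. v \<in> admissible \<Longrightarrow> modular v \<le> B \<Longrightarrow> (LINT t|L. norm (D v t)) \<le> \<epsilon> + C * T"
proof -
  \<comment> \<open>Chosen so that B / (K T) <= \<epsilon>; the B + 1 keeps K positive when B = 0.
    Superlinearity with slope K then bounds the norm of v' by F(T v') / (K T) plus a
    constant.\<close>
  define K where "K = (B + 1) / (T * \<epsilon>)"
  have "B / (K * T) = \<epsilon> * (B / (B + 1))"
    using assms T by (simp add: K_def)
  also have "\<dots> \<le> \<epsilon> * 1"
    using assms by (intro mult_left_mono) auto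
  finally have K: "K > 0" "B / (K * T) \<le> \<epsilon>"
    using assms T by (auto simp: K_def)
  obtain C0 where C0: "\<And>w. K * norm w - C0 \<le> F w"
    using F_lower[of K] by blast
  define C where "C = \<bar>C0\<bar> / (K * T)"
  have C: "C \<ge> 0"
    using K T by (simp add: C_def)
  have pw: "norm w \<le> F (T *\<^sub>R w) / (K * T) + C" for w
  proof -
    have "K * (T * norm w) \<le> F (T *\<^sub>R w) + \<bar>C0\<bar>"
      using C0[of "T *\<^sub>R w"] T by simp
    then have "norm w \<le> (F (T *\<^sub>R w) + \<bar>C0\<bar>) / (K * T)"
      using K T by (simp add: pos_le_divide_eq mult_ac)
    then show ?thesis
      by (simp add: C_def add_divide_distrib)
  qed
  have ac: "abs_continuous_on 0 T v" and int: "integrable L (\<lambda>t. F (T *\<^sub>R D v t) / (K * T))"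
    and le\<epsilon>: "(LINT t|L. F (T *\<^sub>R D v t) / (K * T)) \<le> \<epsilon>"
    if v: "v \<in> admissible" "modular v \<le> B" for v
  proof -
    show "abs_continuous_on 0 T v" "integrable L (\<lambda>t. F (T *\<^sub>R D v t) / (K * T))"
      using v(1) admissible_integrable_F[of v] by (auto simp: admissible_def)
    have "modular v / (K * T) \<le> B / (K * T)"
      using v(2) K T by (intro divide_right_mono) auto
    then show "(LINT t|L. F (T *\<^sub>R D v t) / (K * T)) \<le> \<epsilon>"
      using K(2) by simp
  qed
  show ?thesis
  proof (rule that[OF C])
    fix v E assume v: "v \<in> admissible" "modular v \<le> B" and E: "interval_family 0 T E"
    let ?\<psi> = "\<lambda>t. F (T *\<^sub>R D v t) / (K * T)"
    have \<psi>: "?\<psi> integrable_on {0..T}"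
      using int[OF v] by (rule integrable_on_lebesgue_on) simp
    have \<psi>0: "0 \<le> ?\<psi> t" for t
      using F_nonneg K T by simp
    have "norm (v y - v x) \<le> integral {x..y} ?\<psi> + C * (y - x)" if xy: "0 \<le> x" "x \<le> y" "y \<le> T" for x y
    proof -
      have I: "(D v has_integral (v y - v x)) {x..y}"
        by (rule abs_continuous_has_integral_deriv[OF T ac[OF v] xy])
      have on: "?\<psi> integrable_on {x..y}"
        by (rule integrable_on_subinterval[OF \<psi>]) (use xy in auto)
      have "norm (integral {x..y} (D v)) \<le> integral {x..y} (\<lambda>t. ?\<psi> t + C)"
      proof (rule integral_norm_bound_integral)
        show "D v integrable_on {x..y}" by (rule has_integral_integrable[OF I])
        show "(\<lambda>t. ?\<psi> t + C) integrable_on {x..y}"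
          by (intro integrable_add on integrable_const_ivl)
      qed (rule pw)
      also have "\<dots> = integral {x..y} ?\<psi> + C * (y - x)"
        using xy by (subst Henstock_Kurzweil_Integration.integral_add[OF on integrable_const_ivl])
          (simp add: mult.commute)
      finally show ?thesis
        by (simp add: integral_unique[OF I])
    qed
    then have "sum_norm_increments v E \<le> integral {0..T} ?\<psi> + C * sum_lengths E"
      using \<psi>0 by (intro sum_increments_le[OF E \<psi>])
    then show "sum_norm_increments v E \<le> \<epsilon> + C * sum_lengths E"
      using le\<epsilon>[OF v] lebesgue_integral_eq_integral[OF int[OF v]] by (simp del: integral_divide)
  next
    fix v assume v: "v \<in> admissible" "modular v \<le> B"
    have iC: "integrable L (\<lambda>_. C)"
      by (rule integrable_bounded_Icc[of _ _ _ C]) (use C in auto)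
    have "(LINT t|L. norm (D v t)) \<le> (LINT t|L. F (T *\<^sub>R D v t) / (K * T) + C)"
      using abs_continuous_integrable_deriv[OF T ac[OF v]] int[OF v] pw iC
      by (intro integral_mono) auto
    also have "\<dots> = (LINT t|L. F (T *\<^sub>R D v t) / (K * T)) + (LINT t|L. C)"
      by (rule Bochner_Integration.integral_add[OF int[OF v] iC])
    also have "(LINT t|L. C) = C * T"
      using T by (simp add: measure_restrict_space)
    finally show "(LINT t|L. norm (D v t)) \<le> \<epsilon> + C * T"
      using le\<epsilon>[OF v] by simp
  qed
qed

lemma deriv_add_scaled:
  assumes "t \<in> {0..T}" "(u has_vector_derivative a) (at t within {0..T})"
    "(w has_vector_derivative b) (at t within {0..T})"
  shows "D (\<lambda>t. u t + s *\<^sub>R w t) t = a + s *\<^sub>R b"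
  using assms
  by (intro vector_derivative_within_closed_interval[OF T] has_vector_derivative_add
      bounded_linear.has_vector_derivative[OF bounded_linear_scaleR_right])

text \<open>Integrated Fenchel inequality. After integration by parts the left side depends on v
  only through its values, so it survives a uniform limit of v.\<close>

lemma Fenchel_integral:
  assumes v: "v \<in> admissible" and p: "abs_continuous_on 0 T p"
  shows "(LINT t|L. D v t \<bullet> p t) - (LINT t|L. H t (p t)) \<le> conj_energy v"
proof -
  have cp: "continuous_on {0..T} p" by (rule abs_continuous_continuous[OF p])
  have 1: "integrable L (\<lambda>t. D v t \<bullet> p t)"
    using v by (intro integrable_inner_continuous abs_continuous_integrable_deriv[OF T] cp)
      (auto simp: admissible_def)
  have "continuous_on {0..T} (\<lambda>t. (\<lambda>(t, u). H t u) (t, p t))"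
    by (intro continuous_on_compose2[OF cont] continuous_intros cp) auto
  then have 2: "integrable L (\<lambda>t. H t (p t))"
    using absolutely_integrable_continuous_real by (simp add: integrable_lebesgue_on_iff)
  have "(LINT t|L. D v t \<bullet> p t) - (LINT t|L. H t (p t)) = (LINT t|L. D v t \<bullet> p t - H t (p t))"
    by (rule Bochner_Integration.integral_diff[OF 1 2, symmetric])
  also have "\<dots> \<le> conj_energy v"
  proof (rule integral_mono)
    show "D v t \<bullet> p t - H t (p t) \<le> H_star t (D v t)" if "t \<in> space L" for t
      using Fenchel[of t "p t" "D v t"] that by (simp add: inner_commute)
  qed (use 1 2 v in \<open>auto simp: admissible_def\<close>)
  finally show ?thesis .
qed

text \<open>The test functions \<open>q\<close> are the maximizers in the Legendre transform of \<open>H t\<close> at \<open>g'(t)\<close>,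
  cut off where \<open>g'\<close> is large.\<close>

lemma admissible_of_dual_bound:
  assumes g: "abs_continuous_on 0 T g" "g 0 = g T"
    and bound: "\<And>p. abs_continuous_on 0 T p \<Longrightarrow> (LINT t|L. D g t \<bullet> p t) - (LINT t|L. H t (p t)) \<le> A"
  shows "g \<in> admissible" "conj_energy g \<le> A"
proof -
  have Dg: "integrable L (D g)" "D g \<in> borel_measurable L"
    by (rule abs_continuous_integrable_deriv[OF T g(1)]) (rule deriv_measurable[OF g(1)])
  \<comment> \<open>The bound extends from absolutely continuous to bounded measurable test
    functions: the approximants share the bound B and converge a.e., so both integrals converge by
    dominated convergence.\<close>
  have bound_q: "integrable L (\<lambda>t. D g t \<bullet> q t)" "integrable L (\<lambda>t. H t (q t))"
    "(LINT t|L. D g t \<bullet> q t) - (LINT t|L. H t (q t)) \<le> A"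
    if q: "q \<in> borel_measurable L" "\<And>t. t \<in> {0..T} \<Longrightarrow> norm (q t) \<le> B" for q B
  proof -
    obtain p where p: "\<And>n::nat. abs_continuous_on 0 T (p n)" "\<And>n t. norm (p n t) \<le> B"
      "AE t in L. (\<lambda>n. p n t) \<longlonglongrightarrow> q t"
      by (rule bounded_measurable_approx_abs_continuous[OF T q]) (assumption | rule that)+
    have p_cont: "continuous_on {0..T} (p n)" for n
      by (rule abs_continuous_continuous[OF p(1)])
    have p_meas: "p n \<in> borel_measurable L" for n
      by (rule continuous_imp_measurable_on_sets_lebesgue[OF p_cont]) simp
    obtain B' where B': "\<And>t w. t \<in> {0..T} \<Longrightarrow> norm w \<le> B \<Longrightarrow> norm (H t w) \<le> B'"
      by (rule bounded_Caratheodory[OF cont, of B]) (rule that)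
    have B'_int: "integrable L (\<lambda>_. B')"
      by (rule integrable_bounded_Icc[of _ _ _ "\<bar>B'\<bar>"]) auto
    show q1: "integrable L (\<lambda>t. D g t \<bullet> q t)"
    proof (rule Bochner_Integration.integrable_bound)
      show "integrable L (\<lambda>t. B * norm (D g t))"
        using Dg by simp
      show "(\<lambda>t. D g t \<bullet> q t) \<in> borel_measurable L" by (intro borel_measurable_inner Dg q)
      show "AE t in L. norm (D g t \<bullet> q t) \<le> norm (B * norm (D g t))"
      proof (rule AE_I2)
        fix t assume "t \<in> space L"
        then have qB: "norm (q t) \<le> B"
          using q(2) by simp
        have "norm (D g t) * norm (q t) \<le> norm (D g t) * B" "0 \<le> B"
          by (rule mult_left_mono[OF qB norm_ge_zero]) (rule order_trans[OF norm_ge_zero qB])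
        then show "norm (D g t \<bullet> q t) \<le> norm (B * norm (D g t))"
          using Cauchy_Schwarz_ineq2[of "D g t" "q t"] by (simp add: mult.commute)
      qed
    qed
    show q2: "integrable L (\<lambda>t. H t (q t))"
      using T q by (intro integrable_Caratheodory[OF _ cont]) auto
    have "(\<lambda>n. LINT t|L. D g t \<bullet> p n t) \<longlonglongrightarrow> (LINT t|L. D g t \<bullet> q t)"
    proof (rule integral_dominated_convergence[where w = "\<lambda>t. B * norm (D g t)"])
      show "AE t in L. (\<lambda>n. D g t \<bullet> p n t) \<longlonglongrightarrow> D g t \<bullet> q t"
        using p(3) by eventually_elim (intro tendsto_intros)
      show "AE t in L. norm (D g t \<bullet> p n t) \<le> B * norm (D g t)" for n
      proof (rule AE_I2)
        fix t
        have "norm (D g t) * norm (p n t) \<le> norm (D g t) * B"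
          by (rule mult_left_mono[OF p(2)]) simp
        then show "norm (D g t \<bullet> p n t) \<le> B * norm (D g t)"
          using Cauchy_Schwarz_ineq2[of "D g t" "p n t"] by (simp add: mult.commute)
      qed
    qed (use q1 Dg p_meas in \<open>auto intro: borel_measurable_inner\<close>)
    moreover have "(\<lambda>n. LINT t|L. H t (p n t)) \<longlonglongrightarrow> (LINT t|L. H t (q t))"
    proof (rule integral_dominated_convergence[where w = "\<lambda>_. B'"])
      show "AE t in L. (\<lambda>n. H t (p n t)) \<longlonglongrightarrow> H t (q t)"
        using p(3) AE_space
      proof eventually_elim
        case (elim t)
        then show ?case
          by (intro tendsto_H[of "\<lambda>_. t"]) auto
      qed
      show "AE t in L. norm (H t (p n t)) \<le> B'" for n
        using B' p(2) by (intro AE_I2) auto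
      show "(\<lambda>t. H t (p n t)) \<in> borel_measurable L" for n
        using T by (intro measurable_Caratheodory[OF _ cont p_meas]) simp
    qed (use q2 B'_int in auto)
    ultimately have "(\<lambda>n. (LINT t|L. D g t \<bullet> p n t) - (LINT t|L. H t (p n t)))
        \<longlonglongrightarrow> (LINT t|L. D g t \<bullet> q t) - (LINT t|L. H t (q t))"
      by (rule tendsto_diff)
    then show "(LINT t|L. D g t \<bullet> q t) - (LINT t|L. H t (q t)) \<le> A"
      by (rule LIMSEQ_le_const2) (use bound[OF p(1)] in auto)
  qed
  define q where "q = (\<lambda>(k::nat) t. if norm (D g t) \<le> k then conj_max t (D g t) else 0)"
  \<comment> \<open>Adding \<open>H t 0\<close> cancels the contribution of q = 0 off the cut and,
    by Fenchel's inequality at 0, makes the integrand nonnegative. Hence f increases with k, and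
    monotone convergence yields integrability together with the bound.\<close>
  define f where "f = (\<lambda>(k::nat) t. if norm (D g t) \<le> k then H_star t (D g t) + H t 0 else 0)"
  have set: "{t \<in> space L. norm (D g t) \<le> real k} \<in> sets L" for k :: nat
    using Dg(2) by measurable
  have q_meas: "q k \<in> borel_measurable L" for k
    unfolding q_def using T set
    by (intro measurable_If measurable_Caratheodory[OF _ continuous_conj_max Dg(2)]) auto
  have "\<forall>k::nat. \<exists>B. \<forall>t\<in>{0..T}. \<forall>w. norm w \<le> real k \<longrightarrow> norm (conj_max t w) \<le> B"
    using bounded_conj_max by blast
  then obtain R where R: "\<And>k t w. t \<in> {0..T} \<Longrightarrow> norm w \<le> real k \<Longrightarrow> norm (conj_max t w) \<le> R k"
    by metis
  have q_bdd: "norm (q k t) \<le> \<bar>R k\<bar>" if "t \<in> {0..T}" for k t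
    using R[OF that, of "D g t" k] by (auto simp: q_def)
  note q_int = bound_q[OF q_meas q_bdd]
  have f_eq: "f k t = D g t \<bullet> q k t - H t (q k t) + H t 0" if "t \<in> {0..T}" for k t
    using convex_conjugate_eq[OF that, of "D g t"] by (simp add: f_def q_def inner_commute)
  have f_eq_int: "integrable L (\<lambda>t. D g t \<bullet> q k t - H t (q k t) + H t 0)" for k
    using q_int(1,2) integrable_H_zero by simp
  have f_int: "integrable L (f k)" for k
    by (rule Bochner_Integration.integrable_cong[THEN iffD1, OF refl _ f_eq_int[of k]]) (simp add: f_eq)
  have f_le: "(LINT t|L. f k t) \<le> A + (LINT t|L. H t 0)" for k
  proof -
    have "(LINT t|L. f k t) = (LINT t|L. D g t \<bullet> q k t - H t (q k t) + H t 0)"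
      by (rule Bochner_Integration.integral_cong) (simp_all add: f_eq)
    also have "\<dots> = (LINT t|L. D g t \<bullet> q k t) - (LINT t|L. H t (q k t)) + (LINT t|L. H t 0)"
      using q_int(1,2) integrable_H_zero by simp
    finally show ?thesis
      using q_int(3)[of k] by simp
  qed
  have nonneg: "0 \<le> H_star t w + H t 0" if "t \<in> {0..T}" for t w
    using Fenchel[OF that, of 0 w] by simp
  have mono: "f k t \<le> f l t" if "k \<le> l" "t \<in> {0..T}" for k l t
    using nonneg[OF that(2), of "D g t"] that(1) by (auto simp: f_def)
  have "incseq (\<lambda>k. LINT t|L. f k t)" by (intro incseq_SucI integral_mono f_int mono) auto
  then obtain I where I: "(\<lambda>k. LINT t|L. f k t) \<longlonglongrightarrow> I" "I \<le> A + (LINT t|L. H t 0)"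
    using incseq_convergent[of "\<lambda>k. LINT t|L. f k t"] f_le LIMSEQ_le_const2 by (metis (no_types, lifting))
  have meas: "(\<lambda>t. H_star t (D g t) + H t 0) \<in> borel_measurable L"
    using T by (intro borel_measurable_add measurable_Caratheodory[OF _ continuous_conjugate Dg(2)]
        borel_measurable_integrable[OF integrable_H_zero]) simp
  have pw: "(\<lambda>k. f k t) \<longlonglongrightarrow> H_star t (D g t) + H t 0" for t
  proof (rule tendsto_eventually)
    obtain k :: nat where "norm (D g t) \<le> k"
      using real_arch_simple by blast
    then have "\<forall>l\<ge>k. f l t = H_star t (D g t) + H t 0" by (auto simp: f_def)
    then show "\<forall>\<^sub>F k in sequentially. f k t = H_star t (D g t) + H t 0"
      by (auto simp: eventually_sequentially)
  qed
  have mono_AE: "AE t in L. mono (\<lambda>k. f k t)"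
    using mono by (intro AE_I2 monoI) auto
  note mct = f_int mono_AE AE_I2[OF pw] I(1) meas
  have int: "integrable L (\<lambda>t. H_star t (D g t) + H t 0)"
    by (rule integrable_monotone_convergence[OF mct])
  have eq: "(LINT t|L. H_star t (D g t) + H t 0) = I"
    by (rule integral_monotone_convergence[OF mct])
  have int': "integrable L (\<lambda>t. H_star t (D g t))"
    using Bochner_Integration.integrable_diff[OF int integrable_H_zero] by simp
  then show "g \<in> admissible"
    using g by (simp add: admissible_def)
  show "conj_energy g \<le> A"
    using eq I(2) int' integrable_H_zero by simp
qed

section \<open>Existence of a minimizer by the direct method\<close>

theorem minimizer_exists:
  obtains v where "v \<in> admissible" "\<And>w. w \<in> admissible \<Longrightarrow> energy v \<le> energy w"
proof -
  define m where "m = Inf (energy ` admissible)"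
  have F0: "0 \<le> modular v" for v
    using F_nonneg by (intro Bochner_Integration.integral_nonneg) auto
  have low: "- (LINT t|L. \<alpha> t) \<le> energy v" if "v \<in> admissible" for v
    using energy_lower[OF that] mult_nonneg_nonneg[of "\<rho> - \<mu>", OF _ F0[of v]] \<rho>(2) by simp
  then have bdd: "bdd_below (energy ` admissible)"
    by (auto intro!: bdd_belowI[of _ "- (LINT t|L. \<alpha> t)"])
  have m_le: "m \<le> energy v" if "v \<in> admissible" for v
    unfolding m_def by (rule cINF_lower[OF bdd that])
  \<comment> \<open>Translation does not change the energy; the value 0 at time 0 turns bounds on
    increments into a uniform bound.\<close>
  have "\<exists>v. v \<in> admissible \<and> v 0 = 0 \<and> energy v < m + 1 / Suc n" for n
  proof -
    have "\<exists>y\<in>energy ` admissible. y < m + 1 / Suc n"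
      unfolding m_def by (rule cInf_lessD[of "energy ` admissible"]) (use zero_admissible in auto)
    then obtain v where v: "v \<in> admissible" "energy v < m + 1 / Suc n" by blast
    show ?thesis
      using admissible_translate[OF v(1), of "- v 0"] v(2)
      by (intro exI[of _ "\<lambda>t. v t + - v 0"]) simp
  qed
  then obtain w where w: "\<And>n. w n \<in> admissible" "\<And>n. w n 0 = 0" "\<And>n. energy (w n) < m + 1 / Suc n"
    by metis
  \<comment> \<open>Solved from \<open>energy_lower\<close>, as the energies stay below m +
    1.\<close>
  define B where "B = (m + 1 + (LINT t|L. \<alpha> t)) / (\<rho> - \<mu>)"
  have FB: "modular (w n) \<le> B" for n
  proof -
    have "1 / real (Suc n) \<le> 1" by simp
    then have "(\<rho> - \<mu>) * modular (w n) \<le> m + 1 + (LINT t|L. \<alpha> t)"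
      using energy_lower[OF w(1)[of n]] w(3)[of n] by linarith
    then show ?thesis
      using \<rho>(2) by (simp add: B_def pos_le_divide_eq mult.commute)
  qed
  have B0: "B \<ge> 0"
    using FB[of 0] F0[of "w 0"] by linarith
  have w_ac: "abs_continuous_on 0 T (w n)" and w_per: "w n 0 = w n T" for n
    using w(1) by (auto simp: admissible_def)
  have w_cont: "continuous_on {0..T} (w n)" for n
    by (rule abs_continuous_continuous[OF w_ac])
  have increments: "\<exists>C\<ge>0. \<forall>n E. interval_family 0 T E \<longrightarrow>
      sum_norm_increments (w n) E \<le> \<epsilon> + C * sum_lengths E" if "\<epsilon> > 0" for \<epsilon>
    by (rule uniform_absolute_continuity[OF that B0]) (use w(1) FB in blast)
  obtain C1 where C1: "\<And>n. (LINT t|L. norm (D (w n) t)) \<le> 1 + C1 * T" "C1 \<ge> 0"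
    by (rule uniform_absolute_continuity[OF zero_less_one B0]) (use w(1) FB in blast)
  \<comment> \<open>A family consisting of one interval gives a modulus of continuity common to the
    whole sequence. Boundedness and equicontinuity for Arzela-Ascoli both follow from it.\<close>
  have single: "norm (w n y - w n x) \<le> \<epsilon> + C * \<bar>y - x\<bar>"
    if C: "\<And>n E. interval_family 0 T E \<Longrightarrow> sum_norm_increments (w n) E \<le> \<epsilon> + C * sum_lengths E"
      and xy: "x \<in> {0..T}" "y \<in> {0..T}" for \<epsilon> C n x y
    using C[of "{(min x y, max x y)}" n] interval_family_single[of 0 "min x y" "max x y" T] xy
    by (auto simp: min_def max_def norm_minus_commute split: if_splits)
  obtain C0 where C0: "C0 \<ge> 0" "\<And>n E. interval_family 0 T E \<Longrightarrow>
      sum_norm_increments (w n) E \<le> 1 + C0 * sum_lengths E"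
    using increments[of 1] by auto
  have w_bdd: "norm (w n x) \<le> 1 + C0 * T" if "x \<in> {0..T}" for n x
  proof -
    have "norm (w n x - w n 0) \<le> 1 + C0 * \<bar>x - 0\<bar>"
      by (rule single[OF C0(2)]) (use that T in auto)
    moreover have "C0 * \<bar>x - 0\<bar> \<le> C0 * T"
      using that C0(1) by (intro mult_left_mono) auto
    ultimately show ?thesis
      using w(2)[of n] by simp
  qed
  have w_equi: "\<exists>d>0. \<forall>n y. y \<in> {0..T} \<and> norm (x - y) < d \<longrightarrow> norm (w n x - w n y) < e"
    if x: "x \<in> {0..T}" and e: "0 < e" for x e :: real
  proof -
    obtain C where C: "C \<ge> 0" "\<And>n E. interval_family 0 T E \<Longrightarrow>
        sum_norm_increments (w n) E \<le> e / 2 + C * sum_lengths E"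
      using increments[of "e / 2"] e by auto
    show ?thesis
    proof (intro exI[of _ "e / (2 * (C + 1))"] conjI allI impI)
      fix n y assume y: "y \<in> {0..T} \<and> norm (x - y) < e / (2 * (C + 1))"
      have "norm (w n x - w n y) \<le> e / 2 + C * \<bar>x - y\<bar>"
        by (rule single[OF C(2)]) (use x y in auto)
      moreover have "C * \<bar>x - y\<bar> \<le> (C + 1) * \<bar>x - y\<bar>" by (intro mult_right_mono) auto
      moreover have "(C + 1) * \<bar>x - y\<bar> < (C + 1) * (e / (2 * (C + 1)))"
        using y C(1) by (intro mult_strict_left_mono) auto
      moreover have "(C + 1) * (e / (2 * (C + 1))) = e / 2"
        using C(1) by (simp add: divide_simps)
      ultimately show "norm (w n x - w n y) < e" by linarith
    qed (use e C(1) in auto)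
  qed
  obtain g and s :: "nat \<Rightarrow> nat" where g: "continuous_on {0..T} g" "strict_mono s"
    "\<And>e. 0 < e \<Longrightarrow> \<exists>N. \<forall>n x. n \<ge> N \<and> x \<in> {0..T} \<longrightarrow> norm (w (s n) x - g x) < e"
    by (rule Arzela_Ascoli[OF compact_Icc w_bdd w_equi]) (assumption | rule that)+
  have unif: "uniform_limit {0..T} (\<lambda>n. w (s n)) g sequentially"
    unfolding uniform_limit_iff eventually_sequentially dist_norm using g(3) by meson
  have lim: "(\<lambda>n. w (s n) t) \<longlonglongrightarrow> g t" if "t \<in> {0..T}" for t
    by (rule tendsto_uniform_limitI[OF unif that])
  have g_per: "g 0 = g T"
  proof (rule LIMSEQ_unique)
    show "(\<lambda>n. w (s n) 0) \<longlonglongrightarrow> g 0" by (rule lim) (use T in simp)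
    have "(\<lambda>n. w (s n) T) \<longlonglongrightarrow> g T" by (rule lim) (use T in simp)
    then show "(\<lambda>n. w (s n) 0) \<longlonglongrightarrow> g T" by (simp only: w_per)
  qed
  have g_ac: "abs_continuous_on 0 T g"
  proof (rule abs_continuous_onI_affine)
    fix \<epsilon> :: real assume "\<epsilon> > 0"
    then obtain C where C: "C \<ge> 0" "\<And>n E. interval_family 0 T E \<Longrightarrow>
        sum_norm_increments (w n) E \<le> \<epsilon> + C * sum_lengths E"
      using increments by blast
    have "sum_norm_increments g E \<le> \<epsilon> + C * sum_lengths E" if E: "interval_family 0 T E" for E
    proof (rule LIMSEQ_le_const2)
      have bd: "fst p \<in> {0..T} \<and> snd p \<in> {0..T}" if "p \<in> E" for p
        using E that unfolding interval_family_alt by force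
      show "(\<lambda>n. \<Sum>(x, y)\<in>E. norm (w (s n) y - w (s n) x)) \<longlonglongrightarrow> sum_norm_increments g E"
        unfolding case_prod_unfold by (intro tendsto_intros lim) (use bd in auto)
    qed (use C(2)[OF E] in auto)
    then show "\<exists>C\<ge>0. \<forall>E. interval_family 0 T E \<longrightarrow>
        sum_norm_increments g E \<le> \<epsilon> + C * sum_lengths E"
      using C(1) by blast
  qed
  have wint: "integrable L (\<lambda>t. J (D (w n) t))" for n
    by (rule integrable_J_deriv[OF T w_ac])
  \<comment> \<open>Both arguments vary with n. Replacing the second by g costs the uniform distance
    times the L1 norm of the derivatives, which is at most 1 + C1 T; symmetry then puts the
    derivative on the fixed g.\<close>
  have quad: "(\<lambda>n. symp_form T (w (s n)) (w (s n))) \<longlonglongrightarrow> symp_form T g g"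
  proof -
    have "(\<lambda>n. symp_form T (w (s n)) g) \<longlonglongrightarrow> symp_form T g g"
    proof -
      have "(\<lambda>n. symp_form T g (w (s n))) \<longlonglongrightarrow> symp_form T g g"
        unfolding symp_form_def
        by (rule integral_inner_tendsto[OF integrable_J_deriv[OF T g_ac] g(1) w_cont unif])
      then show ?thesis
        using symp_form_sym[OF T g_ac g_per w_ac w_per] by simp
    qed
    moreover have "(\<lambda>n. symp_form T (w (s n)) (w (s n)) - symp_form T (w (s n)) g) \<longlonglongrightarrow> 0"
    proof (rule LIMSEQ_I)
      fix e :: real assume "e > 0"
      define A where "A = 1 + C1 * T"
      have A: "A > 0"
        using C1(2) T by (simp add: A_def add_pos_nonneg)
      obtain N where N: "\<And>n x. n \<ge> N \<Longrightarrow> x \<in> {0..T} \<Longrightarrow> norm (w (s n) x - g x) < e / (2 * A)"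
        using g(3)[of "e / (2 * A)"] \<open>e > 0\<close> A by (meson divide_pos_pos mult_pos_pos zero_less_numeral)
      have "norm (symp_form T (w (s n)) (w (s n)) - symp_form T (w (s n)) g - 0) < e" if "n \<ge> N" for n
      proof -
        have "\<bar>symp_form T (w (s n)) (w (s n)) - symp_form T (w (s n)) g\<bar>
            \<le> e / (2 * A) * (LINT t|L. norm (J (D (w (s n)) t)))"
          unfolding symp_form_def using N[OF that]
          by (intro integral_inner_diff_bound wint w_cont g(1) less_imp_le)
        also have "\<dots> \<le> e / (2 * A) * A"
          using C1(1)[of "s n"] \<open>e > 0\<close> A by (intro mult_left_mono) (auto simp: norm_J A_def)
        also have "\<dots> < e"
          using A \<open>e > 0\<close> by simp
        finally show ?thesis by simp
      qed
      then show "\<exists>N. \<forall>n\<ge>N. norm (symp_form T (w (s n)) (w (s n)) - symp_form T (w (s n)) g - 0) < e"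
        by blast
    qed
    ultimately show ?thesis
      using tendsto_add by fastforce
  qed
  have "(\<lambda>n. energy (w n)) \<longlonglongrightarrow> m"
  proof (rule tendsto_sandwich[of "\<lambda>_. m" _ _ "\<lambda>n. m + 1 / Suc n"])
    show "(\<lambda>n. m + 1 / Suc n) \<longlonglongrightarrow> m"
      using LIMSEQ_inverse_real_of_nat_add[of m] by (simp add: divide_inverse)
    show "\<forall>\<^sub>F n in sequentially. energy (w n) \<le> m + 1 / Suc n"
      by (intro always_eventually allI less_imp_le w(3))
    show "\<forall>\<^sub>F n in sequentially. m \<le> energy (w n)"
      by (intro always_eventually allI m_le w(1))
  qed (rule tendsto_const)
  then have "(\<lambda>n. energy (w (s n))) \<longlonglongrightarrow> m"
    using LIMSEQ_subseq_LIMSEQ[OF _ g(2), of "\<lambda>n. energy (w n)"] by (simp add: o_def)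
  then have "(\<lambda>n. energy (w (s n)) - 1 / 2 * symp_form T (w (s n)) (w (s n))) \<longlonglongrightarrow> m - 1 / 2 * symp_form T g g"
    by (intro tendsto_intros quad)
  then have conj_lim: "(\<lambda>n. LINT t|L. H_star t (D (w (s n)) t)) \<longlonglongrightarrow> m - 1 / 2 * symp_form T g g"
    by (simp add: energy_def)
  \<comment> \<open>Lower semicontinuity without convergence of the derivatives: for fixed p the
    derivative is moved to p, and the Fenchel bounds along the sequence pass to the limit. The
    resulting dual bound for g returns its admissibility and the estimate of its convex part, so its
    energy is at most m.\<close>
  have "(LINT t|L. D g t \<bullet> p t) - (LINT t|L. H t (p t)) \<le> m - 1 / 2 * symp_form T g g"
    if p: "abs_continuous_on 0 T p" for p
  proof (rule LIMSEQ_le[OF _ conj_lim])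
    have parts: "(LINT t|L. D v t \<bullet> p t) = v T \<bullet> p T - v 0 \<bullet> p 0 - (LINT t|L. D p t \<bullet> v t)"
      if "abs_continuous_on 0 T v" for v
      using abs_continuous_integral_by_parts[OF T that p] by (simp add: inner_commute)
    have "(\<lambda>n. LINT t|L. D p t \<bullet> w (s n) t) \<longlonglongrightarrow> (LINT t|L. D p t \<bullet> g t)"
      by (rule integral_inner_tendsto[OF abs_continuous_integrable_deriv[OF T p] g(1) w_cont unif])
    then have "(\<lambda>n. LINT t|L. D (w (s n)) t \<bullet> p t) \<longlonglongrightarrow> (LINT t|L. D g t \<bullet> p t)"
      unfolding parts[OF w_ac] parts[OF g_ac] using T by (intro tendsto_intros lim) auto
    then show "(\<lambda>n. (LINT t|L. D (w (s n)) t \<bullet> p t) - (LINT t|L. H t (p t)))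
        \<longlonglongrightarrow> (LINT t|L. D g t \<bullet> p t) - (LINT t|L. H t (p t))"
      by (intro tendsto_intros)
  qed (use Fenchel_integral[OF w(1) p] in auto)
  note g_adm = admissible_of_dual_bound[OF g_ac g_per this]
  show ?thesis
  proof (rule that[OF g_adm(1)])
    fix v assume "v \<in> admissible"
    then show "energy g \<le> energy v"
      using g_adm(2) m_le[of v] by (simp add: energy_def)
  qed
qed

end

section \<open>Euler--Lagrange equation\<close>

context dual_problem
begin

lemma L_not_null: "\<not> (AE t in L. False)"
proof
  assume "AE t in L. False"
  then have "AE t in L. t \<notin> {0..T}" by eventually_elim simp
  then have "{0..T} \<in> null_sets L" by (subst AE_iff_null_sets) auto
  then have "emeasure L {0..T} = 0" by auto
  then show False
    using T by (simp add: emeasure_restrict_space)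
qed

lemma abs_continuous_add_scaled:
  assumes "abs_continuous_on 0 T u" "abs_continuous_on 0 T w"
  shows "abs_continuous_on 0 T (\<lambda>t. u t + s *\<^sub>R w t :: 'a)"
proof (rule abs_continuous_bound[OF assms, of "1 + \<bar>s\<bar>"])
  fix x y
  have "norm (u y + s *\<^sub>R w y - (u x + s *\<^sub>R w x)) = norm ((u y - u x) + s *\<^sub>R (w y - w x))"
    by (simp add: algebra_simps)
  also have "\<dots> \<le> norm (u y - u x) + \<bar>s\<bar> * norm (w y - w x)"
    by (metis norm_scaleR norm_triangle_ineq)
  also have "\<dots> \<le> (1 + \<bar>s\<bar>) * norm (u y - u x) + (1 + \<bar>s\<bar>) * norm (w y - w x)"
    by (intro add_mono mult_right_mono mult_left_le_one_le) (auto simp: mult_le_cancel_right1)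
  finally show "norm (u y + s *\<^sub>R w y - (u x + s *\<^sub>R w x))
      \<le> (1 + \<bar>s\<bar>) * (norm (u y - u x) + norm (w y - w x))"
    by (simp add: distrib_left)
qed simp

lemma AE_deriv_add_scaled:
  assumes u: "abs_continuous_on 0 T u" and w: "abs_continuous_on 0 T w"
  shows "AE t in L. D (\<lambda>t. u t + s *\<^sub>R w t) t = D u t + s *\<^sub>R D w t"
  using abs_continuous_AE_deriv[OF T u] abs_continuous_AE_deriv[OF T w] AE_space
proof eventually_elim
  case (elim t)
  then show ?case
    by (intro deriv_add_scaled) auto
qed

lemma symp_form_add_scaled_left:
  assumes u: "abs_continuous_on 0 T u" and w: "abs_continuous_on 0 T w" and x: "continuous_on {0..T} x"
  shows "symp_form T (\<lambda>t. u t + s *\<^sub>R w t) x = symp_form T u x + s * symp_form T w x"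
proof -
  have i: "integrable L (\<lambda>t. J (D z t) \<bullet> x t)" if "abs_continuous_on 0 T z" for z
    by (intro integrable_inner_continuous integrable_J_deriv T that x)
  have "symp_form T (\<lambda>t. u t + s *\<^sub>R w t) x = (LINT t|L. J (D u t) \<bullet> x t + s * (J (D w t) \<bullet> x t))"
    unfolding symp_form_def
  proof (rule integral_cong_AE)
    show "AE t in L. J (D (\<lambda>t. u t + s *\<^sub>R w t) t) \<bullet> x t = J (D u t) \<bullet> x t + s * (J (D w t) \<bullet> x t)"
      using AE_deriv_add_scaled[OF u w, of s]
      by eventually_elim (simp add: linear_add[OF linear] linear_scale[OF linear] inner_add_left)
    show "(\<lambda>t. J (D (\<lambda>t. u t + s *\<^sub>R w t) t) \<bullet> x t) \<in> borel_measurable L"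
      by (rule borel_measurable_integrable[OF i[OF abs_continuous_add_scaled[OF u w]]])
    show "(\<lambda>t. J (D u t) \<bullet> x t + s * (J (D w t) \<bullet> x t)) \<in> borel_measurable L"
      using i[OF u] i[OF w] by (intro borel_measurable_integrable) simp
  qed
  then show ?thesis
    using i[OF u] i[OF w] by (simp add: symp_form_def)
qed

lemma symp_form_add_scaled_right:
  assumes u: "abs_continuous_on 0 T u" and x: "continuous_on {0..T} x" "continuous_on {0..T} y"
  shows "symp_form T u (\<lambda>t. x t + s *\<^sub>R y t) = symp_form T u x + s * symp_form T u y"
  using integrable_inner_continuous[OF integrable_J_deriv[OF T u] x(1)]
    integrable_inner_continuous[OF integrable_J_deriv[OF T u] x(2)]
  by (simp add: symp_form_def inner_add_right)

text \<open>Symmetry merges the two mixed terms.\<close>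

lemma symp_form_add_scaled:
  assumes u: "abs_continuous_on 0 T u" "u 0 = u T" and w: "abs_continuous_on 0 T w" "w 0 = w T"
  shows "symp_form T (\<lambda>t. u t + s *\<^sub>R w t) (\<lambda>t. u t + s *\<^sub>R w t)
    = symp_form T u u + 2 * s * symp_form T w u + s\<^sup>2 * symp_form T w w"
proof -
  have c: "continuous_on {0..T} u" "continuous_on {0..T} w"
    using u w by (auto intro: abs_continuous_continuous)
  show ?thesis
    using symp_form_sym[OF T u w] c
    by (simp add: symp_form_add_scaled_left[OF u(1) w(1)] symp_form_add_scaled_right[OF u(1)]
        symp_form_add_scaled_right[OF w(1)] continuous_intros power2_eq_square algebra_simps)
qed

text \<open>Admissible variations are supported where \<open>v'\<close> is bounded, so that no growth of the conjugate
  is involved; testing with the deviation of \<open>conj_max t (v' t) - J (v t)\<close> from its mean over this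
  set forces it to be constant there.\<close>

lemma Euler_Lagrange_truncated:
  assumes v: "v \<in> admissible" and min: "\<And>w. w \<in> admissible \<Longrightarrow> energy v \<le> energy w"
  shows "\<exists>c. AE t in L. norm (D v t) \<le> real k \<longrightarrow> conj_max t (D v t) - J (v t) = c"
proof -
  have v_ac: "abs_continuous_on 0 T v" and v_per: "v 0 = v T"
    and v_int: "integrable L (\<lambda>t. H_star t (D v t))"
    using v by (auto simp: admissible_def)
  have v_cont: "continuous_on {0..T} v"
    by (rule abs_continuous_continuous[OF v_ac])
  have Dv [measurable]: "D v \<in> borel_measurable L" by (rule deriv_measurable[OF v_ac])
  define E where "E = {t \<in> space L. norm (D v t) \<le> real k}"
  have E [measurable]: "E \<in> sets L"
    unfolding E_def by measurable
  define r where "r = (\<lambda>t. conj_max t (D v t) - J (v t))"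
  have Jv_cont: "continuous_on {0..T} (\<lambda>t. J (v t))"
    by (rule abs_continuous_continuous[OF abs_continuous_J[OF v_ac]])
  have r_meas [measurable]: "r \<in> borel_measurable L"
    unfolding r_def using T
    by (intro borel_measurable_diff measurable_Caratheodory[OF _ continuous_conj_max Dv]
        continuous_imp_measurable_on_sets_lebesgue[OF Jv_cont]) auto
  obtain R where R: "\<And>t w. t \<in> {0..T} \<Longrightarrow> norm w \<le> real k \<Longrightarrow> norm (conj_max t w) \<le> R"
    using bounded_conj_max[of "real k"] by blast
  obtain V where V: "\<And>t. t \<in> {0..T} \<Longrightarrow> norm (J (v t)) \<le> V"
    using continuous_on_Icc_bounded[OF Jv_cont] by blast
  have r_bdd: "norm (r t) \<le> R + V" if "t \<in> E" for t
    using norm_triangle_ineq4[of "conj_max t (D v t)" "J (v t)"] R[of t "D v t"] V[of t] that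
    by (auto simp: E_def r_def)
  have fin: "emeasure L E \<noteq> \<infinity>"
  proof -
    interpret finite_measure L
      by (rule finite_measure_lebesgue_on) simp
    show ?thesis by simp
  qed
  \<comment> \<open>The mean of r over E. It gives h the integral 0, so that the primitive \<phi> of
    h is periodic and v + s \<phi> can compete with v.\<close>
  define c where "c = (1 / measure L E) *\<^sub>R (LINT t|L. indicator E t *\<^sub>R r t)"
  define h where "h = (\<lambda>t. indicator E t *\<^sub>R (c - r t))"
  define Bh where "Bh = \<bar>norm c + (R + V)\<bar>"
  have h_bdd: "norm (h t) \<le> Bh" for t
    using norm_triangle_ineq4[of c "r t"] r_bdd[of t] by (auto simp: h_def Bh_def indicator_def)
  have h_meas [measurable]: "h \<in> borel_measurable L"
    unfolding h_def by measurable
  have h_int: "integrable L h"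
    by (rule integrable_bounded_Icc[OF h_meas]) (use h_bdd in auto)
  show ?thesis
  proof (cases "measure L E = 0")
    \<comment> \<open>On a null set any constant will do; dividing by \<open>measure L E\<close> is
      meaningful only in the other case.\<close>
    case True
    then have "E \<in> null_sets L"
      using fin by (intro null_setsI) (auto simp: measure_def enn2real_eq_0_iff)
    then have "AE t in L. t \<notin> E" by (rule AE_not_in)
    then have "AE t in L. norm (D v t) \<le> real k \<longrightarrow> conj_max t (D v t) - J (v t) = 0"
      using AE_space by eventually_elim (auto simp: E_def)
    then show ?thesis by blast
  next
    case False
    have r_int: "integrable L (\<lambda>t. indicator E t *\<^sub>R r t)"
      by (rule integrable_bounded_Icc[of _ _ _ "\<bar>R + V\<bar>"])
        (use r_bdd in \<open>auto simp: indicator_def intro!: AE_I2 order_trans[OF r_bdd]\<close>)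
    have c_int: "integrable L (\<lambda>t. indicator E t *\<^sub>R c)"
      by (rule integrable_bounded_Icc[of _ _ _ "norm c"]) (auto simp: indicator_def)
    have ind_int: "integrable L (indicat_real E)"
      by (rule integrable_bounded_Icc[of _ _ _ 1]) (auto simp: indicator_def)
    have EI: "E \<inter> space L = E" by (auto simp: E_def)
    have h_zero: "(LINT t|L. h t) = 0"
    proof -
      have "(LINT t|L. h t) = (LINT t|L. indicator E t *\<^sub>R c) - (LINT t|L. indicator E t *\<^sub>R r t)"
        using r_int c_int by (simp add: h_def scaleR_diff_right)
      also have "(LINT t|L. indicator E t *\<^sub>R c) = measure L E *\<^sub>R c"
        using integral_scaleR_left[of c L "indicat_real E"] ind_int EI by simp
      finally show ?thesis
        using False by (simp add: c_def)
    qed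
    define \<phi> where "\<phi> = (\<lambda>t. integral {0..t} h)"
    have h_on: "h integrable_on {0..T}"
      using h_int by (rule integrable_on_lebesgue_on) simp
    have h_sub: "h integrable_on {x..y}" if "0 \<le> x" "y \<le> T" for x y
      by (rule integrable_on_subinterval[OF h_on]) (use that in auto)
    have \<phi>_inc: "(h has_integral (\<phi> y - \<phi> x)) {x..y}" if "0 \<le> x" "x \<le> y" "y \<le> T" for x y
    proof -
      have "integral {0..x} h + integral {x..y} h = integral {0..y} h"
        by (rule Henstock_Kurzweil_Integration.integral_combine[OF that(1,2) h_sub]) (use that in auto)
      then have "\<phi> y - \<phi> x = integral {x..y} h" by (auto simp: \<phi>_def algebra_simps)
      then show ?thesis
        using integrable_integral[OF h_sub[OF that(1,3)]] by simp
    qed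
    have \<phi>_ac: "abs_continuous_on 0 T \<phi>"
      by (rule abs_continuous_indefinite_integral[OF h_int \<phi>_inc])
    have "\<phi> 0 = 0" by (simp add: \<phi>_def)
    moreover have "\<phi> T = 0"
      using h_zero lebesgue_integral_eq_integral[OF h_int] by (simp add: \<phi>_def)
    ultimately have \<phi>_per: "\<phi> 0 = \<phi> T" by simp
    have D\<phi>: "AE t in L. D \<phi> t = h t"
      using lebesgue_differentiation[OF h_on] AE_space
    proof eventually_elim
      case (elim t)
      then show ?case
        unfolding \<phi>_def by (intro vector_derivative_within_closed_interval[OF T]) auto
    qed
    obtain B where B: "\<And>t w. t \<in> {0..T} \<Longrightarrow> norm w \<le> real k + Bh \<Longrightarrow> norm (H_star t w) \<le> B"
      by (rule bounded_Caratheodory[OF continuous_conjugate, of "real k + Bh"]) (rule that)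
    obtain Q where Q: "\<And>t w. t \<in> {0..T} \<Longrightarrow> norm w \<le> real k + Bh \<Longrightarrow> norm (conj_max t w) \<le> Q"
      using bounded_conj_max[of "real k + Bh"] by blast
    define s where "s = (\<lambda>n. 1 / real (Suc n))"
    have s: "0 < s n" "s n \<le> 1" for n
      by (auto simp: s_def)
    have w_bdd: "norm (D v t + s n *\<^sub>R h t) \<le> real k + Bh" if "t \<in> E" for n t
    proof -
      have "norm (s n *\<^sub>R h t) \<le> 1 * Bh"
        unfolding norm_scaleR using s[of n] h_bdd by (intro mult_mono) auto
      then show ?thesis
        using that norm_triangle_ineq[of "D v t" "s n *\<^sub>R h t"] by (auto simp: E_def)
    qed
    have Dv_bdd: "norm (D v t) \<le> real k + Bh" if "t \<in> E" for t
      using that by (auto simp: E_def Bh_def)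
    \<comment> \<open>Off E the derivative v' may be unbounded, but h vanishes there. Replacing the
      argument by 0 keeps the maximizer bounded without changing its product with h.\<close>
    define z where "z = (\<lambda>n t. indicator E t *\<^sub>R (D v t + s n *\<^sub>R h t))"
    have z_meas [measurable]: "z n \<in> borel_measurable L" for n
      unfolding z_def by measurable
    have z_bdd: "norm (z n t) \<le> real k + Bh" for n t
      using w_bdd[of t n] by (auto simp: z_def indicator_def Bh_def)
    have E_sub: "t \<in> {0..T}" if "t \<in> E" for t
      using that by (auto simp: E_def)
    define \<delta> where "\<delta> = (\<lambda>n t. indicator E t * (H_star t (D v t + s n *\<^sub>R h t) - H_star t (D v t)))"
    define \<kappa> where "\<kappa> = (\<lambda>n t. conj_max t (z n t) \<bullet> h t)"
    have \<kappa>_meas: "\<kappa> n \<in> borel_measurable L" for n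
      unfolding \<kappa>_def using T
      by (intro borel_measurable_inner h_meas measurable_Caratheodory[OF _ continuous_conj_max z_meas]) simp
    have Bh0: "0 \<le> Bh" by (simp add: Bh_def)
    have \<kappa>_bdd: "norm (\<kappa> n t) \<le> Q * Bh" if "t \<in> {0..T}" for n t
    proof -
      have "norm (conj_max t (z n t)) * norm (h t) \<le> Q * Bh"
        using Q[OF that z_bdd] by (rule mult_mono) (use h_bdd Q[OF that z_bdd] norm_ge_zero order_trans in blast)+
      then show ?thesis
        using Cauchy_Schwarz_ineq2[of "conj_max t (z n t)" "h t"] by (simp add: \<kappa>_def)
    qed
    have \<kappa>_int: "integrable L (\<kappa> n)" for n
      by (rule integrable_bounded_Icc[OF \<kappa>_meas, of _ "Q * Bh"]) (use \<kappa>_bdd in auto)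
    have \<delta>_meas: "\<delta> n \<in> borel_measurable L" for n
    proof -
      have m1: "(\<lambda>t. H_star t (D v t + s n *\<^sub>R h t)) \<in> borel_measurable L"
        by (rule measurable_Caratheodory[OF _ continuous_conjugate]) (use T in auto)
      have m2: "(\<lambda>t. H_star t (D v t)) \<in> borel_measurable L"
        using v_int by auto
      show ?thesis
        unfolding \<delta>_def by (intro borel_measurable_times borel_measurable_indicator E borel_measurable_diff m1 m2)
    qed
    have \<delta>_int: "integrable L (\<delta> n)" for n
    proof (rule integrable_bounded_Icc[OF \<delta>_meas], rule AE_I2)
      fix t
      show "norm (\<delta> n t) \<le> \<bar>B\<bar> + \<bar>B\<bar>"
      proof (cases "t \<in> E")
        case True
        then have "\<bar>H_star t (D v t + s n *\<^sub>R h t)\<bar> \<le> B" "\<bar>H_star t (D v t)\<bar> \<le> B"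
          using B[OF E_sub[OF True] w_bdd[OF True]] B[OF E_sub[OF True] Dv_bdd[OF True]] by auto
        then show ?thesis
          using True by (simp add: \<delta>_def)
      qed (simp add: \<delta>_def)
    qed
    \<comment> \<open>The subgradient inequality is used at the perturbed point, not at v': this
      bounds the increment of the conjugate from above, as minimality requires, and continuity of
      \<open>conj_max\<close> recovers the maximizer at v' when s tends to 0.\<close>
    have \<delta>_le: "\<delta> n t \<le> s n * \<kappa> n t" for n t
    proof (cases "t \<in> E")
      case True
      then show ?thesis
        using conj_subgradient[OF E_sub[OF True], of "D v t + s n *\<^sub>R h t" "D v t"]
        by (simp add: \<delta>_def \<kappa>_def z_def inner_diff_right inner_add_right)
    qed (simp add: \<delta>_def \<kappa>_def h_def)
    \<comment> \<open>Minimality against v + s \<phi>, divided by s > 0.\<close>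
    have ineq: "0 \<le> symp_form T \<phi> v + s n / 2 * symp_form T \<phi> \<phi> + (LINT t|L. \<kappa> n t)" for n
    proof -
      let ?w = "\<lambda>t. v t + s n *\<^sub>R \<phi> t"
      have w_ac: "abs_continuous_on 0 T ?w"
        by (rule abs_continuous_add_scaled[OF v_ac \<phi>_ac])
      have eq: "AE t in L. H_star t (D v t) + \<delta> n t = H_star t (D ?w t)"
        using AE_deriv_add_scaled[OF v_ac \<phi>_ac, of "s n"] D\<phi>
        by eventually_elim (auto simp: \<delta>_def h_def indicator_def)
      have int: "integrable L (\<lambda>t. H_star t (D v t) + \<delta> n t)"
        using v_int \<delta>_int by simp
      have w_int: "integrable L (\<lambda>t. H_star t (D ?w t))"
        by (rule integrable_cong_AE_lebesgue_on[OF _ int eq]) simp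
      have w_adm: "?w \<in> admissible"
        using w_ac w_int v_per \<phi>_per by (simp add: admissible_def)
      have "conj_energy ?w = (LINT t|L. H_star t (D v t) + \<delta> n t)"
        by (rule integral_cong_AE[OF borel_measurable_integrable[OF w_int] borel_measurable_integrable[OF int]])
          (use eq in \<open>eventually_elim, simp\<close>)
      also have "\<dots> = conj_energy v + (LINT t|L. \<delta> n t)"
        using v_int \<delta>_int by simp
      finally have "energy ?w - energy v = s n * symp_form T \<phi> v + (s n)\<^sup>2 / 2 * symp_form T \<phi> \<phi> + (LINT t|L. \<delta> n t)"
        by (simp add: energy_def symp_form_add_scaled[OF v_ac v_per \<phi>_ac \<phi>_per] field_simps)
      moreover have "(LINT t|L. \<delta> n t) \<le> (LINT t|L. s n * \<kappa> n t)"
        using \<delta>_int \<kappa>_int by (intro integral_mono \<delta>_le) auto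
      ultimately have "0 \<le> s n * symp_form T \<phi> v + (s n)\<^sup>2 / 2 * symp_form T \<phi> \<phi> + s n * (LINT t|L. \<kappa> n t)"
        using min[OF w_adm] by simp
      also have "\<dots> = s n * (symp_form T \<phi> v + s n / 2 * symp_form T \<phi> \<phi> + (LINT t|L. \<kappa> n t))"
        by (simp add: power2_eq_square algebra_simps)
      finally show ?thesis
        using s(1)[of n] by (simp add: zero_le_mult_iff)
    qed
    define \<kappa>0 where "\<kappa>0 = (\<lambda>t. conj_max t (indicator E t *\<^sub>R D v t) \<bullet> h t)"
    have s_lim: "s \<longlonglongrightarrow> 0"
      unfolding s_def using LIMSEQ_inverse_real_of_nat by (simp add: divide_inverse)
    have \<kappa>_lim: "(\<lambda>n. \<kappa> n t) \<longlonglongrightarrow> \<kappa>0 t" if t: "t \<in> {0..T}" for t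
    proof -
      have "(\<lambda>n. indicator E t *\<^sub>R (D v t + s n *\<^sub>R h t)) \<longlonglongrightarrow> indicator E t *\<^sub>R (D v t + 0 *\<^sub>R h t)"
        by (intro tendsto_intros s_lim)
      then have "(\<lambda>n. z n t) \<longlonglongrightarrow> indicator E t *\<^sub>R D v t" by (simp add: z_def)
      then have "(\<lambda>n. conj_max t (z n t)) \<longlonglongrightarrow> conj_max t (indicator E t *\<^sub>R D v t)"
      proof (rule continuous_on_tendsto_compose[rotated])
        show "continuous_on UNIV (conj_max t)"
          using continuous_on_compose2[OF continuous_conj_max, of UNIV "\<lambda>w. (t, w)"] t
          by (force intro!: continuous_intros)
      qed auto
      then show ?thesis
        unfolding \<kappa>_def \<kappa>0_def by (intro tendsto_intros)
    qed
    have \<kappa>0_meas: "\<kappa>0 \<in> borel_measurable L"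
      unfolding \<kappa>0_def using T
      by (intro borel_measurable_inner h_meas measurable_Caratheodory[OF _ continuous_conj_max]) auto
    have const: "integrable L (\<lambda>_. Q * Bh)"
      by (rule integrable_bounded_Icc[of _ _ _ "\<bar>Q * Bh\<bar>"]) auto
    note dc = \<kappa>0_meas \<kappa>_meas const AE_I2[of L, OF \<kappa>_lim] AE_I2[of L, OF \<kappa>_bdd]
    have "(\<lambda>n. LINT t|L. \<kappa> n t) \<longlonglongrightarrow> (LINT t|L. \<kappa>0 t)"
      by (rule integral_dominated_convergence[OF dc]) auto
    then have "(\<lambda>n. symp_form T \<phi> v + s n / 2 * symp_form T \<phi> \<phi> + (LINT t|L. \<kappa> n t))
        \<longlonglongrightarrow> symp_form T \<phi> v + 0 / 2 * symp_form T \<phi> \<phi> + (LINT t|L. \<kappa>0 t)"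
      by (intro tendsto_intros s_lim) auto
    then have "0 \<le> symp_form T \<phi> v + 0 / 2 * symp_form T \<phi> \<phi> + (LINT t|L. \<kappa>0 t)"
      by (rule LIMSEQ_le_const) (use ineq in auto)
    then have nn: "0 \<le> symp_form T \<phi> v + (LINT t|L. \<kappa>0 t)" by simp
    have \<kappa>0_int: "integrable L \<kappa>0" by (rule integrable_dominated_convergence[OF dc]) auto
    have hh_int: "integrable L (\<lambda>t. h t \<bullet> h t)"
    proof (rule integrable_bounded_Icc)
      show "AE t in L. norm (h t \<bullet> h t) \<le> Bh * Bh"
        using h_bdd Bh0 by (intro AE_I2) (auto simp: dot_square_norm power2_eq_square intro!: mult_mono)
    qed measurable
    have Jh_int: "integrable L (\<lambda>t. J (h t) \<bullet> v t)"
      by (intro integrable_inner_continuous integrable_bounded_linear[OF bounded_linear h_int] v_cont)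
    have "symp_form T \<phi> v = (LINT t|L. J (h t) \<bullet> v t)"
      unfolding symp_form_def
    proof (rule integral_cong_AE)
      show "(\<lambda>t. J (D \<phi> t) \<bullet> v t) \<in> borel_measurable L"
        by (rule borel_measurable_integrable[OF integrable_inner_continuous[OF integrable_J_deriv[OF T \<phi>_ac] v_cont]])
      show "AE t in L. J (D \<phi> t) \<bullet> v t = J (h t) \<bullet> v t"
        using D\<phi> by eventually_elim simp
    qed (rule borel_measurable_integrable[OF Jh_int])
    then have "symp_form T \<phi> v + (LINT t|L. \<kappa>0 t) = (LINT t|L. J (h t) \<bullet> v t + \<kappa>0 t)"
      using Jh_int \<kappa>0_int by simp
    \<comment> \<open>By skewness the integrand is the product of r and h, and r = c - h on E. Since
      h has integral 0, the first-order inequality says that minus the integral of the square of h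
      is nonnegative, which forces r = c a.e. on E.\<close>
    also have "\<dots> = (LINT t|L. c \<bullet> h t - h t \<bullet> h t)"
    proof (rule Bochner_Integration.integral_cong[OF refl])
      fix t
      show "J (h t) \<bullet> v t + \<kappa>0 t = c \<bullet> h t - h t \<bullet> h t"
      proof (cases "t \<in> E")
        case True
        then have "J (h t) \<bullet> v t + \<kappa>0 t = r t \<bullet> (c - r t)"
          by (simp add: \<kappa>0_def r_def h_def skew inner_commute inner_diff_left)
        then show ?thesis
          using True by (simp add: h_def inner_diff_left inner_diff_right inner_commute)
      qed (simp add: \<kappa>0_def h_def linear_0[OF linear])
    qed
    also have "\<dots> = (LINT t|L. c \<bullet> h t) - (LINT t|L. h t \<bullet> h t)"
    proof (rule Bochner_Integration.integral_diff)
      show "integrable L (\<lambda>t. c \<bullet> h t)"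
        using h_int by simp
    qed (rule hh_int)
    also have "(LINT t|L. c \<bullet> h t) = c \<bullet> (LINT t|L. h t)"
      using h_int by simp
    finally have "(LINT t|L. h t \<bullet> h t) \<le> 0"
      using nn h_zero by simp
    moreover have "0 \<le> (LINT t|L. h t \<bullet> h t)"
      by (rule Bochner_Integration.integral_nonneg) simp
    ultimately have "(LINT t|L. h t \<bullet> h t) = 0" by simp
    then have "AE t in L. h t \<bullet> h t = 0"
      using integral_nonneg_eq_0_iff_AE[OF hh_int] by simp
    then have "AE t in L. norm (D v t) \<le> real k \<longrightarrow> conj_max t (D v t) - J (v t) = c"
      using AE_space by eventually_elim (auto simp: h_def r_def E_def indicator_def)
    then show ?thesis by blast
  qed
qed

text \<open>The truncation sets increase with k and exhaust the interval. Once one of them is not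
  null, the constants of all larger ones agree with its own.\<close>

theorem Euler_Lagrange:
  assumes v: "v \<in> admissible" and min: "\<And>w. w \<in> admissible \<Longrightarrow> energy v \<le> energy w"
  shows "\<exists>c. AE t in L. conj_max t (D v t) = J (v t) + c"
proof -
  define r where "r = (\<lambda>t. conj_max t (D v t) - J (v t))"
  have "\<forall>k::nat. \<exists>c. AE t in L. norm (D v t) \<le> real k \<longrightarrow> r t = c"
    unfolding r_def using Euler_Lagrange_truncated[OF assms] by blast
  then obtain c where c: "\<And>k::nat. AE t in L. norm (D v t) \<le> real k \<longrightarrow> r t = c k" by metis
  \<comment> \<open>Otherwise almost every t would lie in no truncation set, although v' has finite
    norm everywhere and the interval has positive length.\<close>
  have "\<exists>k::nat. \<not> (AE t in L. \<not> norm (D v t) \<le> real k)"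
  proof (rule ccontr)
    assume "\<not> ?thesis"
    then have "AE t in L. \<forall>k::nat. \<not> norm (D v t) \<le> real k" by (simp add: AE_all_countable)
    then have "AE t in L. False" by eventually_elim (use real_arch_simple in blast)
    then show False
      using L_not_null by simp
  qed
  then obtain k where k: "\<not> (AE t in L. \<not> norm (D v t) \<le> real k)" by blast
  have eq: "c l = c k" if "k \<le> l" for l
  proof (rule ccontr)
    assume ne: "c l \<noteq> c k"
    have "AE t in L. \<not> norm (D v t) \<le> real k"
      using c[of k] c[of l]
    proof eventually_elim
      case (elim t)
      show ?case
      proof
        assume "norm (D v t) \<le> real k"
        moreover from this have "norm (D v t) \<le> real l"
          using that by linarith
        ultimately show False
          using elim ne by simp
      qed
    qed
    then show False
      using k by simp
  qed
  have "AE t in L. \<forall>l::nat. norm (D v t) \<le> real l \<longrightarrow> r t = c l"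
    using c by (simp add: AE_all_countable)
  then have "AE t in L. conj_max t (D v t) = J (v t) + c k"
  proof eventually_elim
    case (elim t)
    obtain l :: nat where "norm (D v t) \<le> l"
      using real_arch_simple by blast
    then have "norm (D v t) \<le> real (max k l)" by simp
    then have "r t = c k"
      using elim eq[of "max k l"] by simp
    then show ?case
      by (simp add: r_def algebra_simps)
  qed
  then show ?thesis by blast
qed

end

section \<open>The Hamiltonian system\<close>

lemma sum_UNIV_Plus:
  fixes f :: "'a::finite + 'b::finite \<Rightarrow> real"
  shows "(\<Sum>j\<in>UNIV. f j) = (\<Sum>a\<in>UNIV. f (Inl a)) + (\<Sum>b\<in>UNIV. f (Inr b))"
  by (subst UNIV_Plus_UNIV[symmetric], subst sum.Plus) simp_all

lemma symplectic_J_nth: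
  fixes x :: "real ^ ('n::finite + 'n)"
  shows "(symplectic_J *v x) $ Inl a = x $ Inr a" "(symplectic_J *v x) $ Inr a = - (x $ Inl a)"
  by (simp_all add: matrix_vector_mult_def symplectic_J_def sum_UNIV_Plus if_distribR
      if_distrib[of "\<lambda>c. c * _"] cong: if_cong)

lemma skew_structure_symplectic_J: "skew_structure (\<lambda>x :: real ^ ('n::finite + 'n). symplectic_J *v x)"
proof (rule skew_structure.intro)
  fix x y :: "real ^ ('n + 'n)"
  show "(symplectic_J *v x) \<bullet> y = - (x \<bullet> (symplectic_J *v y))"
    by (simp add: inner_vec_def sum_UNIV_Plus symplectic_J_nth sum_negf)
  show "symplectic_J *v (symplectic_J *v x) = - x"
    unfolding vec_eq_iff
  proof
    fix i :: "'n + 'n"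
    show "(symplectic_J *v (symplectic_J *v x)) $ i = (- x) $ i"
      by (cases i) (simp_all add: symplectic_J_nth)
  qed
qed (rule matrix_vector_mul_linear)

section \<open>Orlicz classes and the extended integral\<close>

lemma orlicz_bounded:
  fixes f :: "real \<Rightarrow> 'a::euclidean_space"
  assumes f: "f \<in> borel_measurable (lebesgue_on {0..T})" "AE t in lebesgue_on {0..T}. norm (f t) \<le> B"
    and G: "continuous_on UNIV G"
  shows "f \<in> orlicz T G"
proof -
  have "bounded (G ` cball 0 B)"
    by (intro compact_imp_bounded compact_continuous_image continuous_on_subset[OF G]) auto
  then obtain M where "\<forall>y\<in>G ` cball 0 B. norm y \<le> M"
    unfolding bounded_iff by blast
  then have M: "norm (G w) \<le> M" if "norm w \<le> B" for w
    using that by simp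
  have "integrable (lebesgue_on {0..T}) (\<lambda>t. G (f t))"
  proof (rule integrable_bounded_Icc)
    show "(\<lambda>t. G (f t)) \<in> borel_measurable (lebesgue_on {0..T})"
      by (rule borel_measurable_continuous_on[OF G f(1)])
    show "AE t in lebesgue_on {0..T}. norm (G (f t)) \<le> M"
      using f(2) by eventually_elim (rule M)
  qed
  then have "(\<integral>\<^sup>+t. ennreal (G (1 *\<^sub>R f t)) \<partial>lebesgue_on {0..T}) < \<infinity>"
    by (simp add: real_integrable_def top.not_eq_extremum)
  then show ?thesis
    unfolding orlicz_def using f(1) zero_less_one by blast
qed

lemma orlicz_continuous:
  fixes f :: "real \<Rightarrow> 'a::euclidean_space"
  assumes f: "continuous_on {0..T} f" and G: "continuous_on UNIV G"
  shows "f \<in> orlicz T G"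
proof -
  obtain B where "\<And>t. t \<in> {0..T} \<Longrightarrow> norm (f t) \<le> B"
    using continuous_on_Icc_bounded[OF f] by blast
  then show ?thesis
    using f by (intro orlicz_bounded[OF _ _ G, of _ _ B] AE_I2 continuous_imp_measurable_on_sets_lebesgue) auto
qed

lemma ext_integral_integrable:
  assumes "integrable M f"
  shows "ext_integral M f = ereal (integral\<^sup>L M f)"
proof -
  have "(\<integral>\<^sup>+x. ennreal (f x) \<partial>M) \<noteq> \<infinity>" "(\<integral>\<^sup>+x. ennreal (- f x) \<partial>M) \<noteq> \<infinity>"
    using assms by (auto simp: real_integrable_def)
  then obtain a b where "(\<integral>\<^sup>+x. ennreal (f x) \<partial>M) = ennreal a" "(\<integral>\<^sup>+x. ennreal (- f x) \<partial>M) = ennreal b"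
    "0 \<le> a" "0 \<le> b"
    by (metis ennreal_cases infinity_ennreal_def)
  then show ?thesis
    by (simp add: ext_integral_def real_lebesgue_integral_def[OF assms] enn2ereal_ennreal)
qed

text \<open>The majorant \<beta> makes the integral of the negative part finite, so an extended
  integral below \<infinity> forces that of the positive part to be finite too.\<close>

lemma integrable_of_ext_integral_less:
  assumes f: "f \<in> borel_measurable M" and \<beta>: "integrable M \<beta>" "\<And>x. x \<in> space M \<Longrightarrow> - f x \<le> \<beta> x"
    and less: "ext_integral M f < \<infinity>"
  shows "integrable M f"
proof -
  have "(\<integral>\<^sup>+x. ennreal (- f x) \<partial>M) \<le> (\<integral>\<^sup>+x. ennreal (\<beta> x) \<partial>M)"
    using \<beta>(2) by (intro nn_integral_mono ennreal_leI)
  then have neg: "(\<integral>\<^sup>+x. ennreal (- f x) \<partial>M) \<noteq> \<infinity>"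
    using \<beta>(1) by (auto simp: real_integrable_def top_unique)
  then obtain b where b: "(\<integral>\<^sup>+x. ennreal (- f x) \<partial>M) = ennreal b" "0 \<le> b"
    by (metis ennreal_cases infinity_ennreal_def)
  have "(\<integral>\<^sup>+x. ennreal (f x) \<partial>M) \<noteq> \<infinity>"
    using less b by (auto simp: ext_integral_def enn2ereal_ennreal)
  then show ?thesis
    using neg f by (simp add: real_integrable_def)
qed

section \<open>The conjugate of a G-function\<close>

locale G_conjugate =
  fixes G :: "'a::euclidean_space \<Rightarrow> real"
  assumes G_fun: "G_function G" and G_cont: "continuous_on UNIV G"
begin

lemma G_simps: "G 0 = 0" "0 \<le> G u"
  using G_fun by (auto simp: G_function_def)

lemma G_Fenchel: "u \<bullet> w - G u \<le> convex_conjugate G w"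
  unfolding convex_conjugate_def using G_fun
  by (intro cSUP_upper bdd_above_convex_conjugate[OF G_cont]) (auto simp: G_function_def)

lemma conjugate_le: "(\<And>u. u \<bullet> w - G u \<le> B) \<Longrightarrow> convex_conjugate G w \<le> B"
  unfolding convex_conjugate_def by (rule cSUP_least) auto

lemma conjugate_nonneg: "0 \<le> convex_conjugate G w"
  using G_Fenchel[of 0 w] by (simp add: G_simps)

text \<open>As G >= 0 and s >= 1, G u is at most s times G u. This is the reason for the 1 in the
  maximum of condition (2): it yields \<rho> >= 1, so that \<rho> can be moved into the
  argument.\<close>

lemma conjugate_scale:
  assumes "1 \<le> s"
  shows "s * convex_conjugate G w \<le> convex_conjugate G (s *\<^sub>R w)"
proof -
  have "convex_conjugate G w \<le> convex_conjugate G (s *\<^sub>R w) / s"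
  proof (rule conjugate_le)
    fix u
    have "G u \<le> s * G u"
      using assms G_simps(2)[of u] by (simp add: mult_le_cancel_right1)
    then have "s * (u \<bullet> w - G u) \<le> convex_conjugate G (s *\<^sub>R w)"
      using G_Fenchel[of u "s *\<^sub>R w"] by (simp add: algebra_simps)
    then show "u \<bullet> w - G u \<le> convex_conjugate G (s *\<^sub>R w) / s"
      using assms by (simp add: pos_le_divide_eq mult.commute)
  qed
  then show ?thesis
    using assms by (simp add: pos_le_divide_eq mult.commute)
qed

lemma conjugate_continuous: "continuous_on UNIV (convex_conjugate G)"
proof (rule convex_on_continuous)
  show "convex_on UNIV (convex_conjugate G)"
  proof (rule convex_onI)
    fix t :: real and x y assume t: "0 < t" "t < 1"
    show "convex_conjugate G ((1 - t) *\<^sub>R x + t *\<^sub>R y)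
        \<le> (1 - t) * convex_conjugate G x + t * convex_conjugate G y"
    proof (rule conjugate_le)
      fix u
      have "(1 - t) * (u \<bullet> x - G u) + t * (u \<bullet> y - G u)
          \<le> (1 - t) * convex_conjugate G x + t * convex_conjugate G y"
        using t by (intro add_mono mult_left_mono G_Fenchel) auto
      then show "u \<bullet> ((1 - t) *\<^sub>R x + t *\<^sub>R y) - G u
          \<le> (1 - t) * convex_conjugate G x + t * convex_conjugate G y"
        by (simp add: inner_add_right algebra_simps)
    qed
  qed simp
qed simp

text \<open>The competitor of norm |M| in the direction of w lies in a ball on which G is bounded,
  and its product with w is |M| norm w.\<close>

lemma conjugate_lower: "\<exists>C. \<forall>w. M * norm w - C \<le> convex_conjugate G w"
proof -
  have "bounded (G ` cball 0 \<bar>M\<bar>)"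
    by (intro compact_imp_bounded compact_continuous_image continuous_on_subset[OF G_cont]) auto
  then obtain C where "\<forall>y\<in>G ` cball 0 \<bar>M\<bar>. norm y \<le> C"
    unfolding bounded_iff by blast
  then have C: "norm (G w) \<le> C" if "norm w \<le> \<bar>M\<bar>" for w
    using that by simp
  have "M * norm w - C \<le> convex_conjugate G w" for w
  proof -
    have "norm (\<bar>M\<bar> *\<^sub>R sgn w) \<le> \<bar>M\<bar>" by (simp add: norm_sgn)
    then have "G (\<bar>M\<bar> *\<^sub>R sgn w) \<le> C"
      using C[of "\<bar>M\<bar> *\<^sub>R sgn w"] by simp
    moreover have "sgn w \<bullet> w = norm w"
      by (cases "w = 0") (simp_all add: sgn_div_norm dot_square_norm power2_eq_square)
    then have "(\<bar>M\<bar> *\<^sub>R sgn w) \<bullet> w = \<bar>M\<bar> * norm w" by simp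
    moreover have "M * norm w \<le> \<bar>M\<bar> * norm w" by (intro mult_right_mono) auto
    ultimately show ?thesis
      using G_Fenchel[of "\<bar>M\<bar> *\<^sub>R sgn w" w] by linarith
  qed
  then show ?thesis by blast
qed

text \<open>The null set in the hypothesis may depend on \<open>u\<close>; continuity in \<open>u\<close> makes it uniform.\<close>

lemma conjugate_lower_bound:
  assumes H: "superlinear_family {0..T} H" and \<Lambda>: "\<Lambda> > 0"
    and upper: "\<And>u. AE t in lebesgue_on {0..T}. H t u \<le> G (\<Lambda> *\<^sub>R u) + \<alpha> t"
  shows "AE t in lebesgue_on {0..T}. \<forall>w. convex_conjugate G (inverse \<Lambda> *\<^sub>R w) - \<alpha> t \<le> convex_conjugate (H t) w"
proof -
  interpret superlinear_family "{0..T}" H by (rule H)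
  obtain X :: "'a set" where X: "countable X" "UNIV \<subseteq> closure X"
    by (rule separable[of UNIV]) (rule that)
  have "AE t in lebesgue_on {0..T}. \<forall>u\<in>X. H t u \<le> G (\<Lambda> *\<^sub>R u) + \<alpha> t"
    using upper by (simp add: AE_ball_countable[OF X(1)])
  then show ?thesis
    using AE_space
  proof eventually_elim
    case (elim t)
    then have t: "t \<in> {0..T}" by simp
    have cont: "continuous_on UNIV (\<lambda>u. H t u - G (\<Lambda> *\<^sub>R u))"
      by (intro continuous_intros continuous_at_time t continuous_on_compose2[OF G_cont]) auto
    have all: "H t u \<le> G (\<Lambda> *\<^sub>R u) + \<alpha> t" for u
    proof -
      have "closed {u. H t u - G (\<Lambda> *\<^sub>R u) \<le> \<alpha> t}"
        by (intro closed_Collect_le cont continuous_on_const)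
      moreover have "X \<subseteq> {u. H t u - G (\<Lambda> *\<^sub>R u) \<le> \<alpha> t}"
        using elim by auto
      ultimately have "closure X \<subseteq> {u. H t u - G (\<Lambda> *\<^sub>R u) \<le> \<alpha> t}"
        by (rule closure_minimal[rotated])
      then have "u \<in> {u. H t u - G (\<Lambda> *\<^sub>R u) \<le> \<alpha> t}"
        using X(2) by auto
      then show ?thesis by simp
    qed
    show ?case
    proof
      fix w
      \<comment> \<open>Substituting u / \<Lambda> removes the dilation inside G and puts the factor
        1 / \<Lambda> on the dual variable.\<close>
      have "convex_conjugate G (inverse \<Lambda> *\<^sub>R w) \<le> convex_conjugate (H t) w + \<alpha> t"
      proof (rule conjugate_le)
        fix u
        show "u \<bullet> (inverse \<Lambda> *\<^sub>R w) - G u \<le> convex_conjugate (H t) w + \<alpha> t"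
          using Fenchel[OF t, of "inverse \<Lambda> *\<^sub>R u" w] all[of "inverse \<Lambda> *\<^sub>R u"] \<Lambda> by simp
      qed
      then show "convex_conjugate G (inverse \<Lambda> *\<^sub>R w) - \<alpha> t \<le> convex_conjugate (H t) w"
        by simp
    qed
  qed
qed

end

text \<open>A nonconstant v competes in the infimum that defines \<open>C_const\<close>, so its
  quotient is at least -2 \<mu>; multiplying by the denominator gives the claim. Constants, which
  the infimum excludes, have form 0.\<close>

lemma form_lower_of_C_const:
  fixes F :: "real ^ ('n::finite + 'n) \<Rightarrow> real"
  assumes T: "0 < T" and F: "continuous_on UNIV F" "\<And>w. 0 \<le> F w"
    and \<mu>: "0 \<le> \<mu>" "C_const F T \<le> ereal (2 * \<mu>)"
    and v: "abs_continuous_on 0 T v" "v 0 = v T"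
    and int: "integrable (lebesgue_on {0..T}) (\<lambda>t. F (T *\<^sub>R time_deriv T v t))"
  shows "- \<mu> * (LINT t|lebesgue_on {0..T}. F (T *\<^sub>R time_deriv T v t))
    \<le> 1 / 2 * skew_structure.symp_form (\<lambda>x. symplectic_J *v x) T v v"
proof -
  interpret skew_structure "\<lambda>x :: real ^ ('n + 'n). symplectic_J *v x"
    by (rule skew_structure_symplectic_J)
  define d where "d = (LINT t|lebesgue_on {0..T}. F (T *\<^sub>R time_deriv T v t))"
  have d: "d \<ge> 0"
    unfolding d_def using F(2) by (intro Bochner_Integration.integral_nonneg) auto
  have nn: "(\<integral>\<^sup>+t. ennreal (F (T *\<^sub>R time_deriv T v t)) \<partial>lebesgue_on {0..T}) = ennreal d"
    unfolding d_def using int F(2) by (intro nn_integral_eq_integral) auto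
  show ?thesis
  proof (cases "v constant_on {0..T}")
    case True
    then obtain c where c: "\<And>t. t \<in> {0..T} \<Longrightarrow> v t = c" by (auto simp: constant_on_def)
    have "symp_form T v v = symp_form T v (\<lambda>_. c)"
      unfolding symp_form_def by (rule Bochner_Integration.integral_cong) (auto simp: c)
    then show ?thesis
      using symp_form_const[OF T v, of c] d \<mu>(1) by (simp add: d_def)
  next
    case False
    have "v \<in> orlicz T F"
      by (rule orlicz_continuous[OF abs_continuous_continuous[OF v(1)] F(1)])
    \<comment> \<open>The factor T inside the denominator witnesses membership in the Orlicz
      class.\<close>
    moreover have "time_deriv T v \<in> orlicz T F"
      unfolding orlicz_def
      using T nn borel_measurable_integrable[OF abs_continuous_integrable_deriv[OF T v(1)]]
      by (auto intro!: exI[of _ T])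
    ultimately have "v \<in> {u \<in> W1L_per T F. \<not> u constant_on {0..T}}"
      using v False by (simp add: W1L_per_def W1L_def)
    then have "(INF u \<in> {u \<in> W1L_per T F. \<not> u constant_on {0..T}}.
       ereal (LINT t|lebesgue_on {0..T}. (symplectic_J *v time_deriv T u t) \<bullet> u t) /
       enn2ereal (\<integral>\<^sup>+t. ennreal (F (T *\<^sub>R time_deriv T u t)) \<partial>lebesgue_on {0..T}))
      \<le> ereal (LINT t|lebesgue_on {0..T}. (symplectic_J *v time_deriv T v t) \<bullet> v t) /
       enn2ereal (\<integral>\<^sup>+t. ennreal (F (T *\<^sub>R time_deriv T v t)) \<partial>lebesgue_on {0..T})"
      by (rule INF_lower)
    then have "- C_const F T \<le> ereal (symp_form T v v) / ereal d"
      unfolding C_const_def nn symp_form_def using d by (simp add: enn2ereal_ennreal)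
    moreover have "- ereal (2 * \<mu>) \<le> - C_const F T"
      using \<mu>(2) by (simp only: ereal_minus_le_minus)
    ultimately have le: "ereal (- (2 * \<mu>)) \<le> ereal (symp_form T v v) / ereal d"
      by (metis order_trans uminus_ereal.simps(1))
    show ?thesis
    proof (cases "d = 0")
      \<comment> \<open>With denominator 0 the extended quotient of a negative number is
        -\<infinity>, which the finite lower bound rules out.\<close>
      case True
      have "0 \<le> symp_form T v v"
      proof (rule ccontr)
        assume "\<not> ?thesis"
        then have "ereal (symp_form T v v) / ereal d = - \<infinity>"
          using True by (simp add: divide_ereal_def)
        then show False
          using le by simp
      qed
      then show ?thesis
        using True by (simp add: d_def)
    next
      case False
      then have "- (2 * \<mu>) \<le> symp_form T v v / d"
        using le by simp
      then have "- (2 * \<mu>) * d \<le> symp_form T v v"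
        using d False by (simp add: pos_le_divide_eq)
      then show ?thesis
        by (simp add: d_def)
    qed
  qed
qed

section \<open>Extended-real action and real energy\<close>

context dual_problem
begin

lemma admissible_imp_W1L_per: "v \<in> admissible \<Longrightarrow> v \<in> W1L_per T F"
proof -
  assume v: "v \<in> admissible"
  then have ac: "abs_continuous_on 0 T v" and int: "integrable L (\<lambda>t. F (T *\<^sub>R D v t))"
    using admissible_integrable_F by (auto simp: admissible_def)
  have "(\<integral>\<^sup>+t. ennreal (F (T *\<^sub>R D v t)) \<partial>L) < \<infinity>"
    using int by (simp add: real_integrable_def top.not_eq_extremum)
  then have "D v \<in> orlicz T F"
    unfolding orlicz_def using T deriv_measurable[OF ac] by blast
  moreover have "v \<in> orlicz T F"
    by (rule orlicz_continuous[OF abs_continuous_continuous[OF ac] F_cont])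
  ultimately show ?thesis
    using v by (simp add: W1L_per_def W1L_def admissible_def)
qed

lemma integrable_form:
  assumes "abs_continuous_on 0 T v"
  shows "integrable L (\<lambda>t. 1 / 2 * (J (D v t) \<bullet> v t))"
  using integrable_inner_continuous[OF integrable_J_deriv[OF T assms] abs_continuous_continuous[OF assms]]
  by simp

lemma action_integrable_iff:
  assumes "abs_continuous_on 0 T v"
  shows "integrable L (\<lambda>t. 1 / 2 * (J (D v t) \<bullet> v t)  + H_star t (D v t))
    \<longleftrightarrow> integrable L (\<lambda>t. H_star t (D v t))" (is "?l \<longleftrightarrow> ?r")
proof -
  note i = integrable_form[OF assms]
  show ?thesis
  proof
    assume ?l
    from Bochner_Integration.integrable_diff[OF this i] show ?r by simp
  next
    assume ?r
    from Bochner_Integration.integrable_add[OF i this] show ?l by simp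
  qed
qed

lemma ext_integral_action:
  assumes "v \<in> admissible"
  shows "ext_integral L (\<lambda>t. 1 / 2 * (J (D v t) \<bullet> v t) + H_star t (D v t)) = ereal (energy v)"
proof -
  have ac: "abs_continuous_on 0 T v" and int: "integrable L (\<lambda>t. H_star t (D v t))"
    using assms by (auto simp: admissible_def)
  note i = integrable_form[OF ac]
  have "(LINT t|L. 1 / 2 * (J (D v t) \<bullet> v t) + H_star t (D v t)) = energy v"
    using Bochner_Integration.integral_add[OF i int] by (simp add: energy_def symp_form_def)
  then show ?thesis
    using ext_integral_integrable[OF action_integrable_iff[OF ac, THEN iffD2, OF int]] by (simp only:)
qed

text \<open>Fenchel's inequality at 0 dominates the negative part of the integrand by an integrable
  function. With \<open>ext_integral_action\<close>, the action equals the energy on admissible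
  functions and is \<infinity> on the rest of the Sobolev space, so minimizing one is minimizing the
  other.\<close>

lemma admissible_of_finite_action:
  assumes v: "v \<in> W1L_per T F"
    and less: "ext_integral L (\<lambda>t. 1 / 2 * (J (D v t) \<bullet> v t) + H_star t (D v t)) < \<infinity>"
  shows "v \<in> admissible"
proof -
  have ac: "abs_continuous_on 0 T v" and per: "v 0 = v T"
    using v by (auto simp: W1L_per_def W1L_def)
  note i = integrable_form[OF ac]
  have "integrable L (\<lambda>t. 1 / 2 * (J (D v t) \<bullet> v t) + H_star t (D v t))"
  proof (rule integrable_of_ext_integral_less[OF _ _ _ less])
    show "(\<lambda>t. 1 / 2 * (J (D v t) \<bullet> v t) + H_star t (D v t)) \<in> borel_measurable L"
      using T by (intro borel_measurable_add borel_measurable_integrable[OF i]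
          measurable_Caratheodory[OF _ continuous_conjugate deriv_measurable[OF ac]]) simp
    show "integrable L (\<lambda>t. \<bar>1 / 2 * (J (D v t) \<bullet> v t)\<bar> + H t 0)"
      using i integrable_H_zero by (intro Bochner_Integration.integrable_add integrable_abs)
    show "- (1 / 2 * (J (D v t) \<bullet> v t) + H_star t (D v t))
        \<le> \<bar>1 / 2 * (J (D v t) \<bullet> v t)\<bar> + H t 0" if "t \<in> space L" for t
      using Fenchel[of t 0 "D v t"] that by simp
  qed
  then show ?thesis
    using action_integrable_iff[OF ac] ac per by (simp add: admissible_def)
qed

end

section \<open>From the minimizer to a periodic solution\<close>

theorem theorem5p1:
  fixes T :: real
    and G :: "real ^ ('n::finite + 'n) \<Rightarrow> real"
    and H :: "real \<Rightarrow> real ^ ('n + 'n) \<Rightarrow> real"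
  assumes T_pos: "T > 0"
    and G_fun: "G_function G"
    and G_Gamma: "G \<in> Gamma_class"
    and G_conj_symp: "semi_symplectic (convex_conjugate G)"
    and G_conj_Delta2: "Delta2 (convex_conjugate G)"
    and H_C1: "C1_on ({0..T} \<times> UNIV) (\<lambda>(t, u). H t u)"
    and H_Gamma: "\<forall>t\<in>{0..T}. H t \<in> Gamma_class"
    and lower: "\<exists>\<xi> \<in> orlicz T (convex_conjugate G).
      \<forall>u. AE t in lebesgue_on {0..T}. H t u \<ge> \<xi> t \<bullet> u"
    and upper: "\<exists>\<Lambda>>0. ereal (inverse \<Lambda>) > ereal T * max 1 (C_const (convex_conjugate G) T / 2) \<and>
      (\<exists>\<alpha> :: real \<Rightarrow> real. integrable (lebesgue_on {0..T}) \<alpha> \<and>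
        (\<forall>u. AE t in lebesgue_on {0..T}. H t u \<le> G (\<Lambda> *\<^sub>R u) + \<alpha> t))"
    and coercive: "filterlim (\<lambda>u. LINT t|lebesgue_on {0..T}. H t u) at_top at_infinity"
  shows "\<exists>u \<in> W1L_per T G.
    (AE t in lebesgue_on {0..T}.
      (u has_vector_derivative symplectic_J *v gradient (H t) (u t)) (at t within {0..T})) \<and>
    u 0 = u T \<and>
    (let u_mean = (1 / T) *\<^sub>R (LINT t|lebesgue_on {0..T}. u t);
         v = (\<lambda>t. - (symplectic_J *v (u t - u_mean)))
     in is_arg_min (dual_action T H) (\<lambda>w. w \<in> W1L_per T (convex_conjugate G)) v)"
proof -
  let ?F = "convex_conjugate G"
  obtain \<Lambda> \<alpha> where \<Lambda>: "\<Lambda> > 0" "ereal (inverse \<Lambda>) > ereal T * max 1 (C_const ?F T / 2)"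
    and \<alpha>: "integrable (lebesgue_on {0..T}) \<alpha>"
    and up: "\<And>u. AE t in lebesgue_on {0..T}. H t u \<le> G (\<Lambda> *\<^sub>R u) + \<alpha> t"
    using upper by blast
  have G_cont: "continuous_on UNIV G"
    using G_Gamma by (auto simp: Gamma_class_def intro: differentiable_imp_continuous_on)
  interpret G_conjugate G
    by unfold_locales (rule G_fun, rule G_cont)
  obtain f' where
    "\<forall>x\<in>{0..T} \<times> UNIV. ((\<lambda>(t, u). H t u) has_derivative blinfun_apply (f' x)) (at x within {0..T} \<times> UNIV)"
    using H_C1 unfolding C1_on_def by blast
  then have H_cont: "continuous_on ({0..T} \<times> UNIV) (\<lambda>(t, u). H t u)"
    by (intro has_derivative_continuous_on[where f' = "\<lambda>x. blinfun_apply (f' x)"]) blast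
  have family: "superlinear_family {0..T} H"
    by unfold_locales (use H_cont H_Gamma in \<open>auto simp: Gamma_class_def\<close>)
  \<comment> \<open>Dilating T w by \<rho> gives w / \<Lambda>, the argument produced by conjugating
    the upper bound.\<close>
  define \<rho> where "\<rho> = inverse \<Lambda> / T"
  \<comment> \<open>The maximum is a real number: it is at least 1, and the strict inequality in
    condition (2) excludes \<infinity>.\<close>
  obtain \<mu> where \<mu>: "max 1 (C_const ?F T / 2) = ereal \<mu>"
  proof (cases "max 1 (C_const ?F T / 2)")
    case (real r)
    then show ?thesis by (rule that)
  next
    case PInf
    then show ?thesis
      using \<Lambda>(2) T_pos by simp
  next
    case MInf
    then show ?thesis
      using max.cobounded1[of 1 "C_const ?F T / 2"] by simp
  qed
  have "T * \<mu> < inverse \<Lambda>"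
    using \<Lambda>(2) unfolding \<mu> by simp
  then have \<mu>\<rho>: "\<mu> < \<rho>"
    using T_pos by (simp add: \<rho>_def pos_less_divide_eq mult.commute)
  have \<mu>1: "1 \<le> \<mu>"
    using max.cobounded1[of 1 "C_const ?F T / 2"] unfolding \<mu> by simp
  have C: "C_const ?F T \<le> ereal (2 * \<mu>)"
  proof -
    have "C_const ?F T / 2 \<le> ereal \<mu>"
      using max.cobounded2[of "C_const ?F T / 2" 1] unfolding \<mu> by simp
    then show ?thesis
      by (cases "C_const ?F T") auto
  qed
  have conj_lower: "AE t in lebesgue_on {0..T}. \<forall>w. \<rho> * ?F (T *\<^sub>R w) - \<alpha> t \<le> convex_conjugate (H t) w"
    using conjugate_lower_bound[OF family \<Lambda>(1) up]
  proof eventually_elim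
    case (elim t)
    show ?case
    proof
      fix w
      have "\<rho> * ?F (T *\<^sub>R w) \<le> ?F (\<rho> *\<^sub>R (T *\<^sub>R w))"
        by (rule conjugate_scale) (use \<mu>\<rho> \<mu>1 in simp)
      also have "\<rho> *\<^sub>R (T *\<^sub>R w) = inverse \<Lambda> *\<^sub>R w"
        using T_pos by (simp add: \<rho>_def)
      finally show "\<rho> * ?F (T *\<^sub>R w) - \<alpha> t \<le> convex_conjugate (H t) w"
        using elim by (meson diff_right_mono order_trans)
    qed
  qed
  have J: "skew_structure (\<lambda>x :: real ^ ('n + 'n). symplectic_J *v x)"
    by (rule skew_structure_symplectic_J)
  interpret dual_problem "\<lambda>x. symplectic_J *v x" T H ?F \<alpha> \<rho> \<mu>
  proof (intro dual_problem.intro J family dual_problem_axioms.intro)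
    show "0 < T" by (rule T_pos)
    show "continuous_on UNIV ?F" by (rule conjugate_continuous)
    show "0 \<le> ?F w" for w by (rule conjugate_nonneg)
    show "\<exists>C. \<forall>w. M * norm w - C \<le> ?F w" for M by (rule conjugate_lower)
    show "0 < \<rho>" using \<mu>1 \<mu>\<rho> by simp
    show "\<mu> < \<rho>" by (rule \<mu>\<rho>)
    show "integrable (lebesgue_on {0..T}) \<alpha>" by (rule \<alpha>)
    show "AE t in lebesgue_on {0..T}. \<forall>w. \<rho> * ?F (T *\<^sub>R w) - \<alpha> t \<le> convex_conjugate (H t) w"
      by (rule conj_lower)
    have "0 \<le> \<mu>"
      using \<mu>1 by simp
    then show "- \<mu> * (LINT t|lebesgue_on {0..T}. ?F (T *\<^sub>R time_deriv T v t))
        \<le> 1 / 2 * skew_structure.symp_form (\<lambda>x. symplectic_J *v x) T v v"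
      if "abs_continuous_on 0 T v" "v 0 = v T"
        "integrable (lebesgue_on {0..T}) (\<lambda>t. ?F (T *\<^sub>R time_deriv T v t))" for v
      using form_lower_of_C_const[OF T_pos conjugate_continuous conjugate_nonneg _ C that] by blast
  qed
  obtain v where v: "v \<in> admissible" and min: "\<And>w. w \<in> admissible \<Longrightarrow> energy v \<le> energy w"
    by (rule minimizer_exists) (rule that)
  obtain c where c: "AE t in L. conj_max t (D v t) = symplectic_J *v v t + c"
    using Euler_Lagrange[OF v min] by blast
  \<comment> \<open>u is a.e. the maximizer at v'. By reciprocity v' is the gradient of H at u, and
    applying J to v' gives the derivative of u.\<close>
  define u where "u = (\<lambda>t. symplectic_J *v v t + c)"
  have v_ac: "abs_continuous_on 0 T v" and v_per: "v 0 = v T"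
    using v by (auto simp: admissible_def)
  have u_ac: "abs_continuous_on 0 T u"
    unfolding u_def by (intro abs_continuous_add abs_continuous_J v_ac abs_continuous_const)
  have u_cont: "continuous_on {0..T} u"
    by (rule abs_continuous_continuous[OF u_ac])
  obtain U where U: "\<And>t. t \<in> {0..T} \<Longrightarrow> norm (u t) \<le> U"
    using continuous_on_Icc_bounded[OF u_cont] by blast
  have U0: "0 \<le> U"
    using order_trans[OF norm_ge_zero U[of 0]] T_pos by simp
  \<comment> \<open>u is continuous, hence bounded, and it is the maximizer at v'. So v' is bounded
    and with it the derivative of u, which therefore lies in the Orlicz class of G whatever the
    growth of G.\<close>
  obtain B where B: "\<And>t w. t \<in> {0..T} \<Longrightarrow> norm (conj_max t w) \<le> U \<Longrightarrow> norm w \<le> B"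
    using norm_le_of_bounded_conj_max[OF U0] by blast
  have der: "AE t in L. D v t = gradient (H t) (u t) \<and> norm (D v t) \<le> B \<and>
      (u has_vector_derivative symplectic_J *v D v t) (at t within {0..T})"
    using c abs_continuous_AE_deriv[OF T_pos v_ac] AE_space
  proof eventually_elim
    case (elim t)
    then have t: "t \<in> {0..T}" and eq: "conj_max t (D v t) = u t" by (auto simp: u_def)
    have "H t differentiable (at (conj_max t (D v t)))"
      using H_Gamma t by (auto simp: Gamma_class_def differentiable_on_def)
    then have "D v t = gradient (H t) (u t)"
      using gradient_conj_max[OF t] eq by metis
    moreover have "norm (D v t) \<le> B"
      using B[OF t] U[OF t] eq by metis
    moreover have "(u has_vector_derivative symplectic_J *v D v t) (at t within {0..T})"
      using bounded_linear.has_vector_derivative[OF bounded_linear elim(2)]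
      by (simp add: u_def has_vector_derivative_add_const)
    ultimately show ?case by blast
  qed
  have "AE t in L. norm (D u t) \<le> B"
    using der AE_space
  proof eventually_elim
    case (elim t)
    then have "D u t = symplectic_J *v D v t"
      by (intro vector_derivative_within_closed_interval[OF T_pos]) auto
    then have "norm (D u t) = norm (D v t)" by (simp only: norm_J)
    then show ?case
      using elim by metis
  qed
  then have "D u \<in> orlicz T G"
    by (rule orlicz_bounded[OF deriv_measurable[OF u_ac] _ G_cont])
  then have u_W: "u \<in> W1L_per T G"
    using u_ac v_per orlicz_continuous[OF u_cont G_cont] by (simp add: W1L_per_def W1L_def u_def)
  \<comment> \<open>Since J squares to -1, the function in question differs from v by a constant,
    for every m, and translations leave the energy unchanged. The mean of u is one such m.\<close>
  have arg_min: "is_arg_min (dual_action T H) (\<lambda>w. w \<in> W1L_per T ?F) (\<lambda>t. - (symplectic_J *v (u t - m)))" for m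
  proof -
    define w where "w = (\<lambda>t. - (symplectic_J *v (u t - m)))"
    have "w = (\<lambda>t. v t + - (symplectic_J *v (c - m)))"
      by (rule ext) (simp add: w_def u_def linear_add[OF linear] linear_diff[OF linear] square)
    then have w: "w \<in> admissible" "energy w = energy v"
      using admissible_translate[OF v, of "- (symplectic_J *v (c - m))"] by (simp_all only:)
    show ?thesis
      unfolding w_def[symmetric] is_arg_min_def
    proof (intro conjI notI admissible_imp_W1L_per[OF w(1)])
      assume "\<exists>y. y \<in> W1L_per T ?F \<and> dual_action T H y < dual_action T H w"
      then obtain y where y: "y \<in> W1L_per T ?F" "dual_action T H y < dual_action T H w"
        by blast
      have eq: "dual_action T H w = ereal (energy v)"
        using ext_integral_action[OF w(1)] w(2) by (simp add: dual_action_def)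
      then have "dual_action T H y < \<infinity>"
        using less_trans[OF y(2), of "\<infinity>"] by simp
      then have y_adm: "y \<in> admissible"
        using admissible_of_finite_action[OF y(1)] by (simp add: dual_action_def)
      then have "dual_action T H y = ereal (energy y)"
        using ext_integral_action by (simp add: dual_action_def)
      then show False
        using y(2) eq min[OF y_adm] by simp
    qed
  qed
  show ?thesis
  proof (intro bexI[OF _ u_W] conjI)
    show "AE t in lebesgue_on {0..T}.
        (u has_vector_derivative symplectic_J *v gradient (H t) (u t)) (at t within {0..T})"
      using der by eventually_elim auto
    show "u 0 = u T"
      using v_per by (simp add: u_def)
    show "let u_mean = (1 / T) *\<^sub>R (LINT t|lebesgue_on {0..T}. u t);
         v = (\<lambda>t. - (symplectic_J *v (u t - u_mean)))
     in is_arg_min (dual_action T H) (\<lambda>w. w \<in> W1L_per T ?F) v"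
      unfolding Let_def by (rule arg_min)
  qed
qed

end
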